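(* There exists a family of unital associative $\mathbb{C}$-algebras $(A_a)_{a\in\mathbb{C}}$, parameterized by $\mathbb{C}$, namely $A_a := \mathbb{C}\langle x,y\rangle/(xay-ayx-x)$, such that $HCDim(A_a)=2$ for every $a\in\mathbb{C}$ with $a\neq 0$, and $HCDim(A_0)=1$.
   Context: All rings and algebras are unital and associative. $\mathbb{C}\langle x,y\rangle$ denotes the free associative $\mathbb{C}$-algebra on two generators $x,y$, and for $a\in\mathbb{C}$ (a scalar) $(xay-ayx-x)$ denotes the two-sided ideal generated by the element $a\,xy-a\,yx-x$. For a $\mathbb{C}$-algebra $A$ and an $(A,A)$-bimodule $M$, $HH^n(A,M)$ denotes the $n$-th Hochschild cohomology of $A$ (over $\mathbb{C}$) with coefficients in $M$. The Hochschild cohomological dimension $HCDim(A)$ of a $\mathbb{C}$-algebra $A$ is the largest natural number $n$ for which there exists an $(A,A)$-bimodule $M$ such that $HH^n(A,M)\not\cong 0$; if no such largest number exists, then $HCDim(A):=\infty$. *)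

theory Defs
  imports
    "HOL-Algebra.Algebra"
    "HOL-Algebra.Algebraic_Closure_Type"
    "HOL-Library.Poly_Mapping"
    "HOL-Library.Equipollence"
    "HOL-Library.Extended_Nat"
begin

section \<open>Associative algebras and their quotients\<close>

text \<open>The library locale \<^locale>\<open>algebra\<close> demands commutativity, so the unital associative,
  not necessarily commutative, notion is introduced here on the same record type.\<close>

locale assoc_algebra = module R A + ring A for R (structure) and A (structure) +
  assumes smult_mult_left:
      "\<lbrakk>c \<in> carrier R; x \<in> carrier A; y \<in> carrier A\<rbrakk>
        \<Longrightarrow> (c \<odot>\<^bsub>A\<^esub> x) \<otimes>\<^bsub>A\<^esub> y = c \<odot>\<^bsub>A\<^esub> (x \<otimes>\<^bsub>A\<^esub> y)"
    and smult_mult_right: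
      "\<lbrakk>c \<in> carrier R; x \<in> carrier A; y \<in> carrier A\<rbrakk>
        \<Longrightarrow> x \<otimes>\<^bsub>A\<^esub> (c \<odot>\<^bsub>A\<^esub> y) = c \<odot>\<^bsub>A\<^esub> (x \<otimes>\<^bsub>A\<^esub> y)"

text \<open>The quotient ring \<^term>\<open>A Quot I\<close> with the scalar action
  \<open>c \<odot> (I + x) = I + (c \<odot> x)\<close>, written in the style of \<^const>\<open>rcoset_mult\<close>.\<close>

definition quot_algebra :: "('k, 'a) module \<Rightarrow> 'a set \<Rightarrow> ('k, 'a set) module" where
  "quot_algebra A I =
     \<lparr>carrier = carrier (A Quot I), monoid.mult = monoid.mult (A Quot I), one = monoid.one (A Quot I),
      ring.zero = ring.zero (A Quot I), add = ring.add (A Quot I),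
      module.smult = \<lambda>c S. \<Union>x\<in>S. I +>\<^bsub>A\<^esub> (c \<odot>\<^bsub>A\<^esub> x)\<rparr>"

section \<open>Free algebras\<close>

datatype 'x free_monoid = Word (letters: "'x list")

instantiation free_monoid :: (type) monoid_add
begin

definition zero_free_monoid :: "'a free_monoid" where
  "0 = Word []"

definition plus_free_monoid :: "'a free_monoid \<Rightarrow> 'a free_monoid \<Rightarrow> 'a free_monoid" where
  "u + v = Word (letters u @ letters v)"

instance
  by standard (simp_all add: zero_free_monoid_def plus_free_monoid_def)

end

text \<open>Since concatenation is written additively, the convolution product that
  \<^theory>\<open>HOL-Library.Poly_Mapping\<close> puts on finitely supported functions on words is the
  product of noncommutative polynomials.\<close>

definition free_algebra :: "('k::comm_ring_1, 'x free_monoid \<Rightarrow>\<^sub>0 'k) module" where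
  "free_algebra =
     \<lparr>carrier = UNIV, monoid.mult = (*), one = 1, ring.zero = 0, add = (+),
      module.smult = \<lambda>c. Poly_Mapping.map ((*) c)\<rparr>"

definition free_gen :: "'x \<Rightarrow> ('x free_monoid \<Rightarrow>\<^sub>0 'k::comm_ring_1)" where
  "free_gen v = Poly_Mapping.single (Word [v]) 1"

section \<open>Hochschild cohomology\<close>

text \<open>As with \<^const>\<open>module.smult\<close>-modules in the library, the multiplicative fields inherited from
  \<^typ>\<open>'m ring\<close> play no role for bimodules.\<close>

record ('k, 'a, 'm) bimodule = "('k, 'm) module" +
  lact :: "'a \<Rightarrow> 'm \<Rightarrow> 'm"
  ract :: "'m \<Rightarrow> 'a \<Rightarrow> 'm"

text \<open>Bimodules over an \<open>R\<close>-algebra are \<open>R\<close>-central: both actions are \<open>R\<close>-bilinear for the one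
  \<open>R\<close>-module structure of \<open>M\<close>, i.e. these are the modules over the enveloping algebra.\<close>

locale bimodule = assoc_algebra R A + M: module R M
  for R :: "'k ring" (structure) and A :: "('k, 'a) module" (structure)
    and M :: "('k, 'a, 'm) bimodule" (structure) +
  assumes lact_closed:
      "\<lbrakk>a \<in> carrier A; m \<in> carrier M\<rbrakk> \<Longrightarrow> lact M a m \<in> carrier M"
    and lact_one: "m \<in> carrier M \<Longrightarrow> lact M \<one>\<^bsub>A\<^esub> m = m"
    and lact_mult: "\<lbrakk>a \<in> carrier A; b \<in> carrier A; m \<in> carrier M\<rbrakk>
        \<Longrightarrow> lact M (a \<otimes>\<^bsub>A\<^esub> b) m = lact M a (lact M b m)"
    and lact_add_left: "\<lbrakk>a \<in> carrier A; b \<in> carrier A; m \<in> carrier M\<rbrakk>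
        \<Longrightarrow> lact M (a \<oplus>\<^bsub>A\<^esub> b) m = lact M a m \<oplus>\<^bsub>M\<^esub> lact M b m"
    and lact_add_right: "\<lbrakk>a \<in> carrier A; m \<in> carrier M; m' \<in> carrier M\<rbrakk>
        \<Longrightarrow> lact M a (m \<oplus>\<^bsub>M\<^esub> m') = lact M a m \<oplus>\<^bsub>M\<^esub> lact M a m'"
    and lact_smult_left: "\<lbrakk>c \<in> carrier R; a \<in> carrier A; m \<in> carrier M\<rbrakk>
        \<Longrightarrow> lact M (c \<odot>\<^bsub>A\<^esub> a) m = c \<odot>\<^bsub>M\<^esub> lact M a m"
    and lact_smult_right: "\<lbrakk>c \<in> carrier R; a \<in> carrier A; m \<in> carrier M\<rbrakk>
        \<Longrightarrow> lact M a (c \<odot>\<^bsub>M\<^esub> m) = c \<odot>\<^bsub>M\<^esub> lact M a m"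
    and ract_closed:
      "\<lbrakk>a \<in> carrier A; m \<in> carrier M\<rbrakk> \<Longrightarrow> ract M m a \<in> carrier M"
    and ract_one: "m \<in> carrier M \<Longrightarrow> ract M m \<one>\<^bsub>A\<^esub> = m"
    and ract_mult: "\<lbrakk>a \<in> carrier A; b \<in> carrier A; m \<in> carrier M\<rbrakk>
        \<Longrightarrow> ract M m (a \<otimes>\<^bsub>A\<^esub> b) = ract M (ract M m a) b"
    and ract_add_right: "\<lbrakk>a \<in> carrier A; b \<in> carrier A; m \<in> carrier M\<rbrakk>
        \<Longrightarrow> ract M m (a \<oplus>\<^bsub>A\<^esub> b) = ract M m a \<oplus>\<^bsub>M\<^esub> ract M m b"
    and ract_add_left: "\<lbrakk>a \<in> carrier A; m \<in> carrier M; m' \<in> carrier M\<rbrakk>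
        \<Longrightarrow> ract M (m \<oplus>\<^bsub>M\<^esub> m') a = ract M m a \<oplus>\<^bsub>M\<^esub> ract M m' a"
    and ract_smult_right: "\<lbrakk>c \<in> carrier R; a \<in> carrier A; m \<in> carrier M\<rbrakk>
        \<Longrightarrow> ract M m (c \<odot>\<^bsub>A\<^esub> a) = c \<odot>\<^bsub>M\<^esub> ract M m a"
    and ract_smult_left: "\<lbrakk>c \<in> carrier R; a \<in> carrier A; m \<in> carrier M\<rbrakk>
        \<Longrightarrow> ract M (c \<odot>\<^bsub>M\<^esub> m) a = c \<odot>\<^bsub>M\<^esub> ract M m a"
    and lact_ract: "\<lbrakk>a \<in> carrier A; b \<in> carrier A; m \<in> carrier M\<rbrakk>
        \<Longrightarrow> ract M (lact M a m) b = lact M a (ract M m b)"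

definition tuples :: "('k, 'a) module \<Rightarrow> nat \<Rightarrow> 'a list set" where
  "tuples A n = {as. set as \<subseteq> carrier A \<and> length as = n}"

text \<open>Hochschild \<open>n\<close>-cochains: \<open>R\<close>-multilinear maps \<open>A\<^sup>n \<rightarrow> M\<close>, i.e. linear maps on the
  \<open>n\<close>-th tensor power; they are made extensional so that equality is equality on tuples.\<close>

definition hochschild_cochains ::
    "'k ring \<Rightarrow> ('k, 'a) module \<Rightarrow> ('k, 'a, 'm) bimodule \<Rightarrow> nat \<Rightarrow> ('a list \<Rightarrow> 'm) set" where
  "hochschild_cochains R A M n =
     {f \<in> tuples A n \<rightarrow>\<^sub>E carrier M.
        (\<forall>as\<in>tuples A n. \<forall>i<n. \<forall>b\<in>carrier A.
           f (as[i := as ! i \<oplus>\<^bsub>A\<^esub> b]) = f as \<oplus>\<^bsub>M\<^esub> f (as[i := b])) \<and>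
        (\<forall>as\<in>tuples A n. \<forall>i<n. \<forall>c\<in>carrier R.
           f (as[i := c \<odot>\<^bsub>A\<^esub> as ! i]) = c \<odot>\<^bsub>M\<^esub> f as)}"

definition hochschild_cochain_group ::
    "'k ring \<Rightarrow> ('k, 'a) module \<Rightarrow> ('k, 'a, 'm) bimodule \<Rightarrow> nat \<Rightarrow> ('a list \<Rightarrow> 'm) monoid" where
  "hochschild_cochain_group R A M n =
     \<lparr>carrier = hochschild_cochains R A M n,
      monoid.mult = \<lambda>f g. \<lambda>as\<in>tuples A n. f as \<oplus>\<^bsub>M\<^esub> g as,
      one = \<lambda>as\<in>tuples A n. \<zero>\<^bsub>M\<^esub>\<rparr>"

text \<open>On a tuple \<open>a\<^sub>1, \<dots>, a\<^sub>N\<close> the faces are \<open>a\<^sub>1 f(a\<^sub>2, \<dots>, a\<^sub>N)\<close> for \<open>i = 0\<close>,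
  \<open>f(a\<^sub>1, \<dots>, a\<^sub>i a\<^sub>i\<^sub>+\<^sub>1, \<dots>, a\<^sub>N)\<close> for \<open>0 < i < N\<close>, and \<open>f(a\<^sub>1, \<dots>, a\<^sub>N\<^sub>-\<^sub>1) a\<^sub>N\<close> for \<open>i = N\<close>.
  List positions count from 0, so \<open>a\<^sub>i\<close> is \<open>as ! (i - 1)\<close>.\<close>

definition hochschild_face ::
    "('k, 'a) module \<Rightarrow> ('k, 'a, 'm) bimodule \<Rightarrow> nat \<Rightarrow> ('a list \<Rightarrow> 'm) \<Rightarrow> 'a list \<Rightarrow> 'm" where
  "hochschild_face A M i f as =
     (if i = 0 then lact M (hd as) (f (tl as))
      else if i = length as then ract M (f (butlast as)) (last as)
      else f (take (i - 1) as @ [as ! (i - 1) \<otimes>\<^bsub>A\<^esub> as ! i] @ drop (i + 1) as))"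

definition hochschild_diff ::
    "('k, 'a) module \<Rightarrow> ('k, 'a, 'm) bimodule \<Rightarrow> nat \<Rightarrow> ('a list \<Rightarrow> 'm) \<Rightarrow> 'a list \<Rightarrow> 'm" where
  "hochschild_diff A M n f =
     (\<lambda>as\<in>tuples A (Suc n).
        \<Oplus>\<^bsub>M\<^esub>i\<in>{..Suc n}. add_pow M ((- 1) ^ i :: int) (hochschild_face A M i f as))"

definition hochschild_cocycles ::
    "'k ring \<Rightarrow> ('k, 'a) module \<Rightarrow> ('k, 'a, 'm) bimodule \<Rightarrow> nat \<Rightarrow> ('a list \<Rightarrow> 'm) set" where
  "hochschild_cocycles R A M n =
     {f \<in> hochschild_cochains R A M n.
        hochschild_diff A M n f = \<one>\<^bsub>hochschild_cochain_group R A M (Suc n)\<^esub>}"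

fun hochschild_coboundaries ::
    "'k ring \<Rightarrow> ('k, 'a) module \<Rightarrow> ('k, 'a, 'm) bimodule \<Rightarrow> nat \<Rightarrow> ('a list \<Rightarrow> 'm) set" where
  "hochschild_coboundaries R A M 0 = {\<one>\<^bsub>hochschild_cochain_group R A M 0\<^esub>}"
| "hochschild_coboundaries R A M (Suc n) =
     hochschild_diff A M n ` hochschild_cochains R A M n"

text \<open>Only the additive group of the \<open>R\<close>-module \<open>HH\<^sup>n(A, M)\<close> is formed (HOL-Algebra writes
  groups multiplicatively); this suffices for speaking about its vanishing.\<close>

definition HH ::
    "'k ring \<Rightarrow> ('k, 'a) module \<Rightarrow> ('k, 'a, 'm) bimodule \<Rightarrow> nat \<Rightarrow> ('a list \<Rightarrow> 'm) set monoid" where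
  "HH R A M n =
     (hochschild_cochain_group R A M n)\<lparr>carrier := hochschild_cocycles R A M n\<rparr>
       Mod hochschild_coboundaries R A M n"

text \<open>The type argument is the universe from which the carriers of the bimodules \<open>M\<close> are taken,
  as HOL cannot quantify over types. If \<open>A\<close> is a complex algebra of countable dimension, then any
  universe with at least continuum many elements gives the same value: a cocycle with values in an
  arbitrary \<open>M\<close> that is not a coboundary has values in the subbimodule generated by its values
  on tuples of basis elements, and is not a coboundary there; this subbimodule has countable
  dimension and hence at most continuum many elements.\<close>

definition HH_nonzero_degree ::
    "'m itself \<Rightarrow> 'k ring \<Rightarrow> ('k, 'a) module \<Rightarrow> nat \<Rightarrow> bool" where
  "HH_nonzero_degree (_ :: 'm itself) R A n \<longleftrightarrow>
     (\<exists>M :: ('k, 'a, 'm) bimodule. bimodule R A M \<and> \<not> trivial_group (HH R A M n))"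

definition HCDim :: "'m itself \<Rightarrow> 'k ring \<Rightarrow> ('k, 'a) module \<Rightarrow> enat" where
  "HCDim U R A =
     (if \<exists>n. HH_nonzero_degree U R A n \<and> (\<forall>m. HH_nonzero_degree U R A m \<longrightarrow> m \<le> n)
      then enat (GREATEST n. HH_nonzero_degree U R A n) else \<infinity>)"

section \<open>The family of algebras\<close>

abbreviation complex_ring :: "complex ring" where
  "complex_ring \<equiv> ring_of_type_algebra"

datatype generator = Gen_x | Gen_y

abbreviation free_xy :: "(complex, generator free_monoid \<Rightarrow>\<^sub>0 complex) module" where
  "free_xy \<equiv> free_algebra"

definition xy_relator :: "complex \<Rightarrow> (generator free_monoid \<Rightarrow>\<^sub>0 complex)" where
  "xy_relator a =
     (let x = free_gen Gen_x; y = free_gen Gen_y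
      in a \<odot>\<^bsub>free_xy\<^esub> (x \<otimes>\<^bsub>free_xy\<^esub> y) \<ominus>\<^bsub>free_xy\<^esub> a \<odot>\<^bsub>free_xy\<^esub> (y \<otimes>\<^bsub>free_xy\<^esub> x) \<ominus>\<^bsub>free_xy\<^esub> x)"

definition A_family :: "complex \<Rightarrow> (complex, (generator free_monoid \<Rightarrow>\<^sub>0 complex) set) module" where
  "A_family a = quot_algebra free_xy (Idl\<^bsub>free_xy\<^esub> {xy_relator a})"

end

theory Submission
  imports Defs
begin

text \<open>Let \<open>A\<close> be an algebra and \<open>M\<close> a bimodule. The \<open>k\<close>-cochains form a left \<open>A\<close>-module
  \<open>C\<^sup>k\<close> by acting on values, and they carry the right action
  \<open>(f \<cdot> a)(a\<^sub>1, \<dots>, a\<^sub>k) = f(a a\<^sub>1, a\<^sub>2, \<dots>) - f(a, a\<^sub>1 a\<^sub>2, \<dots>) + \<dots> \<plusminus> f(a, a\<^sub>1, \<dots>) a\<^sub>k\<close>,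
  chosen such that \<open>(df)(a, \<dots>) = a f - f \<cdot> a\<close>. The right action is associative, although \<open>1\<close> does not
  act as the identity when \<open>k > 0\<close>. In these terms a \<open>(k + 2)\<close>-cocycle with values in \<open>M\<close> is a 2-cocycle
  \<open>A \<times> A \<rightarrow> C\<^sup>k\<close>, and vanishing in all high degrees is a statement about 2-cocycles with values in
  such one-sided unital bimodules \<open>N\<close>.

  A 2-cocycle describes a square-zero extension of \<open>A\<close> by \<open>N\<close>, and it is a coboundary when this
  extension has a section. As \<open>A\<^sub>a\<close> is given by the generators \<open>x, y\<close> and the single relation
  \<open>a x y = a y x + x\<close>, a section is the same as a choice of lifts \<open>(x, n\<^sub>x)\<close>, \<open>(y, n\<^sub>y)\<close> that satisfy the
  relation; this is \<open>two_cocycle_splits\<close>. The argument uses the universal property of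
  \<open>A\<^sub>a\<close> and induction along left multiplication by generators in place of a basis.

  For \<open>a = 0\<close> the relation says \<open>x = 0\<close> and holds for the lift \<open>n\<^sub>x = 0\<close>, so \<open>HH\<^sup>n = 0\<close> for
  \<open>n \<ge> 2\<close>. For \<open>a \<noteq> 0\<close> and \<open>N = C\<^sup>k\<^sup>+\<^sup>1\<close>, that is \<open>N = Hom(A, C\<^sup>k)\<close>, the relation for the lifts becomes
  an equation \<open>n(x c) = x n(c) + K(c)\<close> for \<open>n\<close>. It can be solved because left multiplication by \<open>x\<close>
  has a locally nilpotent left inverse on \<open>A\<^sub>a\<close> (\<open>left_division_by_x\<close>, \<open>left_x_recursion\<close>). Hence
  \<open>HH\<^sup>n = 0\<close> for \<open>n \<ge> 3\<close>.

  In the other direction one-dimensional bimodules suffice. The derivation \<open>\<beta>\<close> with \<open>\<beta>(x) = 0\<close>,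
  \<open>\<beta>(y) = 1\<close> is a 1-cocycle with values in the trivial bimodule, where all inner derivations vanish.
  For \<open>a \<noteq> 0\<close> let \<open>y\<close> act by \<open>- 1 / a\<close> on the left and by \<open>0\<close> on the right of \<open>\<complex>\<close>, and \<open>x\<close> by \<open>0\<close>.
  Then every 2-coboundary takes the same value on \<open>(x, y)\<close> and \<open>(y, x)\<close>, which fails for the product
  \<open>\<alpha>(b) \<beta>(c)\<close> of \<open>\<beta>\<close> with a skew derivation \<open>\<alpha>\<close> such that \<open>\<alpha>(x) = 1\<close>, \<open>\<alpha>(y) = 0\<close>.\<close>

section \<open>Linear maps and products of modules\<close>

definition linear_maps :: "('k, 'c) ring_scheme \<Rightarrow> ('k, 'v, 'd) module_scheme \<Rightarrow> ('k, 'w, 'e) module_scheme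
    \<Rightarrow> ('v \<Rightarrow> 'w) set" where
  "linear_maps R V W = {f \<in> carrier V \<rightarrow> carrier W.
     (\<forall>u\<in>carrier V. \<forall>v\<in>carrier V. f (u \<oplus>\<^bsub>V\<^esub> v) = f u \<oplus>\<^bsub>W\<^esub> f v) \<and>
     (\<forall>c\<in>carrier R. \<forall>v\<in>carrier V. f (c \<odot>\<^bsub>V\<^esub> v) = c \<odot>\<^bsub>W\<^esub> f v)}"

lemma linear_mapsI:
  assumes "\<And>v. v \<in> carrier V \<Longrightarrow> f v \<in> carrier W"
    and "\<And>u v. u \<in> carrier V \<Longrightarrow> v \<in> carrier V \<Longrightarrow> f (u \<oplus>\<^bsub>V\<^esub> v) = f u \<oplus>\<^bsub>W\<^esub> f v"
    and "\<And>c v. c \<in> carrier R \<Longrightarrow> v \<in> carrier V \<Longrightarrow> f (c \<odot>\<^bsub>V\<^esub> v) = c \<odot>\<^bsub>W\<^esub> f v"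
  shows "f \<in> linear_maps R V W"
  using assms by (simp add: linear_maps_def)

lemma linear_maps_closed: "f \<in> linear_maps R V W \<Longrightarrow> v \<in> carrier V \<Longrightarrow> f v \<in> carrier W"
  and linear_maps_add: "f \<in> linear_maps R V W \<Longrightarrow> u \<in> carrier V \<Longrightarrow> v \<in> carrier V
    \<Longrightarrow> f (u \<oplus>\<^bsub>V\<^esub> v) = f u \<oplus>\<^bsub>W\<^esub> f v"
  and linear_maps_smult: "f \<in> linear_maps R V W \<Longrightarrow> c \<in> carrier R \<Longrightarrow> v \<in> carrier V
    \<Longrightarrow> f (c \<odot>\<^bsub>V\<^esub> v) = c \<odot>\<^bsub>W\<^esub> f v"
  by (auto simp: linear_maps_def)

lemma linear_maps_zero:
  assumes "module R V" "module R W" "f \<in> linear_maps R V W"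
  shows "f \<zero>\<^bsub>V\<^esub> = \<zero>\<^bsub>W\<^esub>"
proof -
  interpret V: module R V by fact
  interpret W: module R W by fact
  have "f (\<zero>\<^bsub>R\<^esub> \<odot>\<^bsub>V\<^esub> \<zero>\<^bsub>V\<^esub>) = \<zero>\<^bsub>R\<^esub> \<odot>\<^bsub>W\<^esub> f \<zero>\<^bsub>V\<^esub>"
    by (rule linear_maps_smult[OF assms(3)]) simp_all
  then show ?thesis using assms(3) by (simp add: linear_maps_closed)
qed

lemma ring_of_type_algebra_simps [simp]:
  "carrier ring_of_type_algebra = UNIV" "\<one>\<^bsub>ring_of_type_algebra\<^esub> = 1"
  "\<zero>\<^bsub>ring_of_type_algebra\<^esub> = 0"
  "c \<oplus>\<^bsub>ring_of_type_algebra\<^esub> d = c + d" "c \<otimes>\<^bsub>ring_of_type_algebra\<^esub> d = c * d"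
  by (simp_all add: ring_of_type_algebra_def)

lemma (in abelian_group) minus_add_distrib2:
  assumes "u \<in> carrier G" "u' \<in> carrier G" "v \<in> carrier G" "v' \<in> carrier G"
  shows "(u \<oplus> u') \<ominus> (v \<oplus> v') = (u \<ominus> v) \<oplus> (u' \<ominus> v')"
  using assms by (simp add: a_minus_def minus_add a_ac)

lemma (in abelian_group) minus_minus_cancel:
  assumes "u \<in> carrier G" "v \<in> carrier G" "w \<in> carrier G"
  shows "(u \<ominus> w) \<ominus> (v \<ominus> w) = u \<ominus> v"
proof -
  have "(u \<ominus> w) \<ominus> (v \<ominus> w) = u \<ominus> v \<oplus> (\<ominus> w \<oplus> w)"
    using assms by (simp add: a_minus_def minus_add a_ac)
  then show ?thesis using assms by (simp add: l_neg)
qed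

lemma (in abelian_group) add_eq_imp_eq_minus:
  "u \<in> carrier G \<Longrightarrow> v \<in> carrier G \<Longrightarrow> u \<oplus> v = w \<Longrightarrow> u = w \<ominus> v"
  by (auto simp: a_minus_def a_assoc r_neg)

lemma (in abelian_group) minus_add_cancel:
  "u \<in> carrier G \<Longrightarrow> v \<in> carrier G \<Longrightarrow> (u \<ominus> v) \<oplus> v = u"
  by (simp add: a_minus_def a_assoc l_neg)

lemma (in module) smult_minus:
  "c \<in> carrier R \<Longrightarrow> u \<in> carrier M \<Longrightarrow> v \<in> carrier M \<Longrightarrow> c \<odot>\<^bsub>M\<^esub> (u \<ominus>\<^bsub>M\<^esub> v) = c \<odot>\<^bsub>M\<^esub> u \<ominus>\<^bsub>M\<^esub> c \<odot>\<^bsub>M\<^esub> v"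
  by (simp add: a_minus_def smult_r_distr smult_r_minus)

lemma (in abelian_group) minus_eq_zero_iff:
  "u \<in> carrier G \<Longrightarrow> v \<in> carrier G \<Longrightarrow> u \<ominus> v = \<zero> \<longleftrightarrow> u = v"
  by (metis minus_add_cancel a_minus_def l_zero r_neg)

definition prod_module :: "('k, 'v, 'd) module_scheme \<Rightarrow> ('k, 'w, 'e) module_scheme \<Rightarrow> ('k, 'v \<times> 'w) module" where
  "prod_module V W = \<lparr>carrier = carrier V \<times> carrier W, monoid.mult = undefined, one = undefined,
     ring.zero = (\<zero>\<^bsub>V\<^esub>, \<zero>\<^bsub>W\<^esub>), add = \<lambda>p q. (fst p \<oplus>\<^bsub>V\<^esub> fst q, snd p \<oplus>\<^bsub>W\<^esub> snd q),
     module.smult = \<lambda>c p. (c \<odot>\<^bsub>V\<^esub> fst p, c \<odot>\<^bsub>W\<^esub> snd p)\<rparr>"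

lemma prod_module_simps [simp]:
  "carrier (prod_module V W) = carrier V \<times> carrier W"
  "\<zero>\<^bsub>prod_module V W\<^esub> = (\<zero>\<^bsub>V\<^esub>, \<zero>\<^bsub>W\<^esub>)"
  "p \<oplus>\<^bsub>prod_module V W\<^esub> q = (fst p \<oplus>\<^bsub>V\<^esub> fst q, snd p \<oplus>\<^bsub>W\<^esub> snd q)"
  "c \<odot>\<^bsub>prod_module V W\<^esub> p = (c \<odot>\<^bsub>V\<^esub> fst p, c \<odot>\<^bsub>W\<^esub> snd p)"
  by (simp_all add: prod_module_def)

lemma module_prod_module:
  assumes "module R V" "module R W"
  shows "module R (prod_module V W)"
proof -
  interpret V: module R V by fact
  interpret W: module R W by fact
  have "abelian_group (prod_module V W)"
  proof (rule abelian_groupI)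
    fix p assume "p \<in> carrier (prod_module V W)"
    then show "\<exists>q\<in>carrier (prod_module V W). q \<oplus>\<^bsub>prod_module V W\<^esub> p = \<zero>\<^bsub>prod_module V W\<^esub>"
      by (intro bexI[of _ "(\<ominus>\<^bsub>V\<^esub> fst p, \<ominus>\<^bsub>W\<^esub> snd p)"]) (auto simp: V.M.l_neg W.M.l_neg)
  qed (auto simp: V.M.a_ac W.M.a_ac)
  then show ?thesis
    by (rule moduleI[OF V.R.is_cring])
      (auto simp: V.smult_l_distr W.smult_l_distr V.smult_r_distr W.smult_r_distr V.smult_assoc1 W.smult_assoc1)
qed

section \<open>The free algebra\<close>

lemma free_algebra_simps [simp]:
  "carrier free_algebra = UNIV" "\<one>\<^bsub>free_algebra\<^esub> = 1"
  "\<zero>\<^bsub>free_algebra\<^esub> = 0"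
  "p \<oplus>\<^bsub>free_algebra\<^esub> q = p + q" "p \<otimes>\<^bsub>free_algebra\<^esub> q = p * q"
  "c \<odot>\<^bsub>free_algebra\<^esub> p = Poly_Mapping.single 0 c * p"
  by (simp_all add: free_algebra_def mult_map_scale_conv_mult)

lemma poly_mapping_sum_single:
  fixes p :: "'a \<Rightarrow>\<^sub>0 'b::comm_monoid_add"
  shows "p = (\<Sum>k\<in>Poly_Mapping.keys p. Poly_Mapping.single k (Poly_Mapping.lookup p k))"
  by (rule poly_mapping_eqI)
    (simp add: lookup_sum lookup_single when_def sum.delta' in_keys_iff)

lemma poly_mapping_single_induct [case_names zero single add]:
  fixes p :: "'a \<Rightarrow>\<^sub>0 'b::comm_monoid_add"
  assumes "P 0" "\<And>k v. P (Poly_Mapping.single k v)" "\<And>p q. P p \<Longrightarrow> P q \<Longrightarrow> P (p + q)"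
  shows "P p"
proof -
  have "P (\<Sum>k\<in>K. Poly_Mapping.single k (Poly_Mapping.lookup p k))" if "finite K" for K
    using that by (induction K) (simp_all add: assms)
  from this[of "Poly_Mapping.keys p"] show ?thesis
    using poly_mapping_sum_single[of p] by simp
qed

text \<open>The coefficients commute although the words do not: the scalars sit on the empty word,
  which is neutral on both sides.\<close>

lemma single_0_central:
  fixes p :: "'x::monoid_add \<Rightarrow>\<^sub>0 'k::comm_ring_1"
  shows "Poly_Mapping.single 0 c * p = p * Poly_Mapping.single 0 c"
  by (induction p rule: poly_mapping_single_induct)
    (simp_all add: mult_single mult.commute distrib_left distrib_right)

lemma assoc_algebra_free_algebra:
  "assoc_algebra (ring_of_type_algebra :: 'k::comm_ring_1 ring)
     (free_algebra :: ('k, 'x free_monoid \<Rightarrow>\<^sub>0 'k) module)"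
proof -
  let ?F = "free_algebra :: ('k, 'x free_monoid \<Rightarrow>\<^sub>0 'k) module"
  have ag: "abelian_group ?F"
    by (rule abelian_groupI) (auto simp: add_ac intro: exI[of _ "- _"] add.left_inverse)
  have "ring ?F"
    by (rule ringI) (auto intro!: ag monoidI simp: mult.assoc distrib_left distrib_right)
  moreover have "module (ring_of_type_algebra :: 'k ring) ?F"
    by (rule moduleI[OF cring_from_type_algebra ag])
      (auto simp: single_add distrib_left distrib_right mult.assoc[symmetric] mult_single)
  ultimately show ?thesis
    by (intro assoc_algebra.intro assoc_algebra_axioms.intro)
      (simp_all add: mult.assoc single_0_central)
qed

lemma free_algebra_uminus: "\<ominus>\<^bsub>free_algebra\<^esub> p = - (p :: 'x free_monoid \<Rightarrow>\<^sub>0 'k::comm_ring_1)"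
proof -
  interpret assoc_algebra "ring_of_type_algebra :: 'k ring" "free_algebra :: ('k, 'x free_monoid \<Rightarrow>\<^sub>0 'k) module"
    by (rule assoc_algebra_free_algebra)
  show ?thesis by (rule M.minus_equality) simp_all
qed

section \<open>Modules over the free algebra\<close>

text \<open>A module over the free algebra is a module over the scalars with one endomorphism for each
  letter. The evaluation \<open>ev v\<close> sends a noncommutative polynomial to its action on \<open>v\<close>.\<close>

locale free_action = module K V
  for K :: "'k::comm_ring_1 ring" and V :: "('k, 'v, 'e) module_scheme" +
  fixes act :: "'x \<Rightarrow> 'v \<Rightarrow> 'v"
  assumes K_def: "K = ring_of_type_algebra"
    and act_linear: "act g \<in> linear_maps K V V"
begin

definition word_act :: "'x free_monoid \<Rightarrow> 'v \<Rightarrow> 'v" where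
  "word_act w = foldr act (letters w)"

definition ev :: "'v \<Rightarrow> ('x free_monoid \<Rightarrow>\<^sub>0 'k) \<Rightarrow> 'v" where
  "ev v p = (\<Oplus>\<^bsub>V\<^esub>w\<in>Poly_Mapping.keys p. Poly_Mapping.lookup p w \<odot>\<^bsub>V\<^esub> word_act w v)"

lemma K_simps [simp]: "carrier K = UNIV" "\<zero>\<^bsub>K\<^esub> = 0" "\<one>\<^bsub>K\<^esub> = 1"
    "c \<oplus>\<^bsub>K\<^esub> d = c + d" "c \<otimes>\<^bsub>K\<^esub> d = c * d"
  by (simp_all add: K_def)

lemma word_act_linear: "word_act w \<in> linear_maps K V V"
proof -
  have "foldr act us \<in> linear_maps K V V" for us
  proof (induction us)
    case Nil
    show ?case by (rule linear_mapsI) simp_all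
  next
    case (Cons g us)
    show ?case
      by (rule linear_mapsI)
       (simp_all add: linear_maps_closed[OF Cons] linear_maps_add[OF Cons] linear_maps_smult[OF Cons]
         linear_maps_closed[OF act_linear] linear_maps_add[OF act_linear] linear_maps_smult[OF act_linear])
  qed
  then show ?thesis by (simp add: word_act_def)
qed

lemmas word_act_closed [simp] = linear_maps_closed[OF word_act_linear]
lemmas word_act_add = linear_maps_add[OF word_act_linear]
lemmas word_act_smult = linear_maps_smult[OF word_act_linear]

lemma word_act_plus: "word_act (w + u) v = word_act w (word_act u v)"
  by (simp add: word_act_def plus_free_monoid_def)

lemma word_act_0 [simp]: "word_act 0 v = v"
  by (simp add: word_act_def zero_free_monoid_def)

lemma word_act_zero [simp]: "word_act w \<zero>\<^bsub>V\<^esub> = \<zero>\<^bsub>V\<^esub>"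
  using module_axioms word_act_linear by (intro linear_maps_zero[of K])

lemma ev_0 [simp]: "ev v 0 = \<zero>\<^bsub>V\<^esub>"
  by (simp add: ev_def)

lemma ev_closed [simp]: "v \<in> carrier V \<Longrightarrow> ev v p \<in> carrier V"
  by (auto simp: ev_def intro!: M.finsum_closed)

lemma ev_superset:
  assumes "v \<in> carrier V" "finite S" "Poly_Mapping.keys p \<subseteq> S"
  shows "ev v p = (\<Oplus>\<^bsub>V\<^esub>w\<in>S. Poly_Mapping.lookup p w \<odot>\<^bsub>V\<^esub> word_act w v)"
  unfolding ev_def using assms
  by (intro M.add.finprod_mono_neutral_cong_left) (auto simp: in_keys_iff smult_l_null[simplified])

lemma ev_single: "v \<in> carrier V \<Longrightarrow> ev v (Poly_Mapping.single w c) = c \<odot>\<^bsub>V\<^esub> word_act w v"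
  using ev_superset[of v "{w}" "Poly_Mapping.single w c"] by (simp add: M.finsum_insert)

lemma ev_add:
  assumes "v \<in> carrier V"
  shows "ev v (p + q) = ev v p \<oplus>\<^bsub>V\<^esub> ev v q"
proof -
  let ?S = "Poly_Mapping.keys p \<union> Poly_Mapping.keys q"
  have "ev v (p + q) = (\<Oplus>\<^bsub>V\<^esub>w\<in>?S. Poly_Mapping.lookup (p + q) w \<odot>\<^bsub>V\<^esub> word_act w v)"
    using assms by (intro ev_superset) (simp_all add: Poly_Mapping.keys_add)
  also have "\<dots> = (\<Oplus>\<^bsub>V\<^esub>w\<in>?S. Poly_Mapping.lookup p w \<odot>\<^bsub>V\<^esub> word_act w v \<oplus>\<^bsub>V\<^esub>
      Poly_Mapping.lookup q w \<odot>\<^bsub>V\<^esub> word_act w v)"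
    using assms by (intro M.finsum_cong') (auto simp: lookup_add smult_l_distr[simplified])
  also have "\<dots> = ev v p \<oplus>\<^bsub>V\<^esub> ev v q"
    using assms by (subst M.finsum_addf) (auto simp: ev_superset[of v ?S])
  finally show ?thesis .
qed

lemma ev_add_left: "u \<in> carrier V \<Longrightarrow> v \<in> carrier V \<Longrightarrow> ev (u \<oplus>\<^bsub>V\<^esub> v) p = ev u p \<oplus>\<^bsub>V\<^esub> ev v p"
  by (induction p rule: poly_mapping_single_induct)
    (auto simp: ev_add ev_single word_act_add smult_r_distr M.a_ac ev_def)

text \<open>This is the module law \<open>(p q) v = p (q v)\<close>; by additivity it reduces to a pair of words,
  where it is the composition of the letters.\<close>

lemma ev_mult: 
  assumes v: "v \<in> carrier V"
  shows "ev v (p * q) = ev (ev v q) p"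
proof (induction p rule: poly_mapping_single_induct)
  case (single w c)
  show ?case
  proof (induction q rule: poly_mapping_single_induct)
    case (single u d)
    show ?case using v
      by (simp add: ev_single mult_single word_act_plus word_act_smult smult_assoc1[simplified])
  next
    case (add q q')
    then show ?case using v by (simp add: distrib_left ev_add ev_add_left)
  qed (use v in \<open>simp add: ev_single\<close>)
next
  case (add p q)
  then show ?case using v by (simp add: distrib_right ev_add)
qed simp

lemma ev_linear:
  assumes v: "v \<in> carrier V"
  shows "ev v \<in> linear_maps K free_algebra V"
  by (rule linear_mapsI) (use v in \<open>simp_all add: ev_add ev_mult ev_single\<close>)

lemma ev_gen_mult: "v \<in> carrier V \<Longrightarrow> ev v (free_gen g * p) = act g (ev v p)"
  by (simp add: ev_mult free_gen_def ev_single word_act_def linear_maps_closed[OF act_linear] smult_one[simplified])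

lemma ev_one: "v \<in> carrier V \<Longrightarrow> ev v 1 = v"
  using ev_single[of v 0 1] by (simp add: smult_one[simplified])

end

section \<open>Quotient algebras\<close>

lemma quot_algebra_fields:
  "carrier (quot_algebra F I) = carrier (F Quot I)"
  "monoid.mult (quot_algebra F I) = monoid.mult (F Quot I)"
  "one (quot_algebra F I) = one (F Quot I)"
  "ring.zero (quot_algebra F I) = ring.zero (F Quot I)"
  "ring.add (quot_algebra F I) = ring.add (F Quot I)"
  by (simp_all add: quot_algebra_def)

locale algebra_ideal = assoc_algebra R F + ideal I F
  for R :: "'k ring" and F :: "('k, 'a) module" and I
begin

abbreviation Q where "Q \<equiv> quot_algebra F I"

lemma Q_carrier: "carrier Q = (\<lambda>p. I +>\<^bsub>F\<^esub> p) ` carrier F"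
  by (auto simp: quot_algebra_fields FactRing_simps)

lemma Q_one: "\<one>\<^bsub>Q\<^esub> = I +>\<^bsub>F\<^esub> \<one>\<^bsub>F\<^esub>"
  by (simp add: quot_algebra_fields FactRing_def)

lemma Q_zero: "\<zero>\<^bsub>Q\<^esub> = I +>\<^bsub>F\<^esub> \<zero>\<^bsub>F\<^esub>"
  by (simp add: quot_algebra_fields FactRing_def a_coset_add_zero a_subset)

lemma Q_add: "p \<in> carrier F \<Longrightarrow> q \<in> carrier F \<Longrightarrow>
    (I +>\<^bsub>F\<^esub> p) \<oplus>\<^bsub>Q\<^esub> (I +>\<^bsub>F\<^esub> q) = I +>\<^bsub>F\<^esub> (p \<oplus>\<^bsub>F\<^esub> q)"
  by (simp add: quot_algebra_fields FactRing_def a_rcos_sum)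

lemma Q_mult: "p \<in> carrier F \<Longrightarrow> q \<in> carrier F \<Longrightarrow>
    (I +>\<^bsub>F\<^esub> p) \<otimes>\<^bsub>Q\<^esub> (I +>\<^bsub>F\<^esub> q) = I +>\<^bsub>F\<^esub> (p \<otimes>\<^bsub>F\<^esub> q)"
  by (simp add: quot_algebra_fields FactRing_def rcoset_mult_add)

text \<open>Scalars preserve the ideal by the ideal property itself: \<open>c h = (c 1) h\<close>.\<close>

lemma ideal_smult_closed:
  assumes "c \<in> carrier R" "h \<in> I"
  shows "c \<odot>\<^bsub>F\<^esub> h \<in> I"
proof -
  have h: "h \<in> carrier F" using assms(2) by (rule a_Hcarr)
  have "(c \<odot>\<^bsub>F\<^esub> \<one>\<^bsub>F\<^esub>) \<otimes>\<^bsub>F\<^esub> h \<in> I" using assms by (intro I_l_closed) simp_all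
  then show ?thesis using assms h by (simp add: smult_mult_left)
qed

lemma coset_eq:
  assumes "p \<in> carrier F" "h \<in> I"
  shows "I +>\<^bsub>F\<^esub> (h \<oplus>\<^bsub>F\<^esub> p) = I +>\<^bsub>F\<^esub> p"
proof -
  have "h \<oplus>\<^bsub>F\<^esub> p \<in> I +>\<^bsub>F\<^esub> p" using assms a_subset by (intro a_rcosI)
  then show ?thesis using a_repr_independence[OF _ assms(1) a_subgroup] by simp
qed

lemma mem_coset: "p \<in> carrier F \<Longrightarrow> q \<in> I +>\<^bsub>F\<^esub> p \<longleftrightarrow> (\<exists>h\<in>I. q = h \<oplus>\<^bsub>F\<^esub> p)"
  by (auto simp: a_r_coset_def r_coset_def)

lemma Q_smult:
  assumes "c \<in> carrier R" "p \<in> carrier F"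
  shows "c \<odot>\<^bsub>Q\<^esub> (I +>\<^bsub>F\<^esub> p) = I +>\<^bsub>F\<^esub> (c \<odot>\<^bsub>F\<^esub> p)"
proof -
  have "I +>\<^bsub>F\<^esub> (c \<odot>\<^bsub>F\<^esub> q) = I +>\<^bsub>F\<^esub> (c \<odot>\<^bsub>F\<^esub> p)" if q: "q \<in> I +>\<^bsub>F\<^esub> p" for q
  proof -
    obtain h where h: "h \<in> I" "q = h \<oplus>\<^bsub>F\<^esub> p" using q unfolding mem_coset[OF assms(2)] by blast
    then show ?thesis using assms ideal_smult_closed[OF assms(1) h(1)]
      by (simp add: smult_r_distr a_Hcarr coset_eq)
  qed
  moreover have "I +>\<^bsub>F\<^esub> p \<noteq> {}" using a_rcos_self[OF assms(2)] by blast
  ultimately have "(\<Union>q\<in>I +>\<^bsub>F\<^esub> p. I +>\<^bsub>F\<^esub> (c \<odot>\<^bsub>F\<^esub> q)) = I +>\<^bsub>F\<^esub> (c \<odot>\<^bsub>F\<^esub> p)"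
    by (intro SUP_eq_const)
  then show ?thesis by (simp add: quot_algebra_def)
qed

lemmas Q_simps = Q_one Q_zero Q_add Q_mult Q_smult

lemma assoc_algebra_quot: "assoc_algebra R Q"
proof -
  have "abelian_group Q"
  proof (rule abelian_groupI)
    fix S assume "S \<in> carrier Q"
    then obtain p where p: "p \<in> carrier F" "S = I +>\<^bsub>F\<^esub> p" by (auto simp: Q_carrier)
    then have "(I +>\<^bsub>F\<^esub> (\<ominus>\<^bsub>F\<^esub> p)) \<oplus>\<^bsub>Q\<^esub> S = \<zero>\<^bsub>Q\<^esub>" by (simp add: Q_simps M.l_neg)
    with p show "\<exists>T\<in>carrier Q. T \<oplus>\<^bsub>Q\<^esub> S = \<zero>\<^bsub>Q\<^esub>" by (auto simp: Q_carrier)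
  qed (auto simp: Q_carrier Q_simps M.a_ac)
  then have ring: "ring Q"
    by (rule ringI) (auto intro!: monoidI simp: Q_carrier Q_simps m_assoc l_distr r_distr)
  interpret Q: ring Q by (rule ring)
  have "module R Q"
    by (rule moduleI[OF R.is_cring Q.abelian_group_axioms])
      (auto simp: Q_carrier Q_simps smult_l_distr smult_r_distr smult_assoc1)
  then show ?thesis
    by (intro assoc_algebra.intro ring assoc_algebra_axioms.intro)
      (auto simp: Q_carrier Q_simps smult_mult_left smult_mult_right)
qed

lemma linear_map_descends:
  assumes V: "module R V" and f: "f \<in> linear_maps R F V"
    and vanish: "\<And>h. h \<in> I \<Longrightarrow> f h = \<zero>\<^bsub>V\<^esub>"
  obtains T where "T \<in> linear_maps R Q V" "\<And>p. p \<in> carrier F \<Longrightarrow> T (I +>\<^bsub>F\<^esub> p) = f p"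
proof
  interpret V: module R V by (rule V)
  let ?T = "\<lambda>S. f (SOME q. q \<in> S)"
  show T: "?T (I +>\<^bsub>F\<^esub> p) = f p" if p: "p \<in> carrier F" for p
  proof -
    have "p \<in> I +>\<^bsub>F\<^esub> p" using p by (rule a_rcos_self)
    then have "(SOME q. q \<in> I +>\<^bsub>F\<^esub> p) \<in> I +>\<^bsub>F\<^esub> p" by (rule someI)
    then obtain h where "h \<in> I" "(SOME q. q \<in> I +>\<^bsub>F\<^esub> p) = h \<oplus>\<^bsub>F\<^esub> p"
      unfolding mem_coset[OF p] by blast
    then show ?thesis using p f vanish
      by (simp add: linear_maps_add[OF f] a_Hcarr linear_maps_closed[OF f])
  qed
  show "?T \<in> linear_maps R Q V"
    by (rule linear_mapsI)
      (auto simp: Q_carrier Q_simps T linear_maps_closed[OF f] linear_maps_add[OF f] linear_maps_smult[OF f])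
qed

end

section \<open>Generators, relation and universal property\<close>

locale family = fixes a :: complex
begin

abbreviation A :: "(complex, (generator free_monoid \<Rightarrow>\<^sub>0 complex) set) module" where "A \<equiv> A_family a"

definition relations where "relations = Idl\<^bsub>free_xy\<^esub> {xy_relator a}"
definition coset where "coset p = a_r_coset free_xy relations p"
definition x where "x = coset (free_gen Gen_x)"
definition y where "y = coset (free_gen Gen_y)"

lemma algebra_ideal: "algebra_ideal complex_ring free_xy relations"
proof -
  interpret F: assoc_algebra complex_ring free_xy by (rule assoc_algebra_free_algebra)
  show ?thesis unfolding relations_def
    by (intro algebra_ideal.intro F.assoc_algebra_axioms F.genideal_ideal) simp
qed

lemma A_eq: "A = quot_algebra free_xy relations"
  by (simp add: A_family_def relations_def)

sublocale assoc_algebra complex_ring A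
  unfolding A_eq by (rule algebra_ideal.assoc_algebra_quot[OF algebra_ideal])

lemma carrier_A: "carrier A = range coset"
  using algebra_ideal.Q_carrier[OF algebra_ideal] by (simp add: A_eq coset_def)

lemma coset_simps:
  "\<one>\<^bsub>A\<^esub> = coset 1" "coset p \<oplus>\<^bsub>A\<^esub> coset q = coset (p + q)"
  "coset p \<otimes>\<^bsub>A\<^esub> coset q = coset (p * q)"
  "c \<odot>\<^bsub>A\<^esub> coset p = coset (Poly_Mapping.single 0 c * p)"
  by (simp_all add: A_eq coset_def algebra_ideal.Q_simps[OF algebra_ideal])

lemma gens_closed [simp]: "x \<in> carrier A" "y \<in> carrier A"
  by (auto simp: carrier_A x_def y_def)

lemma xy_relator_eq: "xy_relator a = Poly_Mapping.single 0 a * (free_gen Gen_x * free_gen Gen_y)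
    - Poly_Mapping.single 0 a * (free_gen Gen_y * free_gen Gen_x) - free_gen Gen_x"
  by (simp add: xy_relator_def Let_def a_minus_def free_algebra_uminus)

lemma relation: "a \<odot>\<^bsub>A\<^esub> (x \<otimes>\<^bsub>A\<^esub> y) = a \<odot>\<^bsub>A\<^esub> (y \<otimes>\<^bsub>A\<^esub> x) \<oplus>\<^bsub>A\<^esub> x"
proof -
  interpret F: assoc_algebra complex_ring free_xy by (rule assoc_algebra_free_algebra)
  have "xy_relator a \<in> relations" unfolding relations_def by (rule F.genideal_self') simp
  then have "coset (xy_relator a \<oplus>\<^bsub>free_xy\<^esub> q) = coset q" for q
    unfolding coset_def by (intro algebra_ideal.coset_eq[OF algebra_ideal]) simp_all
  from this[of "Poly_Mapping.single 0 a * (free_gen Gen_y * free_gen Gen_x) + free_gen Gen_x"]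
  show ?thesis by (simp add: x_def y_def coset_simps xy_relator_eq)
qed

text \<open>The words span the algebra, and each word is built from \<open>1\<close> by left multiplication with
  generators; linearity covers the rest.\<close>

lemma generator_induct [consumes 1, case_names one add smult x y]:
  assumes "c \<in> carrier A" "P \<one>\<^bsub>A\<^esub>"
    and add: "\<And>c d. c \<in> carrier A \<Longrightarrow> d \<in> carrier A \<Longrightarrow> P c \<Longrightarrow> P d \<Longrightarrow> P (c \<oplus>\<^bsub>A\<^esub> d)"
    and smult: "\<And>k c. c \<in> carrier A \<Longrightarrow> P c \<Longrightarrow> P (k \<odot>\<^bsub>A\<^esub> c)"
    and x: "\<And>c. c \<in> carrier A \<Longrightarrow> P c \<Longrightarrow> P (x \<otimes>\<^bsub>A\<^esub> c)"
    and y: "\<And>c. c \<in> carrier A \<Longrightarrow> P c \<Longrightarrow> P (y \<otimes>\<^bsub>A\<^esub> c)"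
  shows "P c"
proof -
  have closed: "coset p \<in> carrier A" for p by (simp add: carrier_A)
  have word: "P (coset (Poly_Mapping.single (Word ws) 1))" for ws
  proof (induction ws)
    case Nil
    then show ?case using assms(2) by (simp add: coset_simps flip: zero_free_monoid_def)
  next
    case (Cons g ws)
    have "coset (Poly_Mapping.single (Word (g # ws)) 1)
        = coset (free_gen g) \<otimes>\<^bsub>A\<^esub> coset (Poly_Mapping.single (Word ws) 1)"
      by (simp add: coset_simps free_gen_def mult_single plus_free_monoid_def)
    with Cons show ?case using x y closed by (cases g) (simp_all add: x_def y_def)
  qed
  have scaled: "P (coset (Poly_Mapping.single w k))" for w k
    using smult[OF closed word[of "letters w"], of k]
    by (simp add: coset_simps mult_single)
  have "P (coset p)" for p
  proof (induction p rule: poly_mapping_single_induct)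
    case zero
    show ?case using scaled[of 0 0] by simp
  next
    case (add p q)
    then show ?case using assms(3)[OF closed closed] by (simp add: coset_simps)
  qed (rule scaled)
  with assms(1) show ?thesis by (auto simp: carrier_A)
qed

text \<open>The polynomials that annihilate every vector of \<open>V\<close> form a two-sided ideal. It contains the
  relator because \<open>\<xi>\<close> and \<open>\<eta>\<close> satisfy the relation, hence it contains all relations, and evaluation at
  \<open>v\<close> descends to \<open>A\<close>. Stating the property for modules with a base point, and not for algebra
  homomorphisms, gives maps from \<open>A\<close> that are specified by their behaviour under left multiplication
  by \<open>x\<close> and \<open>y\<close>.\<close>

theorem universal_property:
  assumes V: "module complex_ring V" and xi: "\<xi> \<in> linear_maps complex_ring V V"
    and eta: "\<eta> \<in> linear_maps complex_ring V V"
    and rel: "\<And>v. v \<in> carrier V \<Longrightarrow> a \<odot>\<^bsub>V\<^esub> \<xi> (\<eta> v) = a \<odot>\<^bsub>V\<^esub> \<eta> (\<xi> v) \<oplus>\<^bsub>V\<^esub> \<xi> v"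
    and v: "v \<in> carrier V"
  obtains T where "T \<in> linear_maps complex_ring A V" "T \<one>\<^bsub>A\<^esub> = v"
    "\<And>c. c \<in> carrier A \<Longrightarrow> T (x \<otimes>\<^bsub>A\<^esub> c) = \<xi> (T c)"
    "\<And>c. c \<in> carrier A \<Longrightarrow> T (y \<otimes>\<^bsub>A\<^esub> c) = \<eta> (T c)"
proof -
  interpret F: assoc_algebra complex_ring free_xy by (rule assoc_algebra_free_algebra)
  interpret V: module complex_ring V by (rule V)
  define act where "act g = (case g of Gen_x \<Rightarrow> \<xi> | Gen_y \<Rightarrow> \<eta>)" for g
  interpret V: free_action complex_ring V act
    by standard (auto simp: act_def xi eta split: generator.split)
  let ?J = "{p. \<forall>v\<in>carrier V. V.ev v p = \<zero>\<^bsub>V\<^esub>}"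
  have "ideal ?J free_xy"
  proof (rule idealI)
    show "subgroup ?J (add_monoid free_xy)"
    proof (rule F.add.subgroupI)
      fix p assume "p \<in> ?J"
      then have "V.ev v (- p) = \<zero>\<^bsub>V\<^esub>" if "v \<in> carrier V" for v
        using V.ev_add[OF that, of p "- p"] that by simp
      then show "\<ominus>\<^bsub>free_xy\<^esub> p \<in> ?J" by (simp add: free_algebra_uminus)
    qed (auto simp: V.ev_add intro: exI[of _ 0])
  next
    have "V.ev \<zero>\<^bsub>V\<^esub> p = \<zero>\<^bsub>V\<^esub>" for p
      using V.ev_add_left[of "\<zero>\<^bsub>V\<^esub>" "\<zero>\<^bsub>V\<^esub>" p] V.M.add.l_cancel_one'[of "V.ev \<zero>\<^bsub>V\<^esub> p" "V.ev \<zero>\<^bsub>V\<^esub> p"] by simp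
    then show "p \<in> ?J \<Longrightarrow> q \<otimes>\<^bsub>free_xy\<^esub> p \<in> ?J" for p q by (simp add: V.ev_mult)
  qed (use F.ring_axioms in \<open>auto simp: V.ev_mult\<close>)
  moreover have "xy_relator a \<in> ?J"
  proof -
    have "V.ev u (xy_relator a) = \<zero>\<^bsub>V\<^esub>" if u: "u \<in> carrier V" for u
    proof -
      let ?q = "Poly_Mapping.single 0 a * (free_gen Gen_y * free_gen Gen_x) + free_gen Gen_x"
      have "V.ev w (free_gen g) = act g w" if "w \<in> carrier V" for g w
        using V.ev_gen_mult[OF that, of g 1] that by (simp add: V.ev_one)
      then have "V.ev u (Poly_Mapping.single 0 a * (free_gen Gen_x * free_gen Gen_y)) = a \<odot>\<^bsub>V\<^esub> \<xi> (\<eta> u)"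
        "V.ev u ?q = a \<odot>\<^bsub>V\<^esub> \<eta> (\<xi> u) \<oplus>\<^bsub>V\<^esub> \<xi> u"
        using u by (simp_all add: V.ev_add V.ev_mult V.ev_single act_def linear_maps_closed[OF xi] linear_maps_closed[OF eta])
      moreover have "V.ev u (xy_relator a + ?q) = V.ev u (xy_relator a) \<oplus>\<^bsub>V\<^esub> V.ev u ?q"
        using u by (rule V.ev_add)
      moreover have "xy_relator a + ?q = Poly_Mapping.single 0 a * (free_gen Gen_x * free_gen Gen_y)"
        by (simp add: xy_relator_eq)
      ultimately have "V.ev u ?q = V.ev u (xy_relator a) \<oplus>\<^bsub>V\<^esub> V.ev u ?q" using rel[OF u] by simp
      then show ?thesis using u by (metis V.M.add.r_cancel_one' V.ev_closed)
    qed
    then show ?thesis by simp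
  qed
  ultimately have "relations \<subseteq> ?J" unfolding relations_def by (intro F.genideal_minimal) simp_all
  then have "V.ev v h = \<zero>\<^bsub>V\<^esub>" if "h \<in> relations" for h using that v by blast
  from algebra_ideal.linear_map_descends[OF algebra_ideal V V.ev_linear[OF v] this]
  obtain T where T: "T \<in> linear_maps complex_ring A V" "\<And>p. T (coset p) = V.ev v p"
    unfolding A_eq coset_def by (metis UNIV_I free_algebra_simps(1))
  have T_gen: "T (coset (free_gen g) \<otimes>\<^bsub>A\<^esub> c) = act g (T c)" if "c \<in> carrier A" for c g
    using that v by (auto simp: carrier_A coset_simps T V.ev_gen_mult)
  from T_gen[of _ Gen_x] T_gen[of _ Gen_y] show ?thesis
    using v by (intro that[OF T(1)]) (simp_all add: coset_simps T V.ev_one x_def y_def act_def)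
qed

end

section \<open>Bimodules without a right unit law\<close>

text \<open>The axioms of a bimodule except \<open>m 1 = m\<close>, which fails for the right action on cochains of
  positive degree.\<close>

locale weak_bimodule = assoc_algebra R A + N: module R N
  for R :: "'k ring" (structure) and A :: "('k, 'a) module" (structure)
    and N :: "('k, 'a, 'n) bimodule" (structure) +
  assumes lact_closed [simp]:
      "\<lbrakk>a \<in> carrier A; m \<in> carrier N\<rbrakk> \<Longrightarrow> lact N a m \<in> carrier N"
    and lact_one: "m \<in> carrier N \<Longrightarrow> lact N \<one>\<^bsub>A\<^esub> m = m"
    and lact_mult: "\<lbrakk>a \<in> carrier A; b \<in> carrier A; m \<in> carrier N\<rbrakk>
        \<Longrightarrow> lact N (a \<otimes>\<^bsub>A\<^esub> b) m = lact N a (lact N b m)"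
    and lact_add_left: "\<lbrakk>a \<in> carrier A; b \<in> carrier A; m \<in> carrier N\<rbrakk>
        \<Longrightarrow> lact N (a \<oplus>\<^bsub>A\<^esub> b) m = lact N a m \<oplus>\<^bsub>N\<^esub> lact N b m"
    and lact_add_right: "\<lbrakk>a \<in> carrier A; m \<in> carrier N; m' \<in> carrier N\<rbrakk>
        \<Longrightarrow> lact N a (m \<oplus>\<^bsub>N\<^esub> m') = lact N a m \<oplus>\<^bsub>N\<^esub> lact N a m'"
    and lact_smult_left: "\<lbrakk>c \<in> carrier R; a \<in> carrier A; m \<in> carrier N\<rbrakk>
        \<Longrightarrow> lact N (c \<odot>\<^bsub>A\<^esub> a) m = c \<odot>\<^bsub>N\<^esub> lact N a m"
    and lact_smult_right: "\<lbrakk>c \<in> carrier R; a \<in> carrier A; m \<in> carrier N\<rbrakk>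
        \<Longrightarrow> lact N a (c \<odot>\<^bsub>N\<^esub> m) = c \<odot>\<^bsub>N\<^esub> lact N a m"
    and ract_closed [simp]:
      "\<lbrakk>a \<in> carrier A; m \<in> carrier N\<rbrakk> \<Longrightarrow> ract N m a \<in> carrier N"
    and ract_mult: "\<lbrakk>a \<in> carrier A; b \<in> carrier A; m \<in> carrier N\<rbrakk>
        \<Longrightarrow> ract N m (a \<otimes>\<^bsub>A\<^esub> b) = ract N (ract N m a) b"
    and ract_add_right: "\<lbrakk>a \<in> carrier A; b \<in> carrier A; m \<in> carrier N\<rbrakk>
        \<Longrightarrow> ract N m (a \<oplus>\<^bsub>A\<^esub> b) = ract N m a \<oplus>\<^bsub>N\<^esub> ract N m b"
    and ract_add_left: "\<lbrakk>a \<in> carrier A; m \<in> carrier N; m' \<in> carrier N\<rbrakk>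
        \<Longrightarrow> ract N (m \<oplus>\<^bsub>N\<^esub> m') a = ract N m a \<oplus>\<^bsub>N\<^esub> ract N m' a"
    and ract_smult_right: "\<lbrakk>c \<in> carrier R; a \<in> carrier A; m \<in> carrier N\<rbrakk>
        \<Longrightarrow> ract N m (c \<odot>\<^bsub>A\<^esub> a) = c \<odot>\<^bsub>N\<^esub> ract N m a"
    and ract_smult_left: "\<lbrakk>c \<in> carrier R; a \<in> carrier A; m \<in> carrier N\<rbrakk>
        \<Longrightarrow> ract N (c \<odot>\<^bsub>N\<^esub> m) a = c \<odot>\<^bsub>N\<^esub> ract N m a"
    and lact_ract: "\<lbrakk>a \<in> carrier A; b \<in> carrier A; m \<in> carrier N\<rbrakk>
        \<Longrightarrow> ract N (lact N a m) b = lact N a (ract N m b)"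

lemma (in weak_bimodule) lact_minus:
  assumes "a \<in> carrier A" "m \<in> carrier N" "m' \<in> carrier N"
  shows "lact N a (m \<ominus>\<^bsub>N\<^esub> m') = lact N a m \<ominus>\<^bsub>N\<^esub> lact N a m'"
  using assms by (intro N.M.add_eq_imp_eq_minus) (simp_all flip: lact_add_right add: N.M.minus_add_cancel)

lemma (in weak_bimodule) ract_minus:
  assumes "a \<in> carrier A" "m \<in> carrier N" "m' \<in> carrier N"
  shows "ract N (m \<ominus>\<^bsub>N\<^esub> m') a = ract N m a \<ominus>\<^bsub>N\<^esub> ract N m' a"
  using assms by (intro N.M.add_eq_imp_eq_minus) (simp_all flip: ract_add_left add: N.M.minus_add_cancel)

lemma (in weak_bimodule) lact_zero [simp]: "a \<in> carrier A \<Longrightarrow> lact N a \<zero>\<^bsub>N\<^esub> = \<zero>\<^bsub>N\<^esub>"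
  using lact_minus[of a "\<zero>\<^bsub>N\<^esub>" "\<zero>\<^bsub>N\<^esub>"] N.M.minus_eq_zero_iff[of "\<zero>\<^bsub>N\<^esub>" "\<zero>\<^bsub>N\<^esub>"]
    N.M.minus_eq_zero_iff[of "lact N a \<zero>\<^bsub>N\<^esub>" "lact N a \<zero>\<^bsub>N\<^esub>"] by simp

lemma (in weak_bimodule) ract_zero [simp]: "a \<in> carrier A \<Longrightarrow> ract N \<zero>\<^bsub>N\<^esub> a = \<zero>\<^bsub>N\<^esub>"
  using ract_minus[of a "\<zero>\<^bsub>N\<^esub>" "\<zero>\<^bsub>N\<^esub>"] N.M.minus_eq_zero_iff[of "\<zero>\<^bsub>N\<^esub>" "\<zero>\<^bsub>N\<^esub>"]
    N.M.minus_eq_zero_iff[of "ract N \<zero>\<^bsub>N\<^esub> a" "ract N \<zero>\<^bsub>N\<^esub> a"] by simp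

section \<open>Splitting two-cocycles\<close>

context family
begin

text \<open>The product \<open>A \<times> N\<close> with \<open>(b, m)(c, n) = (b c, b n + m c + F b c)\<close> is an extension of \<open>A\<close> by \<open>N\<close>,
  and associativity is the cocycle condition. Hypothesis \<open>lift\<close> says that \<open>(x, n\<^sub>x)\<close> and
  \<open>(y, n\<^sub>y)\<close> satisfy the defining relation of \<open>A\<close> in this extension. Their left multiplications then
  make \<open>A \<times> N\<close> an \<open>A\<close>-module, and the orbit map of a suitable base point is a section \<open>c \<mapsto> (c, g c)\<close>.
  With the signs used here \<open>- g\<close> has coboundary \<open>F\<close>.\<close>

theorem two_cocycle_splits:
  assumes N: "weak_bimodule complex_ring A N"
    and F_left: "\<And>c. c \<in> carrier A \<Longrightarrow> (\<lambda>b. F b c) \<in> linear_maps complex_ring A N"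
    and F_right: "\<And>b. b \<in> carrier A \<Longrightarrow> F b \<in> linear_maps complex_ring A N"
    and cocycle: "\<And>b c d. b \<in> carrier A \<Longrightarrow> c \<in> carrier A \<Longrightarrow> d \<in> carrier A \<Longrightarrow>
      lact N b (F c d) \<oplus>\<^bsub>N\<^esub> F b (c \<otimes>\<^bsub>A\<^esub> d) = F (b \<otimes>\<^bsub>A\<^esub> c) d \<oplus>\<^bsub>N\<^esub> ract N (F b c) d"
    and n: "n\<^sub>x \<in> carrier N" "n\<^sub>y \<in> carrier N"
    and lift: "a \<odot>\<^bsub>N\<^esub> (lact N x n\<^sub>y \<oplus>\<^bsub>N\<^esub> ract N n\<^sub>x y \<oplus>\<^bsub>N\<^esub> F x y)
      = a \<odot>\<^bsub>N\<^esub> (lact N y n\<^sub>x \<oplus>\<^bsub>N\<^esub> ract N n\<^sub>y x \<oplus>\<^bsub>N\<^esub> F y x) \<oplus>\<^bsub>N\<^esub> n\<^sub>x"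
  obtains g where "g \<in> linear_maps complex_ring A N"
    "\<And>b c. b \<in> carrier A \<Longrightarrow> c \<in> carrier A \<Longrightarrow>
      g (b \<otimes>\<^bsub>A\<^esub> c) = lact N b (g c) \<oplus>\<^bsub>N\<^esub> ract N (g b) c \<oplus>\<^bsub>N\<^esub> F b c"
proof -
  interpret N: weak_bimodule complex_ring A N by (rule N)
  have F_closed [simp]: "F b c \<in> carrier N" if "b \<in> carrier A" "c \<in> carrier A" for b c
    using linear_maps_closed[OF F_right] that .
  note F_simps = linear_maps_add[OF F_left] linear_maps_smult[OF F_left]
    linear_maps_add[OF F_right] linear_maps_smult[OF F_right]
  note N_simps = N.lact_add_left N.lact_add_right N.lact_smult_left N.lact_smult_right
    N.ract_add_left N.ract_add_right N.ract_smult_left N.ract_smult_right N.N.smult_r_distr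
  define V where "V = prod_module A N"
  have V: "module complex_ring V" unfolding V_def
    by (rule module_prod_module) (rule module_axioms N.N.module_axioms)+
  define op where "op v n u = (v \<otimes>\<^bsub>A\<^esub> fst u, lact N v (snd u) \<oplus>\<^bsub>N\<^esub> ract N n (fst u) \<oplus>\<^bsub>N\<^esub> F v (fst u))"
    for v n and u :: "(generator free_monoid \<Rightarrow>\<^sub>0 complex) set \<times> 'a"
  have op_linear: "op v n \<in> linear_maps complex_ring V V" if "v \<in> carrier A" "n \<in> carrier N" for v n
    by (rule linear_mapsI)
      (use that in \<open>auto simp: V_def op_def r_distr smult_mult_right N_simps F_simps N.N.a_ac\<close>)
  have rel: "a \<odot>\<^bsub>V\<^esub> op x n\<^sub>x (op y n\<^sub>y u) = a \<odot>\<^bsub>V\<^esub> op y n\<^sub>y (op x n\<^sub>x u) \<oplus>\<^bsub>V\<^esub> op x n\<^sub>x u"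
    if uV: "u \<in> carrier V" for u
  proof -
    obtain c m where u: "u = (c, m)" "c \<in> carrier A" "m \<in> carrier N" using uV by (auto simp: V_def)
    define A1 where "A1 = a \<odot>\<^bsub>N\<^esub> lact N x (lact N y m)"
    define A2 where "A2 = a \<odot>\<^bsub>N\<^esub> lact N x (ract N n\<^sub>y c)"
    define A3 where "A3 = a \<odot>\<^bsub>N\<^esub> lact N x (F y c)"
    define A4 where "A4 = a \<odot>\<^bsub>N\<^esub> ract N n\<^sub>x (y \<otimes>\<^bsub>A\<^esub> c)"
    define A5 where "A5 = a \<odot>\<^bsub>N\<^esub> F x (y \<otimes>\<^bsub>A\<^esub> c)"
    define B1 where "B1 = a \<odot>\<^bsub>N\<^esub> lact N y (lact N x m)"
    define B2 where "B2 = a \<odot>\<^bsub>N\<^esub> lact N y (ract N n\<^sub>x c)"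
    define B3 where "B3 = a \<odot>\<^bsub>N\<^esub> lact N y (F x c)"
    define B4 where "B4 = a \<odot>\<^bsub>N\<^esub> ract N n\<^sub>y (x \<otimes>\<^bsub>A\<^esub> c)"
    define B5 where "B5 = a \<odot>\<^bsub>N\<^esub> F y (x \<otimes>\<^bsub>A\<^esub> c)"
    define P where "P = a \<odot>\<^bsub>N\<^esub> F (x \<otimes>\<^bsub>A\<^esub> y) c"
    define P' where "P' = a \<odot>\<^bsub>N\<^esub> F (y \<otimes>\<^bsub>A\<^esub> x) c"
    define S where "S = a \<odot>\<^bsub>N\<^esub> ract N (F x y) c"
    define S' where "S' = a \<odot>\<^bsub>N\<^esub> ract N (F y x) c"
    note defs = A1_def A2_def A3_def A4_def A5_def B1_def B2_def B3_def B4_def B5_def P_def P'_def S_def S'_def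
    have closed [simp]: "A1 \<in> carrier N" "A2 \<in> carrier N" "A3 \<in> carrier N" "A4 \<in> carrier N" "A5 \<in> carrier N"
      "B1 \<in> carrier N" "B2 \<in> carrier N" "B3 \<in> carrier N" "B4 \<in> carrier N" "B5 \<in> carrier N"
      "P \<in> carrier N" "P' \<in> carrier N" "S \<in> carrier N" "S' \<in> carrier N" 
      using u n by (simp_all add: defs)
    have closed' [simp]: "lact N x m \<in> carrier N" "ract N n\<^sub>x c \<in> carrier N" "F x c \<in> carrier N"
      using u n by simp_all
    \<comment> \<open>Each of the five equations below comes from one source: the relation acting on \<open>m\<close>, the cocycle
      condition for \<open>(x, y, c)\<close> and \<open>(y, x, c)\<close>, the relation in the first argument of \<open>F\<close>, and the
      lifted relation acting on \<open>c\<close>. Together they give the relation for the two operators.\<close>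
    have e1: "A1 = B1 \<oplus>\<^bsub>N\<^esub> lact N x m"
      using arg_cong[OF relation, of "\<lambda>v. lact N v m"] u
      by (simp add: defs N_simps N.lact_mult)
    have e2: "A3 \<oplus>\<^bsub>N\<^esub> A5 = P \<oplus>\<^bsub>N\<^esub> S"
      using arg_cong[OF cocycle[of x y c], of "\<lambda>v. a \<odot>\<^bsub>N\<^esub> v"] u by (simp add: defs N_simps)
    have e3: "B3 \<oplus>\<^bsub>N\<^esub> B5 = P' \<oplus>\<^bsub>N\<^esub> S'"
      using arg_cong[OF cocycle[of y x c], of "\<lambda>v. a \<odot>\<^bsub>N\<^esub> v"] u by (simp add: defs N_simps)
    have e4: "P = P' \<oplus>\<^bsub>N\<^esub> F x c"
      using arg_cong[OF relation, of "\<lambda>v. F v c"] u by (simp add: defs F_simps)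
    have e5: "A2 \<oplus>\<^bsub>N\<^esub> A4 \<oplus>\<^bsub>N\<^esub> S = B2 \<oplus>\<^bsub>N\<^esub> B4 \<oplus>\<^bsub>N\<^esub> S' \<oplus>\<^bsub>N\<^esub> ract N n\<^sub>x c"
      using arg_cong[OF lift, of "\<lambda>v. ract N v c"] u n
      by (simp add: defs N_simps N.ract_mult N.lact_ract)
    have "A1 \<oplus>\<^bsub>N\<^esub> A2 \<oplus>\<^bsub>N\<^esub> A3 \<oplus>\<^bsub>N\<^esub> A4 \<oplus>\<^bsub>N\<^esub> A5 = A1 \<oplus>\<^bsub>N\<^esub> (A2 \<oplus>\<^bsub>N\<^esub> A4) \<oplus>\<^bsub>N\<^esub> (A3 \<oplus>\<^bsub>N\<^esub> A5)"
      by (simp add: N.N.a_ac)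
    also have "\<dots> = A1 \<oplus>\<^bsub>N\<^esub> (A2 \<oplus>\<^bsub>N\<^esub> A4 \<oplus>\<^bsub>N\<^esub> S) \<oplus>\<^bsub>N\<^esub> P" unfolding e2 by (simp add: N.N.a_ac)
    also have "\<dots> = B1 \<oplus>\<^bsub>N\<^esub> B2 \<oplus>\<^bsub>N\<^esub> B4 \<oplus>\<^bsub>N\<^esub> (P' \<oplus>\<^bsub>N\<^esub> S') \<oplus>\<^bsub>N\<^esub> (lact N x m \<oplus>\<^bsub>N\<^esub> ract N n\<^sub>x c \<oplus>\<^bsub>N\<^esub> F x c)"
      unfolding e5 unfolding e1 e4 by (simp add: N.N.a_ac)
    also have "\<dots> = B1 \<oplus>\<^bsub>N\<^esub> B2 \<oplus>\<^bsub>N\<^esub> B3 \<oplus>\<^bsub>N\<^esub> B4 \<oplus>\<^bsub>N\<^esub> B5 \<oplus>\<^bsub>N\<^esub> (lact N x m \<oplus>\<^bsub>N\<^esub> ract N n\<^sub>x c \<oplus>\<^bsub>N\<^esub> F x c)"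
      unfolding e3[symmetric] by (simp add: N.N.a_ac)
    finally have "snd (a \<odot>\<^bsub>V\<^esub> op x n\<^sub>x (op y n\<^sub>y u)) = snd (a \<odot>\<^bsub>V\<^esub> op y n\<^sub>y (op x n\<^sub>x u) \<oplus>\<^bsub>V\<^esub> op x n\<^sub>x u)"
      using u n by (simp add: V_def op_def defs N_simps N.N.a_ac)
    moreover have "fst (a \<odot>\<^bsub>V\<^esub> op x n\<^sub>x (op y n\<^sub>y u)) = fst (a \<odot>\<^bsub>V\<^esub> op y n\<^sub>y (op x n\<^sub>x u) \<oplus>\<^bsub>V\<^esub> op x n\<^sub>x u)"
      using arg_cong[OF relation, of "\<lambda>v. v \<otimes>\<^bsub>A\<^esub> c"] u
      by (simp add: V_def op_def l_distr smult_mult_left m_assoc)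
    ultimately show ?thesis by (rule prod_eqI[rotated])
  qed
  \<comment> \<open>The base point is dictated by the cocycle condition at \<open>(1, 1, c)\<close>, which gives \<open>F 1 c = F(1, 1) c\<close>;
    the component \<open>- F(1, 1)\<close> makes the splitting identity true for \<open>b = 1\<close>.\<close>
  have start: "(\<one>\<^bsub>A\<^esub>, \<ominus>\<^bsub>N\<^esub> F \<one>\<^bsub>A\<^esub> \<one>\<^bsub>A\<^esub>) \<in> carrier V" by (simp add: V_def)
  obtain T where T: "T \<in> linear_maps complex_ring A V" "T \<one>\<^bsub>A\<^esub> = (\<one>\<^bsub>A\<^esub>, \<ominus>\<^bsub>N\<^esub> F \<one>\<^bsub>A\<^esub> \<one>\<^bsub>A\<^esub>)"
    and T_gen: "\<And>c. c \<in> carrier A \<Longrightarrow> T (x \<otimes>\<^bsub>A\<^esub> c) = op x n\<^sub>x (T c)"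
    "\<And>c. c \<in> carrier A \<Longrightarrow> T (y \<otimes>\<^bsub>A\<^esub> c) = op y n\<^sub>y (T c)"
    by (rule universal_property[OF V op_linear op_linear rel start]) (use n in auto)
  define g where "g = snd \<circ> T"
  have T_carrier: "T c \<in> carrier A \<times> carrier N" if "c \<in> carrier A" for c
    using linear_maps_closed[OF T(1) that] by (simp add: V_def)
  have g: "g \<in> linear_maps complex_ring A N"
    by (rule linear_mapsI) (use T_carrier in \<open>auto simp: g_def linear_maps_add[OF T(1)] linear_maps_smult[OF T(1)] V_def mem_Times_iff\<close>)
  have fst_T: "fst (T c) = c" if "c \<in> carrier A" for c
    using that by (induction rule: generator_induct)
      (simp_all add: T T_gen op_def linear_maps_add[OF T(1)] linear_maps_smult[OF T(1)] V_def)
  have g_gen: "g (x \<otimes>\<^bsub>A\<^esub> c) = lact N x (g c) \<oplus>\<^bsub>N\<^esub> ract N n\<^sub>x c \<oplus>\<^bsub>N\<^esub> F x c"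
    "g (y \<otimes>\<^bsub>A\<^esub> c) = lact N y (g c) \<oplus>\<^bsub>N\<^esub> ract N n\<^sub>y c \<oplus>\<^bsub>N\<^esub> F y c" if "c \<in> carrier A" for c
    using that by (simp_all add: g_def T_gen op_def fst_T)
  note g_closed [simp] = linear_maps_closed[OF g]
  have step: "g (v \<otimes>\<^bsub>A\<^esub> b \<otimes>\<^bsub>A\<^esub> c) = lact N (v \<otimes>\<^bsub>A\<^esub> b) (g c) \<oplus>\<^bsub>N\<^esub> ract N (g (v \<otimes>\<^bsub>A\<^esub> b)) c \<oplus>\<^bsub>N\<^esub> F (v \<otimes>\<^bsub>A\<^esub> b) c"
    if v: "v \<in> carrier A" "n \<in> carrier N" "\<And>d. d \<in> carrier A \<Longrightarrow> g (v \<otimes>\<^bsub>A\<^esub> d) = lact N v (g d) \<oplus>\<^bsub>N\<^esub> ract N n d \<oplus>\<^bsub>N\<^esub> F v d"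
      and b: "b \<in> carrier A" "g (b \<otimes>\<^bsub>A\<^esub> c) = lact N b (g c) \<oplus>\<^bsub>N\<^esub> ract N (g b) c \<oplus>\<^bsub>N\<^esub> F b c"
      and c: "c \<in> carrier A" for v n b c
  proof -
    have "g (v \<otimes>\<^bsub>A\<^esub> b \<otimes>\<^bsub>A\<^esub> c) = lact N v (lact N b (g c)) \<oplus>\<^bsub>N\<^esub> lact N v (ract N (g b) c) \<oplus>\<^bsub>N\<^esub> ract N (ract N n b) c
        \<oplus>\<^bsub>N\<^esub> (lact N v (F b c) \<oplus>\<^bsub>N\<^esub> F v (b \<otimes>\<^bsub>A\<^esub> c))"
      using v b c by (simp add: m_assoc N_simps N.ract_mult N.N.a_ac)
    also have "\<dots> = lact N v (lact N b (g c)) \<oplus>\<^bsub>N\<^esub> lact N v (ract N (g b) c) \<oplus>\<^bsub>N\<^esub> ract N (ract N n b) c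
        \<oplus>\<^bsub>N\<^esub> (F (v \<otimes>\<^bsub>A\<^esub> b) c \<oplus>\<^bsub>N\<^esub> ract N (F v b) c)"
      using v b c by (simp add: cocycle)
    also have "\<dots> = lact N (v \<otimes>\<^bsub>A\<^esub> b) (g c) \<oplus>\<^bsub>N\<^esub> ract N (g (v \<otimes>\<^bsub>A\<^esub> b)) c \<oplus>\<^bsub>N\<^esub> F (v \<otimes>\<^bsub>A\<^esub> b) c"
      using v b c by (simp add: N_simps N.lact_mult N.lact_ract N.N.a_ac)
    finally show ?thesis .
  qed
  have "g (b \<otimes>\<^bsub>A\<^esub> c) = lact N b (g c) \<oplus>\<^bsub>N\<^esub> ract N (g b) c \<oplus>\<^bsub>N\<^esub> F b c"
    if "b \<in> carrier A" and c: "c \<in> carrier A" for b c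
    using that(1)
  proof (induction rule: generator_induct)
    case one
    have g1: "g \<one>\<^bsub>A\<^esub> \<oplus>\<^bsub>N\<^esub> F \<one>\<^bsub>A\<^esub> \<one>\<^bsub>A\<^esub> = \<zero>\<^bsub>N\<^esub>" by (simp add: g_def T N.N.l_neg)
    have "F \<one>\<^bsub>A\<^esub> c \<oplus>\<^bsub>N\<^esub> F \<one>\<^bsub>A\<^esub> c = F \<one>\<^bsub>A\<^esub> c \<oplus>\<^bsub>N\<^esub> ract N (F \<one>\<^bsub>A\<^esub> \<one>\<^bsub>A\<^esub>) c"
      using cocycle[of "\<one>\<^bsub>A\<^esub>" "\<one>\<^bsub>A\<^esub>" c] c by (simp add: N.lact_one)
    then have "F \<one>\<^bsub>A\<^esub> c = ract N (F \<one>\<^bsub>A\<^esub> \<one>\<^bsub>A\<^esub>) c" using c by simp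
    then have "ract N (g \<one>\<^bsub>A\<^esub>) c \<oplus>\<^bsub>N\<^esub> F \<one>\<^bsub>A\<^esub> c = ract N \<zero>\<^bsub>N\<^esub> c"
      using c by (simp flip: N.ract_add_left add: g1)
    also have "\<dots> = \<zero>\<^bsub>N\<^esub>" using N.ract_smult_left[of 0 c "\<zero>\<^bsub>N\<^esub>"] c N.N.smult_l_null[of "ract N \<zero>\<^bsub>N\<^esub> c"] by simp
    finally show ?case using c by (simp add: N.lact_one N.N.a_assoc)
  next
    case (add b d)
    then show ?case using c by (simp add: l_distr N_simps F_simps linear_maps_add[OF g] N.N.a_ac)
  next
    case (smult k b)
    then show ?case using c by (simp add: smult_mult_left N_simps F_simps linear_maps_smult[OF g])
  next
    case (x b)
    then show ?case using c n by (intro step[OF _ _ g_gen(1)]) auto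
  next
    case (y b)
    then show ?case using c n by (intro step[OF _ _ g_gen(2)]) auto
  qed
  with g show ?thesis by (rule that)
qed

lemma funpow_linear: "T \<in> linear_maps complex_ring A A \<Longrightarrow> T ^^ k \<in> linear_maps complex_ring A A"
proof (induction k)
  case 0
  show ?case by (rule linear_mapsI) simp_all
next
  case (Suc k)
  then show ?case by (intro linear_mapsI) (simp_all add: linear_maps_closed linear_maps_add linear_maps_smult[of _ complex_ring])
qed

text \<open>The algebra acts on \<open>A \<times> A\<close> by \<open>x (c, t) = (x c, c)\<close> and \<open>y (c, t) = (y c, (y - 1 / a) t)\<close>, where the
  shift by \<open>1 / a\<close> is what the relation requires. The orbit map of \<open>(1, 0)\<close> has the form \<open>c \<mapsto> (c, T c)\<close>,
  so \<open>T (x c) = c\<close> and \<open>T (y c) = (y - 1 / a) T c\<close>. In terms of the basis \<open>x\<^sup>i y\<^sup>j\<close> the map \<open>T\<close> deletes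
  one leading \<open>x\<close> and annihilates the powers of \<open>y\<close>.\<close>

lemma left_division_by_x:
  assumes "a \<noteq> 0"
  obtains T where "T \<in> linear_maps complex_ring A A" "T \<one>\<^bsub>A\<^esub> = \<zero>\<^bsub>A\<^esub>"
    "\<And>c. c \<in> carrier A \<Longrightarrow> T (x \<otimes>\<^bsub>A\<^esub> c) = c" "\<And>c. c \<in> carrier A \<Longrightarrow> \<exists>k. (T ^^ k) c = \<zero>\<^bsub>A\<^esub>"
proof -
  define V where "V = prod_module A A"
  have V: "module complex_ring V" unfolding V_def by (rule module_prod_module) (rule module_axioms)+
  define \<xi> where "\<xi> u = (x \<otimes>\<^bsub>A\<^esub> fst u, fst u)"
    for u :: "(generator free_monoid \<Rightarrow>\<^sub>0 complex) set \<times> (generator free_monoid \<Rightarrow>\<^sub>0 complex) set"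
  define \<eta> where "\<eta> u = (y \<otimes>\<^bsub>A\<^esub> fst u, y \<otimes>\<^bsub>A\<^esub> snd u \<oplus>\<^bsub>A\<^esub> (- 1 / a) \<odot>\<^bsub>A\<^esub> snd u)" for u
  have X: "\<xi> \<in> linear_maps complex_ring V V"
    by (rule linear_mapsI) (auto simp: V_def \<xi>_def r_distr smult_mult_right)
  have comm: "c \<odot>\<^bsub>A\<^esub> (d \<odot>\<^bsub>A\<^esub> t) = d \<odot>\<^bsub>A\<^esub> (c \<odot>\<^bsub>A\<^esub> t)" if "t \<in> carrier A" for c d t
    using that smult_assoc1[of c d t] smult_assoc1[of d c t] by (simp add: mult.commute)
  have Y: "\<eta> \<in> linear_maps complex_ring V V"
    by (rule linear_mapsI) (auto simp: V_def \<eta>_def r_distr smult_mult_right smult_r_distr M.a_ac comm)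
  have cancel: "a \<odot>\<^bsub>A\<^esub> ((- 1 / a) \<odot>\<^bsub>A\<^esub> c) \<oplus>\<^bsub>A\<^esub> c = \<zero>\<^bsub>A\<^esub>" if "c \<in> carrier A" for c
    using that assms smult_assoc1[of a "- 1 / a" c] smult_l_distr[of "- 1" 1 c] smult_one[of c] smult_l_null[of c] by simp
  have rel: "a \<odot>\<^bsub>V\<^esub> \<xi> (\<eta> u) = a \<odot>\<^bsub>V\<^esub> \<eta> (\<xi> u) \<oplus>\<^bsub>V\<^esub> \<xi> u" if uV: "u \<in> carrier V" for u
  proof -
    obtain c t where u: "u = (c, t)" "c \<in> carrier A" "t \<in> carrier A" using uV by (auto simp: V_def)
    have "a \<odot>\<^bsub>A\<^esub> (x \<otimes>\<^bsub>A\<^esub> (y \<otimes>\<^bsub>A\<^esub> c)) = a \<odot>\<^bsub>A\<^esub> (y \<otimes>\<^bsub>A\<^esub> (x \<otimes>\<^bsub>A\<^esub> c)) \<oplus>\<^bsub>A\<^esub> x \<otimes>\<^bsub>A\<^esub> c"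
      using arg_cong[OF relation, of "\<lambda>v. v \<otimes>\<^bsub>A\<^esub> c"] u by (simp add: l_distr smult_mult_left m_assoc)
    then show ?thesis using u by (simp add: V_def \<xi>_def \<eta>_def smult_r_distr M.a_assoc cancel[simplified])
  qed
  have start: "(\<one>\<^bsub>A\<^esub>, \<zero>\<^bsub>A\<^esub>) \<in> carrier V" by (simp add: V_def)
  obtain S where S: "S \<in> linear_maps complex_ring A V" "S \<one>\<^bsub>A\<^esub> = (\<one>\<^bsub>A\<^esub>, \<zero>\<^bsub>A\<^esub>)"
    and S_gen: "\<And>c. c \<in> carrier A \<Longrightarrow> S (x \<otimes>\<^bsub>A\<^esub> c) = \<xi> (S c)"
    "\<And>c. c \<in> carrier A \<Longrightarrow> S (y \<otimes>\<^bsub>A\<^esub> c) = \<eta> (S c)"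
    by (rule universal_property[OF V X Y rel start], assumption) (rule that; assumption)
  define T where "T = snd \<circ> S"
  have S_carrier: "S c \<in> carrier A \<times> carrier A" if "c \<in> carrier A" for c
    using linear_maps_closed[OF S(1) that] by (simp add: V_def)
  have T: "T \<in> linear_maps complex_ring A A"
    by (rule linear_mapsI) (use S_carrier in \<open>auto simp: T_def linear_maps_add[OF S(1)] linear_maps_smult[OF S(1)] V_def mem_Times_iff\<close>)
  have fst_S: "fst (S c) = c" if "c \<in> carrier A" for c
    using that by (induction rule: generator_induct)
      (simp_all add: S S_gen \<xi>_def \<eta>_def linear_maps_add[OF S(1)] linear_maps_smult[OF S(1)] V_def)
  have T_gen: "T (x \<otimes>\<^bsub>A\<^esub> c) = c" "T (y \<otimes>\<^bsub>A\<^esub> c) = y \<otimes>\<^bsub>A\<^esub> T c \<oplus>\<^bsub>A\<^esub> (- 1 / a) \<odot>\<^bsub>A\<^esub> T c" if "c \<in> carrier A" for c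
    using that by (simp_all add: T_def S_gen \<xi>_def \<eta>_def fst_S)
  note Tk = funpow_linear[OF T]
  note Tk_closed [simp] = linear_maps_closed[OF Tk]
  have Tk_zero [simp]: "(T ^^ k) \<zero>\<^bsub>A\<^esub> = \<zero>\<^bsub>A\<^esub>" for k
    using module_axioms by (intro linear_maps_zero[OF _ _ Tk])
  have mono: "(T ^^ j) c = \<zero>\<^bsub>A\<^esub>" if "(T ^^ k) c = \<zero>\<^bsub>A\<^esub>" "k \<le> j" for k j c
    using funpow_add[of "j - k" k T] that by simp
  have Tk_y: "(T ^^ k) (y \<otimes>\<^bsub>A\<^esub> c) = y \<otimes>\<^bsub>A\<^esub> (T ^^ k) c \<oplus>\<^bsub>A\<^esub> (- of_nat k / a) \<odot>\<^bsub>A\<^esub> (T ^^ k) c"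
    if c: "c \<in> carrier A" for k c
  proof (induction k)
    case 0
    show ?case using c smult_l_null[of c] by simp
  next
    case (Suc k)
    let ?d = "(T ^^ Suc k) c"
    have d: "?d \<in> carrier A" using c Tk_closed[of c "Suc k"] by simp
    have "(T ^^ Suc k) (y \<otimes>\<^bsub>A\<^esub> c) = y \<otimes>\<^bsub>A\<^esub> ?d \<oplus>\<^bsub>A\<^esub> ((- 1 / a) \<odot>\<^bsub>A\<^esub> ?d \<oplus>\<^bsub>A\<^esub> (- of_nat k / a) \<odot>\<^bsub>A\<^esub> ?d)"
      using c d by (simp add: Suc linear_maps_add[OF T] linear_maps_smult[OF T] T_gen M.a_assoc)
    also have "\<dots> = y \<otimes>\<^bsub>A\<^esub> ?d \<oplus>\<^bsub>A\<^esub> (- 1 / a - of_nat k / a) \<odot>\<^bsub>A\<^esub> ?d"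
      using smult_l_distr[OF _ _ d, of "- 1 / a" "- of_nat k / a"] by simp
    finally show ?case by (simp add: diff_divide_distrib)
  qed
  have nilpotent: "\<exists>k. (T ^^ k) c = \<zero>\<^bsub>A\<^esub>" if "c \<in> carrier A" for c
    using that
  proof (induction rule: generator_induct)
    case one
    have "(T ^^ 1) \<one>\<^bsub>A\<^esub> = \<zero>\<^bsub>A\<^esub>" by (simp add: T_def S)
    then show ?case by blast
  next
    case (add c d)
    then obtain k j where "(T ^^ k) c = \<zero>\<^bsub>A\<^esub>" "(T ^^ j) d = \<zero>\<^bsub>A\<^esub>" by blast
    then have "(T ^^ max k j) c = \<zero>\<^bsub>A\<^esub>" "(T ^^ max k j) d = \<zero>\<^bsub>A\<^esub>" using mono by auto
    then have "(T ^^ max k j) (c \<oplus>\<^bsub>A\<^esub> d) = \<zero>\<^bsub>A\<^esub>" using add by (simp add: linear_maps_add[OF Tk])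
    then show ?case by blast
  next
    case (smult m c)
    then obtain k where "(T ^^ k) c = \<zero>\<^bsub>A\<^esub>" by blast
    then have "(T ^^ k) (m \<odot>\<^bsub>A\<^esub> c) = \<zero>\<^bsub>A\<^esub>" using smult by (simp add: linear_maps_smult[OF Tk] smult_r_null)
    then show ?case by blast
  next
    case (x c)
    then obtain k where "(T ^^ k) c = \<zero>\<^bsub>A\<^esub>" by blast
    then have "(T ^^ Suc k) (x \<otimes>\<^bsub>A\<^esub> c) = \<zero>\<^bsub>A\<^esub>" using x by (simp add: funpow_Suc_right T_gen del: funpow.simps)
    then show ?case by blast
  next
    case (y c)
    then obtain k where "(T ^^ k) c = \<zero>\<^bsub>A\<^esub>" by blast
    then have "(T ^^ k) (y \<otimes>\<^bsub>A\<^esub> c) = \<zero>\<^bsub>A\<^esub>" using y by (simp add: Tk_y)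
    then show ?case by blast
  qed
  show ?thesis
    using S(2) by (intro that[OF T]) (simp_all add: T_gen nilpotent, simp add: T_def)
qed

text \<open>The formal solution is \<open>n(c) = K(T c) + x K(T\<^sup>2 c) + x\<^sup>2 K(T\<^sup>3 c) + \<dots>\<close>, a finite sum for each \<open>c\<close>
  because \<open>T\<close> is locally nilpotent.\<close>

lemma left_x_recursion:
  assumes "a \<noteq> 0" and N: "weak_bimodule complex_ring A N" and K: "K \<in> linear_maps complex_ring A N"
  obtains n where "n \<in> linear_maps complex_ring A N" "n \<one>\<^bsub>A\<^esub> = \<zero>\<^bsub>N\<^esub>"
    "\<And>c. c \<in> carrier A \<Longrightarrow> n (x \<otimes>\<^bsub>A\<^esub> c) = lact N x (n c) \<oplus>\<^bsub>N\<^esub> K c"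
proof -
  interpret N: weak_bimodule complex_ring A N by (rule N)
  obtain T where T: "T \<in> linear_maps complex_ring A A" "T \<one>\<^bsub>A\<^esub> = \<zero>\<^bsub>A\<^esub>"
    "\<And>c. c \<in> carrier A \<Longrightarrow> T (x \<otimes>\<^bsub>A\<^esub> c) = c" "\<And>c. c \<in> carrier A \<Longrightarrow> \<exists>k. (T ^^ k) c = \<zero>\<^bsub>A\<^esub>"
    by (rule left_division_by_x[OF assms(1)]) (rule that; assumption)
  \<comment> \<open>\<open>G k\<close> is the partial sum with \<open>k\<close> terms.\<close>
  define G where "G = rec_nat (\<lambda>c. \<zero>\<^bsub>N\<^esub>) (\<lambda>k Gk c. lact N x (Gk (T c)) \<oplus>\<^bsub>N\<^esub> K (T c))"
  have G_0: "G 0 c = \<zero>\<^bsub>N\<^esub>" and G_Suc: "G (Suc k) c = lact N x (G k (T c)) \<oplus>\<^bsub>N\<^esub> K (T c)" for k c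
    by (simp_all add: G_def)
  note T_closed = linear_maps_closed[OF T(1)]
  have G: "G k \<in> linear_maps complex_ring A N" for k
  proof (induction k)
    case 0
    show ?case by (rule linear_mapsI) (simp_all add: G_0)
  next
    case (Suc k)
    show ?case
      by (rule linear_mapsI)
        (simp_all add: G_Suc T_closed linear_maps_closed[OF K] linear_maps_closed[OF Suc]
          linear_maps_add[OF T(1)] linear_maps_add[OF K] linear_maps_add[OF Suc]
          linear_maps_smult[OF T(1)] linear_maps_smult[OF K] linear_maps_smult[OF Suc]
          N.lact_add_right N.lact_smult_right N.N.smult_r_distr N.N.a_ac)
  qed
  have G_zero: "G k \<zero>\<^bsub>A\<^esub> = \<zero>\<^bsub>N\<^esub>" for k
    using module_axioms N.N.module_axioms by (intro linear_maps_zero[OF _ _ G])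
  note Tk = funpow_linear[OF T(1)]
  have Tk_zero [simp]: "(T ^^ k) \<zero>\<^bsub>A\<^esub> = \<zero>\<^bsub>A\<^esub>" for k
    using module_axioms by (intro linear_maps_zero[OF _ _ Tk])
  have stable: "G j c = G k c" if "(T ^^ k) c = \<zero>\<^bsub>A\<^esub>" "k \<le> j" for j k c
    using that
  proof (induction k arbitrary: j c)
    case 0
    then show ?case by (simp add: G_zero)
  next
    case (Suc k)
    then obtain i where "j = Suc i" by (cases j) auto
    then show ?case using Suc.IH[of "T c" i] Suc.prems
      by (simp add: G_Suc funpow_Suc_right del: funpow.simps)
  qed
  define n where "n c = G (LEAST k. (T ^^ k) c = \<zero>\<^bsub>A\<^esub>) c" for c
  have n_eq: "n c = G k c" if "(T ^^ k) c = \<zero>\<^bsub>A\<^esub>" for k c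
    unfolding n_def by (rule stable[symmetric]) (rule LeastI[of "\<lambda>k. (T ^^ k) c = \<zero>\<^bsub>A\<^esub>", OF that], rule Least_le[of "\<lambda>k. (T ^^ k) c = \<zero>\<^bsub>A\<^esub>", OF that])
  have mono: "(T ^^ j) c = \<zero>\<^bsub>A\<^esub>" if "(T ^^ k) c = \<zero>\<^bsub>A\<^esub>" "k \<le> j" for k j c
    using funpow_add[of "j - k" k T] that by simp
  have "n \<in> linear_maps complex_ring A N"
  proof (rule linear_mapsI)
    fix c d assume cd: "c \<in> carrier A" "d \<in> carrier A"
    obtain k j where kj: "(T ^^ k) c = \<zero>\<^bsub>A\<^esub>" "(T ^^ j) d = \<zero>\<^bsub>A\<^esub>" using T(4)[OF cd(1)] T(4)[OF cd(2)] by blast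
    have z: "(T ^^ max k j) c = \<zero>\<^bsub>A\<^esub>" "(T ^^ max k j) d = \<zero>\<^bsub>A\<^esub>" using mono kj by auto
    then have "(T ^^ max k j) (c \<oplus>\<^bsub>A\<^esub> d) = \<zero>\<^bsub>A\<^esub>" using cd by (simp add: linear_maps_add[OF Tk])
    then show "n (c \<oplus>\<^bsub>A\<^esub> d) = n c \<oplus>\<^bsub>N\<^esub> n d" using cd z by (simp add: n_eq linear_maps_add[OF G])
  next
    fix m c assume c: "c \<in> carrier A"
    obtain k where k: "(T ^^ k) c = \<zero>\<^bsub>A\<^esub>" using T(4)[OF c] by blast
    then have "(T ^^ k) (m \<odot>\<^bsub>A\<^esub> c) = \<zero>\<^bsub>A\<^esub>" using c by (simp add: linear_maps_smult[OF Tk] smult_r_null)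
    then show "n (m \<odot>\<^bsub>A\<^esub> c) = m \<odot>\<^bsub>N\<^esub> n c" using c k by (simp add: n_eq linear_maps_smult[OF G])
  qed (simp add: n_def linear_maps_closed[OF G])
  moreover have "n \<one>\<^bsub>A\<^esub> = \<zero>\<^bsub>N\<^esub>"
    using n_eq[of 1 "\<one>\<^bsub>A\<^esub>"] module_axioms N.N.module_axioms
    by (simp add: T(2) G_Suc G_0 linear_maps_zero[OF _ _ K] linear_maps_closed[OF K])
  moreover have "n (x \<otimes>\<^bsub>A\<^esub> c) = lact N x (n c) \<oplus>\<^bsub>N\<^esub> K c" if c: "c \<in> carrier A" for c
  proof -
    obtain k where k: "(T ^^ k) c = \<zero>\<^bsub>A\<^esub>" using T(4)[OF c] by blast
    then have "(T ^^ Suc k) (x \<otimes>\<^bsub>A\<^esub> c) = \<zero>\<^bsub>A\<^esub>" using c by (simp add: funpow_Suc_right T del: funpow.simps)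
    from n_eq[OF this] show ?thesis using c by (simp add: n_eq[OF k] G_Suc T)
  qed
  ultimately show ?thesis by (rule that)
qed

end

section \<open>Cochains as bimodules\<close>

lemma tuples_0 [simp]: "tuples A 0 = {[]}"
  by (auto simp: tuples_def)

lemma Cons_tuples [simp]: "b # bs \<in> tuples A (Suc k) \<longleftrightarrow> b \<in> carrier A \<and> bs \<in> tuples A k"
  by (auto simp: tuples_def)

lemma tuples_SucE:
  assumes "as \<in> tuples A (Suc k)"
  obtains b bs where "as = b # bs" "b \<in> carrier A" "bs \<in> tuples A k"
  using assms by (cases as) (auto simp: tuples_def)

lemma tuples_update: "as \<in> tuples A k \<Longrightarrow> b \<in> carrier A \<Longrightarrow> as[i := b] \<in> tuples A k"
  by (auto simp: tuples_def dest: set_update_subset_insert[THEN subsetD])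

lemma tuples_nth: "as \<in> tuples A k \<Longrightarrow> i < k \<Longrightarrow> as ! i \<in> carrier A"
  by (auto simp: tuples_def)

text \<open>The alternating sum \<open>f(a a\<^sub>1, \<dots>) - f(a, a\<^sub>1 a\<^sub>2, \<dots>) + \<dots>\<close> of all faces but the first, up to sign,
  written as a recursion on the degree: after its first term it is the right action of \<open>a\<^sub>1\<close> on
  the cochain \<open>f(a, _)\<close> of lower degree. In this form associativity follows by induction.\<close>

primrec cochain_ract :: "('k, 'a) module \<Rightarrow> ('k, 'a, 'm) bimodule \<Rightarrow> nat \<Rightarrow> ('a list \<Rightarrow> 'm) \<Rightarrow> 'a \<Rightarrow> 'a list \<Rightarrow> 'm" where
  "cochain_ract A M 0 f a = (\<lambda>as\<in>tuples A 0. ract M (f []) a)"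
| "cochain_ract A M (Suc k) f a = (\<lambda>as\<in>tuples A (Suc k). f ((a \<otimes>\<^bsub>A\<^esub> hd as) # tl as)
     \<ominus>\<^bsub>M\<^esub> cochain_ract A M k (\<lambda>bs\<in>tuples A k. f (a # bs)) (hd as) (tl as))"

definition cochain_bimodule :: "'k ring \<Rightarrow> ('k, 'a) module \<Rightarrow> ('k, 'a, 'm) bimodule \<Rightarrow> nat
    \<Rightarrow> ('k, 'a, 'a list \<Rightarrow> 'm) bimodule" where
  "cochain_bimodule R A M k = \<lparr>carrier = hochschild_cochains R A M k, monoid.mult = undefined, one = undefined,
     ring.zero = \<lambda>as\<in>tuples A k. \<zero>\<^bsub>M\<^esub>, add = \<lambda>f g. \<lambda>as\<in>tuples A k. f as \<oplus>\<^bsub>M\<^esub> g as,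
     module.smult = \<lambda>c f. \<lambda>as\<in>tuples A k. c \<odot>\<^bsub>M\<^esub> f as,
     lact = \<lambda>a f. \<lambda>as\<in>tuples A k. lact M a (f as), ract = cochain_ract A M k\<rparr>"

context bimodule
begin

abbreviation C :: "nat \<Rightarrow> ('k, 'a, 'a list \<Rightarrow> 'm) bimodule" where "C \<equiv> cochain_bimodule R A M"

definition curry_at :: "nat \<Rightarrow> ('a list \<Rightarrow> 'm) \<Rightarrow> 'a \<Rightarrow> 'a list \<Rightarrow> 'm" where
  "curry_at k f a = (\<lambda>bs\<in>tuples A k. f (a # bs))"

lemma C_simps:
  "carrier (C k) = hochschild_cochains R A M k"
  "\<zero>\<^bsub>C k\<^esub> = (\<lambda>as\<in>tuples A k. \<zero>\<^bsub>M\<^esub>)"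
  "f \<oplus>\<^bsub>C k\<^esub> g = (\<lambda>as\<in>tuples A k. f as \<oplus>\<^bsub>M\<^esub> g as)"
  "c \<odot>\<^bsub>C k\<^esub> f = (\<lambda>as\<in>tuples A k. c \<odot>\<^bsub>M\<^esub> f as)"
  "lact (C k) a f = (\<lambda>as\<in>tuples A k. lact M a (f as))"
  "ract (C k) f a = cochain_ract A M k f a"
  by (simp_all add: cochain_bimodule_def)

lemma cochain_closed: "f \<in> carrier (C k) \<Longrightarrow> as \<in> tuples A k \<Longrightarrow> f as \<in> carrier M"
  and cochain_extensional: "f \<in> carrier (C k) \<Longrightarrow> f \<in> extensional (tuples A k)"
  and cochain_add: "f \<in> carrier (C k) \<Longrightarrow> as \<in> tuples A k \<Longrightarrow> i < k \<Longrightarrow> b \<in> carrier A \<Longrightarrow>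
    f (as[i := as ! i \<oplus>\<^bsub>A\<^esub> b]) = f as \<oplus>\<^bsub>M\<^esub> f (as[i := b])"
  and cochain_smult: "f \<in> carrier (C k) \<Longrightarrow> as \<in> tuples A k \<Longrightarrow> i < k \<Longrightarrow> c \<in> carrier R \<Longrightarrow>
    f (as[i := c \<odot>\<^bsub>A\<^esub> as ! i]) = c \<odot>\<^bsub>M\<^esub> f as"
  by (auto simp: C_simps hochschild_cochains_def PiE_def)

lemma cochainI:
  assumes "\<And>as. as \<in> tuples A k \<Longrightarrow> f as \<in> carrier M" "f \<in> extensional (tuples A k)"
    "\<And>as i b. as \<in> tuples A k \<Longrightarrow> i < k \<Longrightarrow> b \<in> carrier A \<Longrightarrow>
      f (as[i := as ! i \<oplus>\<^bsub>A\<^esub> b]) = f as \<oplus>\<^bsub>M\<^esub> f (as[i := b])"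
    "\<And>as i c. as \<in> tuples A k \<Longrightarrow> i < k \<Longrightarrow> c \<in> carrier R \<Longrightarrow> f (as[i := c \<odot>\<^bsub>A\<^esub> as ! i]) = c \<odot>\<^bsub>M\<^esub> f as"
  shows "f \<in> carrier (C k)"
  using assms by (auto simp: C_simps hochschild_cochains_def PiE_iff)

lemma restrict_cochainI:
  assumes "\<And>as. as \<in> tuples A k \<Longrightarrow> f as \<in> carrier M" 
    "\<And>as i b. as \<in> tuples A k \<Longrightarrow> i < k \<Longrightarrow> b \<in> carrier A \<Longrightarrow>
      f (as[i := as ! i \<oplus>\<^bsub>A\<^esub> b]) = f as \<oplus>\<^bsub>M\<^esub> f (as[i := b])"
    "\<And>as i c. as \<in> tuples A k \<Longrightarrow> i < k \<Longrightarrow> c \<in> carrier R \<Longrightarrow> f (as[i := c \<odot>\<^bsub>A\<^esub> as ! i]) = c \<odot>\<^bsub>M\<^esub> f as"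
  shows "restrict f (tuples A k) \<in> carrier (C k)"
  using assms by (intro cochainI) (simp_all add: tuples_update tuples_nth)

lemma smult_commute: "c \<in> carrier R \<Longrightarrow> d \<in> carrier R \<Longrightarrow> m \<in> carrier M \<Longrightarrow>
    c \<odot>\<^bsub>M\<^esub> (d \<odot>\<^bsub>M\<^esub> m) = d \<odot>\<^bsub>M\<^esub> (c \<odot>\<^bsub>M\<^esub> m)"
  using M.smult_assoc1[of c d m] M.smult_assoc1[of d c m] R.m_comm[of c d] by simp

lemma C_zero_closed: "\<zero>\<^bsub>C k\<^esub> \<in> carrier (C k)"
  unfolding C_simps(2) by (rule restrict_cochainI) simp_all

lemma C_add_closed: "f \<in> carrier (C k) \<Longrightarrow> g \<in> carrier (C k) \<Longrightarrow> f \<oplus>\<^bsub>C k\<^esub> g \<in> carrier (C k)"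
  unfolding C_simps(3)
  by (rule restrict_cochainI)
    (simp_all add: cochain_closed cochain_add cochain_smult tuples_update M.M.a_ac M.smult_r_distr)

lemma C_smult_closed: "c \<in> carrier R \<Longrightarrow> f \<in> carrier (C k) \<Longrightarrow> c \<odot>\<^bsub>C k\<^esub> f \<in> carrier (C k)"
  unfolding C_simps(4)
  by (rule restrict_cochainI)
    (simp_all add: cochain_closed cochain_add cochain_smult tuples_update M.smult_r_distr smult_commute)

lemma C_lact_closed: "a \<in> carrier A \<Longrightarrow> f \<in> carrier (C k) \<Longrightarrow> lact (C k) a f \<in> carrier (C k)"
  unfolding C_simps(5)
  by (rule restrict_cochainI)
    (simp_all add: cochain_closed cochain_add cochain_smult tuples_update lact_closed lact_add_right lact_smult_right)

lemma cochain_eqI: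
  assumes "f \<in> carrier (C k)" "g \<in> carrier (C k)" "\<And>as. as \<in> tuples A k \<Longrightarrow> f as = g as"
  shows "f = g"
  using assms by (intro extensionalityI[of _ "tuples A k"]) (auto intro: cochain_extensional)

lemma module_C: "module R (C k)"
proof -
  have "abelian_group (C k)"
  proof (rule abelian_groupI)
    fix f assume f: "f \<in> carrier (C k)"
    have "(\<ominus>\<^bsub>R\<^esub> \<one>\<^bsub>R\<^esub>) \<odot>\<^bsub>C k\<^esub> f \<oplus>\<^bsub>C k\<^esub> f = \<zero>\<^bsub>C k\<^esub>"
      by (rule cochain_eqI[of _ k])
        (use f in \<open>simp_all add: C_add_closed C_smult_closed C_zero_closed\<close>,
         simp add: C_simps(2-4) cochain_closed[OF f] M.smult_l_minus M.M.l_neg)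
    then show "\<exists>g\<in>carrier (C k). g \<oplus>\<^bsub>C k\<^esub> f = \<zero>\<^bsub>C k\<^esub>" using f C_smult_closed by blast
  next
    fix f assume f: "f \<in> carrier (C k)"
    show "\<zero>\<^bsub>C k\<^esub> \<oplus>\<^bsub>C k\<^esub> f = f"
      by (rule cochain_eqI[of _ k]) (use f in \<open>simp_all add: C_add_closed C_zero_closed\<close>,
        simp add: C_simps(2-3) cochain_closed[OF f])
  qed (auto simp: C_add_closed C_zero_closed, (simp add: C_simps(3) cochain_closed M.M.a_ac cong: restrict_cong)+)
  then show ?thesis
  proof (rule moduleI[OF R.is_cring])
    fix f assume f: "f \<in> carrier (C k)"
    show "\<one>\<^bsub>R\<^esub> \<odot>\<^bsub>C k\<^esub> f = f"
      by (rule cochain_eqI[of _ k]) (use f in \<open>simp_all add: C_smult_closed\<close>, simp add: C_simps(4) cochain_closed[OF f])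
  qed (auto simp: C_smult_closed, (simp add: C_simps(3,4) cochain_closed M.smult_l_distr M.smult_r_distr M.smult_assoc1 cong: restrict_cong)+)
qed

lemma C_minus_apply:
  assumes "f \<in> carrier (C k)" "g \<in> carrier (C k)" "as \<in> tuples A k"
  shows "(f \<ominus>\<^bsub>C k\<^esub> g) as = f as \<ominus>\<^bsub>M\<^esub> g as"
proof -
  interpret C: module R "C k" by (rule module_C)
  have "f = (f \<ominus>\<^bsub>C k\<^esub> g) \<oplus>\<^bsub>C k\<^esub> g" using assms by (simp add: a_minus_def C.M.a_assoc C.M.l_neg)
  then have "f as = ((f \<ominus>\<^bsub>C k\<^esub> g) \<oplus>\<^bsub>C k\<^esub> g) as" by simp
  also have "\<dots> = (f \<ominus>\<^bsub>C k\<^esub> g) as \<oplus>\<^bsub>M\<^esub> g as" using assms(3) by (simp add: C_simps(3))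
  finally show ?thesis using assms cochain_closed[of _ k as]
    by (simp add: a_minus_def M.M.a_assoc M.M.r_neg)
qed

lemma cochain_Cons_add: "f \<in> carrier (C (Suc k)) \<Longrightarrow> a \<in> carrier A \<Longrightarrow> b \<in> carrier A \<Longrightarrow> as \<in> tuples A k \<Longrightarrow>
    f ((a \<oplus>\<^bsub>A\<^esub> b) # as) = f (a # as) \<oplus>\<^bsub>M\<^esub> f (b # as)"
  using cochain_add[of f "Suc k" "a # as" 0 b] by simp

lemma cochain_Cons_smult: "f \<in> carrier (C (Suc k)) \<Longrightarrow> a \<in> carrier A \<Longrightarrow> c \<in> carrier R \<Longrightarrow> as \<in> tuples A k \<Longrightarrow>
    f ((c \<odot>\<^bsub>A\<^esub> a) # as) = c \<odot>\<^bsub>M\<^esub> f (a # as)"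
  using cochain_smult[of f "Suc k" "a # as" 0 c] by simp

lemma curry_closed: "f \<in> carrier (C (Suc k)) \<Longrightarrow> a \<in> carrier A \<Longrightarrow> curry_at k f a \<in> carrier (C k)"
  unfolding curry_at_def
  using cochain_closed[of f "Suc k"] cochain_add[of f "Suc k" "a # _" "Suc _"] cochain_smult[of f "Suc k" "a # _" "Suc _"]
  by (intro restrict_cochainI) simp_all

lemma curry_linear: "f \<in> carrier (C (Suc k)) \<Longrightarrow> curry_at k f \<in> linear_maps R A (C k)"
proof (rule linear_mapsI)
  fix a b assume "f \<in> carrier (C (Suc k))" "a \<in> carrier A" "b \<in> carrier A"
  then show "curry_at k f (a \<oplus>\<^bsub>A\<^esub> b) = curry_at k f a \<oplus>\<^bsub>C k\<^esub> curry_at k f b"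
    by (simp add: curry_at_def C_simps(3) cochain_Cons_add cong: restrict_cong)
next
  fix a c assume "f \<in> carrier (C (Suc k))" "a \<in> carrier A" "c \<in> carrier R"
  then show "curry_at k f (c \<odot>\<^bsub>A\<^esub> a) = c \<odot>\<^bsub>C k\<^esub> curry_at k f a"
    by (simp add: curry_at_def C_simps(4) cochain_Cons_smult cong: restrict_cong)
qed (rule curry_closed)

lemma curry_eqI:
  assumes "f \<in> extensional (tuples A (Suc k))" "g \<in> extensional (tuples A (Suc k))"
    "\<And>a. a \<in> carrier A \<Longrightarrow> curry_at k f a = curry_at k g a"
  shows "f = g"
proof (rule extensionalityI[OF assms(1,2)])
  fix as assume "as \<in> tuples A (Suc k)"
  then obtain b bs where "as = b # bs" "b \<in> carrier A" "bs \<in> tuples A k" by (rule tuples_SucE)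
  then show "f as = g as" using fun_cong[OF assms(3)[of b], of bs] by (simp add: curry_at_def)
qed

text \<open>Together with \<open>curry_linear\<close> this identifies \<open>C\<^sup>k\<^sup>+\<^sup>1\<close> with the linear maps from \<open>A\<close> to
  \<open>C\<^sup>k\<close>, which makes induction on the degree possible.\<close>

lemma cochain_curryI:
  assumes "f \<in> extensional (tuples A (Suc k))" "curry_at k f \<in> linear_maps R A (C k)"
  shows "f \<in> carrier (C (Suc k))"
proof -
  have f_eq: "f (b # bs) = curry_at k f b bs" if "bs \<in> tuples A k" for b bs
    using that by (simp add: curry_at_def)
  note closed = linear_maps_closed[OF assms(2)]
  show ?thesis
  proof (rule cochainI)
    fix as assume "as \<in> tuples A (Suc k)"
    then show "f as \<in> carrier M" by (elim tuples_SucE) (simp add: f_eq cochain_closed[OF closed])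
  next
    fix as i d assume "as \<in> tuples A (Suc k)" and i: "i < Suc k" and d: "d \<in> carrier A"
    then obtain b bs where as: "as = b # bs" "b \<in> carrier A" "bs \<in> tuples A k" by (elim tuples_SucE)
    show "f (as[i := as ! i \<oplus>\<^bsub>A\<^esub> d]) = f as \<oplus>\<^bsub>M\<^esub> f (as[i := d])"
    proof (cases i)
      case 0
      then show ?thesis using as d
        by (simp add: f_eq linear_maps_add[OF assms(2)] C_simps(3))
    next
      case (Suc j)
      then show ?thesis using as d i
        by (simp add: f_eq tuples_update tuples_nth cochain_add[OF closed])
    qed
  next
    fix as i c assume "as \<in> tuples A (Suc k)" and i: "i < Suc k" and c: "c \<in> carrier R"
    then obtain b bs where as: "as = b # bs" "b \<in> carrier A" "bs \<in> tuples A k" by (elim tuples_SucE)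
    show "f (as[i := c \<odot>\<^bsub>A\<^esub> as ! i]) = c \<odot>\<^bsub>M\<^esub> f as"
    proof (cases i)
      case 0
      then show ?thesis using as c
        by (simp add: f_eq linear_maps_smult[OF assms(2)] C_simps(4))
    next
      case (Suc j)
      then show ?thesis using as c i
        by (simp add: f_eq tuples_update tuples_nth cochain_smult[OF closed])
    qed
  qed (rule assms(1))
qed

lemma uncurry:
  assumes g: "g \<in> linear_maps R A (C k)"
  obtains f where "f \<in> carrier (C (Suc k))" "\<And>a. a \<in> carrier A \<Longrightarrow> curry_at k f a = g a"
proof
  let ?f = "\<lambda>as\<in>tuples A (Suc k). g (hd as) (tl as)"
  show eq: "curry_at k ?f a = g a" if "a \<in> carrier A" for a
    by (rule extensionalityI[of _ "tuples A k"])
      (use that cochain_extensional[OF linear_maps_closed[OF g]] in \<open>auto simp: curry_at_def\<close>)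
  have "curry_at k ?f \<in> linear_maps R A (C k)"
    by (rule linear_mapsI) (simp_all add: eq linear_maps_closed[OF g] linear_maps_add[OF g] linear_maps_smult[OF g])
  then show "?f \<in> carrier (C (Suc k))" by (intro cochain_curryI) simp_all
qed

lemma curry_simps:
  "curry_at k (f \<oplus>\<^bsub>C (Suc k)\<^esub> g) b = (if b \<in> carrier A then curry_at k f b \<oplus>\<^bsub>C k\<^esub> curry_at k g b else (\<lambda>_\<in>tuples A k. undefined))"
  "curry_at k (c \<odot>\<^bsub>C (Suc k)\<^esub> f) b = (if b \<in> carrier A then c \<odot>\<^bsub>C k\<^esub> curry_at k f b else (\<lambda>_\<in>tuples A k. undefined))"
  "curry_at k (lact (C (Suc k)) a f) b = (if b \<in> carrier A then lact (C k) a (curry_at k f b) else (\<lambda>_\<in>tuples A k. undefined))"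
  by (auto simp: curry_at_def C_simps intro!: restrict_ext)

text \<open>The closure hypothesis is part of the induction hypothesis in the proof that \<open>C\<^sup>k\<close> is a
  weak bimodule; it is discharged in \<open>curry_ract\<close>.\<close>

lemma curry_ract_if_closed:
  assumes "f \<in> carrier (C (Suc k))" "a \<in> carrier A" "b \<in> carrier A"
    and closed: "ract (C k) (curry_at k f a) b \<in> carrier (C k)"
  shows "curry_at k (ract (C (Suc k)) f a) b = curry_at k f (a \<otimes>\<^bsub>A\<^esub> b) \<ominus>\<^bsub>C k\<^esub> ract (C k) (curry_at k f a) b"
proof -
  interpret C: module R "C k" by (rule module_C)
  have "curry_at k f (a \<otimes>\<^bsub>A\<^esub> b) \<ominus>\<^bsub>C k\<^esub> ract (C k) (curry_at k f a) b \<in> extensional (tuples A k)"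
    using assms by (intro cochain_extensional C.M.minus_closed curry_closed) simp_all
  then show ?thesis
    by (intro extensionalityI[of _ "tuples A k"])
      (use assms in \<open>simp_all add: C_minus_apply curry_closed\<close>, simp_all add: curry_at_def C_simps(6))
qed

text \<open>In degree \<open>k + 1\<close> each law is checked after currying, where \<open>(f \<cdot> a)(b) = f(a b) - f(a) \<cdot> b\<close> reduces
  it to laws in degree \<open>k\<close>. For associativity the two terms \<open>f(a) \<cdot> (b c)\<close> and \<open>(f(a) \<cdot> b) \<cdot> c\<close>
  cancel.\<close>

lemma weak_bimodule_C: "weak_bimodule R A (C k)"
proof (induction k)
  case 0
  have ract0: "ract (C 0) f a = (\<lambda>as\<in>{[]}. ract M (f []) a)" for f a by (simp add: C_simps)
  have eqI: "f = g" if "f \<in> extensional {[]}" "g \<in> extensional {[]}" "f [] = g []" for f g :: "'a list \<Rightarrow> 'm"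
    using that by (intro extensionalityI[of _ "{[]}"]) auto
  have closed: "f [] \<in> carrier M" if "f \<in> carrier (C 0)" for f using cochain_closed[OF that] by simp
  have ext: "f \<in> extensional {[]}" if "f \<in> carrier (C 0)" for f using cochain_extensional[OF that] by simp
  note simps = C_simps(3,4,5) ract0 closed lact_closed lact_one lact_mult lact_add_left lact_add_right
    lact_smult_left lact_smult_right ract_closed ract_mult ract_add_left ract_add_right
    ract_smult_left ract_smult_right lact_ract
  show ?case
    by (rule weak_bimodule.intro[OF assoc_algebra_axioms module_C], rule weak_bimodule_axioms.intro;
      (rule C_lact_closed)?; (rule cochainI)?; (rule eqI)?)
      (simp_all add: simps ext)
next
  case (Suc k)
  interpret N: weak_bimodule R A "C k" by (rule Suc)
  note cur_closed [simp] = curry_closed[of _ k]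
  note cur_add = linear_maps_add[OF curry_linear] and cur_smult = linear_maps_smult[OF curry_linear]
  have cur_ract: "curry_at k (ract (C (Suc k)) f a) b
      = curry_at k f (a \<otimes>\<^bsub>A\<^esub> b) \<ominus>\<^bsub>C k\<^esub> ract (C k) (curry_at k f a) b"
    if "f \<in> carrier (C (Suc k))" "a \<in> carrier A" "b \<in> carrier A" for f a b
    using that by (intro curry_ract_if_closed) simp_all
  note N_simps = N.lact_one N.lact_mult N.lact_add_left N.lact_add_right
    N.lact_smult_left N.lact_smult_right N.ract_mult N.ract_add_left N.ract_add_right
    N.ract_smult_left N.ract_smult_right N.lact_ract
    N.N.M.minus_add_distrib2 N.N.smult_minus N.lact_minus N.ract_minus
  have ract_closed': "ract (C (Suc k)) f a \<in> carrier (C (Suc k))"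
    if "f \<in> carrier (C (Suc k))" "a \<in> carrier A" for f a
    by (rule cochain_curryI, simp add: C_simps(6), rule linear_mapsI)
      (use that in \<open>simp_all add: cur_ract cur_add cur_smult r_distr smult_mult_right N_simps\<close>)
  have eqI: "f = g" if "f \<in> carrier (C (Suc k))" "g \<in> carrier (C (Suc k))"
    "\<And>a. a \<in> carrier A \<Longrightarrow> curry_at k f a = curry_at k g a" for f g
    by (rule curry_eqI[of _ k]) (use that(1,2) in \<open>simp_all add: cochain_extensional that(3)\<close>)
  show ?case
    by (rule weak_bimodule.intro[OF assoc_algebra_axioms module_C], rule weak_bimodule_axioms.intro;
      (rule eqI)?)
      (simp_all add: C_lact_closed C_add_closed C_smult_closed ract_closed' curry_simps cur_ract cur_add cur_smult
        N_simps m_assoc l_distr r_distr smult_mult_left smult_mult_right N.N.M.minus_minus_cancel)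
qed

section \<open>The Hochschild differential\<close>

lemma add_pow_minus_one: "m \<in> carrier M \<Longrightarrow> add_pow M (- 1 :: int) m = \<ominus>\<^bsub>M\<^esub> m"
  using M.M.add.int_pow_neg[of m 1] by (simp add: M.M.add.int_pow_1)

lemma uminus_zero_M: "\<ominus>\<^bsub>M\<^esub> \<zero>\<^bsub>M\<^esub> = \<zero>\<^bsub>M\<^esub>"
  by (rule M.M.minus_equality) simp_all

lemma finsum_minus:
  assumes "finite I" "\<And>i. i \<in> I \<Longrightarrow> f i \<in> carrier M"
  shows "(\<Oplus>\<^bsub>M\<^esub>i\<in>I. \<ominus>\<^bsub>M\<^esub> f i) = \<ominus>\<^bsub>M\<^esub> (\<Oplus>\<^bsub>M\<^esub>i\<in>I. f i)"
  using assms by (induction I) (simp_all add: M.M.finsum_insert Pi_def M.M.minus_add uminus_zero_M)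

lemma face_closed:
  assumes f: "f \<in> carrier (C k)" and as: "as \<in> tuples A (Suc k)" and i: "i \<le> Suc k"
  shows "hochschild_face A M i f as \<in> carrier M"
proof -
  have len: "length as = Suc k" and sub: "set as \<subseteq> carrier A" using as by (auto simp: tuples_def)
  have "as \<noteq> []" using len by auto
  then have "hd as \<in> carrier A" "last as \<in> carrier A" using sub by auto
  moreover have "tl as \<in> tuples A k" "butlast as \<in> tuples A k"
    using len sub by (auto simp: tuples_def dest: in_set_butlastD list.set_sel(2)[rotated])
  moreover have "take (i - 1) as @ [as ! (i - 1) \<otimes>\<^bsub>A\<^esub> as ! i] @ drop (i + 1) as \<in> tuples A k"
    if "i \<noteq> 0" "i \<noteq> length as"
  proof -
    have "as ! (i - 1) \<in> carrier A" "as ! i \<in> carrier A"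
      using tuples_nth[OF as, of "i - 1"] tuples_nth[OF as, of i] that len i by auto
    then show ?thesis using that len i sub
      by (auto simp: tuples_def dest: in_set_takeD in_set_dropD)
  qed
  ultimately show ?thesis using f cochain_closed[OF f]
    by (auto simp: hochschild_face_def lact_closed ract_closed)
qed

text \<open>Face \<open>i + 2\<close> of \<open>f\<close> at \<open>(a, b, \<dots>)\<close> is face \<open>i + 1\<close> of \<open>f(a, _)\<close> at \<open>(b, \<dots>)\<close>, with the opposite sign.
  So the sum over the faces beyond the first follows the recursion of the right action.\<close>

lemma higher_faces:
  assumes "f \<in> carrier (C k)" "a \<in> carrier A" "as \<in> tuples A k"
  shows "(\<Oplus>\<^bsub>M\<^esub>i\<in>{..k}. add_pow M ((- 1) ^ Suc i :: int) (hochschild_face A M (Suc i) f (a # as)))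
    = \<ominus>\<^bsub>M\<^esub> ract (C k) f a as"
  using assms
proof (induction k arbitrary: f a as)
  case 0
  then show ?case
    using cochain_closed[of f 0 "[]"] by (simp add: hochschild_face_def C_simps ract_closed add_pow_minus_one)
next
  case (Suc k)
  interpret N: weak_bimodule R A "C k" by (rule weak_bimodule_C)
  obtain b bs where as: "as = b # bs" "b \<in> carrier A" "bs \<in> tuples A k"
    using Suc.prems(3) by (elim tuples_SucE)
  let ?term = "\<lambda>i. add_pow M ((- 1) ^ Suc i :: int) (hochschild_face A M (Suc i) f (a # as))"
  let ?term' = "\<lambda>i. add_pow M ((- 1) ^ Suc i :: int) (hochschild_face A M (Suc i) (curry_at k f a) (b # bs))"
  have cur: "curry_at k f a \<in> carrier (C k)" using Suc.prems by (intro curry_closed)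
  have face': "hochschild_face A M (Suc i) (curry_at k f a) (b # bs) \<in> carrier M" if "i \<le> k" for i
    using that as by (intro face_closed[OF cur]) simp_all
  have term_Suc: "?term (Suc i) = \<ominus>\<^bsub>M\<^esub> ?term' i" if i: "i \<le> k" for i
  proof -
    have len: "length bs = k" using as by (simp add: tuples_def)
    have "hochschild_face A M (Suc (Suc i)) f (a # as) = hochschild_face A M (Suc i) (curry_at k f a) (b # bs)"
    proof (cases "i = k")
      case True
      have "butlast (b # bs) \<in> tuples A k" 
        using as by (auto simp: tuples_def dest: in_set_butlastD)
      then show ?thesis using True len as by (simp add: hochschild_face_def curry_at_def)
    next
      case False
      have "(b # bs) ! i \<in> carrier A" "bs ! i \<in> carrier A"
        using tuples_nth[of "b # bs" A "Suc k" i] tuples_nth[of bs A k i] as i False by auto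
      then have "take i (b # bs) @ [(b # bs) ! i \<otimes>\<^bsub>A\<^esub> bs ! i] @ drop (Suc i) bs \<in> tuples A k"
        using as i False len set_take_subset[of i "b # bs"] by (auto simp: tuples_def dest: in_set_dropD)
      then show ?thesis using False len as i by (simp add: hochschild_face_def curry_at_def)
    qed
    then show ?thesis using face'[OF i] by (simp add: M.M.add.int_pow_neg)
  qed
  have term'_closed: "?term' i \<in> carrier M" if "i \<le> k" for i
    using face'[OF that] by (intro M.M.add.int_pow_closed)
  have face1: "hochschild_face A M 1 f (a # as) = f ((a \<otimes>\<^bsub>A\<^esub> b) # bs)"
    using as by (simp add: hochschild_face_def)
  have f_closed: "f ((a \<otimes>\<^bsub>A\<^esub> b) # bs) \<in> carrier M"
    using Suc.prems as by (intro cochain_closed[of f "Suc k"]) simp_all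
  have r_closed: "ract (C k) (curry_at k f a) b bs \<in> carrier M"
    using cochain_closed[of "ract (C k) (curry_at k f a) b" k bs] cur as by simp
  have "?term i \<in> carrier M" if "i \<le> Suc k" for i
    using that Suc.prems by (intro M.M.add.int_pow_closed face_closed[of f "Suc k"]) simp_all
  then have "(\<Oplus>\<^bsub>M\<^esub>i\<in>{..Suc k}. ?term i) = (\<Oplus>\<^bsub>M\<^esub>i\<in>{..k}. ?term (Suc i)) \<oplus>\<^bsub>M\<^esub> ?term 0"
    by (intro M.M.finsum_Suc2) auto
  also have "(\<Oplus>\<^bsub>M\<^esub>i\<in>{..k}. ?term (Suc i)) = (\<Oplus>\<^bsub>M\<^esub>i\<in>{..k}. \<ominus>\<^bsub>M\<^esub> ?term' i)"
    using term'_closed by (intro M.M.finsum_cong') (auto simp only: term_Suc atMost_iff Pi_iff M.M.a_inv_closed)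
  also have "\<dots> = \<ominus>\<^bsub>M\<^esub> (\<ominus>\<^bsub>M\<^esub> ract (C k) (curry_at k f a) b bs)"
    unfolding Suc.IH[OF cur as(2,3), symmetric]
    by (rule finsum_minus) (simp, rule term'_closed, simp only: atMost_iff)
  also have "?term 0 = \<ominus>\<^bsub>M\<^esub> f ((a \<otimes>\<^bsub>A\<^esub> b) # bs)"
    using f_closed face1 by (simp add: add_pow_minus_one)
  also have "\<ominus>\<^bsub>M\<^esub> (\<ominus>\<^bsub>M\<^esub> ract (C k) (curry_at k f a) b bs) \<oplus>\<^bsub>M\<^esub> \<ominus>\<^bsub>M\<^esub> f ((a \<otimes>\<^bsub>A\<^esub> b) # bs)
      = \<ominus>\<^bsub>M\<^esub> (f ((a \<otimes>\<^bsub>A\<^esub> b) # bs) \<ominus>\<^bsub>M\<^esub> ract (C k) (curry_at k f a) b bs)"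
    using f_closed r_closed by (simp add: a_minus_def M.M.minus_add M.M.a_ac)
  also have "f ((a \<otimes>\<^bsub>A\<^esub> b) # bs) \<ominus>\<^bsub>M\<^esub> ract (C k) (curry_at k f a) b bs = ract (C (Suc k)) f a as"
    using as Suc.prems by (simp add: C_simps(6) curry_at_def)
  finally show ?case .
qed

lemma curry_diff:
  assumes f: "f \<in> carrier (C k)" and a: "a \<in> carrier A"
  shows "curry_at k (hochschild_diff A M k f) a = lact (C k) a f \<ominus>\<^bsub>C k\<^esub> ract (C k) f a"
proof -
  interpret N: weak_bimodule R A "C k" by (rule weak_bimodule_C)
  have closed: "lact (C k) a f \<in> carrier (C k)" "ract (C k) f a \<in> carrier (C k)" using f a by simp_all
  show ?thesis
  proof (rule extensionalityI[of _ "tuples A k"])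
    show "lact (C k) a f \<ominus>\<^bsub>C k\<^esub> ract (C k) f a \<in> extensional (tuples A k)"
      using closed by (intro cochain_extensional N.N.M.minus_closed)
  next
    fix as assume as: "as \<in> tuples A k"
    let ?term = "\<lambda>i. add_pow M ((- 1) ^ i :: int) (hochschild_face A M i f (a # as))"
    have "?term i \<in> carrier M" if "i \<le> Suc k" for i
      using that a as f by (intro M.M.add.int_pow_closed face_closed[of f k]) simp_all
    then have "(\<Oplus>\<^bsub>M\<^esub>i\<in>{..Suc k}. ?term i) = (\<Oplus>\<^bsub>M\<^esub>i\<in>{..k}. ?term (Suc i)) \<oplus>\<^bsub>M\<^esub> ?term 0"
      by (intro M.M.finsum_Suc2) auto
    also have "\<dots> = \<ominus>\<^bsub>M\<^esub> ract (C k) f a as \<oplus>\<^bsub>M\<^esub> ?term 0" by (simp only: higher_faces[OF f a as])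
    also have "?term 0 = lact M a (f as)"
      using lact_closed[OF a cochain_closed[OF f as]] by (simp add: hochschild_face_def)
    also have "\<ominus>\<^bsub>M\<^esub> ract (C k) f a as \<oplus>\<^bsub>M\<^esub> lact M a (f as) = lact M a (f as) \<ominus>\<^bsub>M\<^esub> ract (C k) f a as"
      using lact_closed[OF a cochain_closed[OF f as]] cochain_closed[OF closed(2) as]
      by (simp add: a_minus_def M.M.a_comm)
    also have "\<dots> = (lact (C k) a f \<ominus>\<^bsub>C k\<^esub> ract (C k) f a) as"
      using closed as by (simp add: C_minus_apply C_simps(5))
    finally show "curry_at k (hochschild_diff A M k f) a as = (lact (C k) a f \<ominus>\<^bsub>C k\<^esub> ract (C k) f a) as"
      using a as by (simp add: curry_at_def hochschild_diff_def)
  qed (simp add: curry_at_def)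
qed

lemma diff_closed:
  assumes f: "f \<in> carrier (C k)"
  shows "hochschild_diff A M k f \<in> carrier (C (Suc k))"
proof (rule cochain_curryI)
  interpret N: weak_bimodule R A "C k" by (rule weak_bimodule_C)
  show "curry_at k (hochschild_diff A M k f) \<in> linear_maps R A (C k)"
    by (rule linear_mapsI) (use f in \<open>simp_all add: curry_diff N.lact_add_left N.ract_add_right
       N.lact_smult_left N.ract_smult_right N.N.M.minus_add_distrib2 N.N.smult_minus\<close>)
qed (simp add: hochschild_diff_def)

section \<open>Cocycles, coboundaries and cohomology groups\<close>

lemma curry_zero: "a \<in> carrier A \<Longrightarrow> curry_at k \<zero>\<^bsub>C (Suc k)\<^esub> a = \<zero>\<^bsub>C k\<^esub>"
  by (auto simp: curry_at_def C_simps(2) intro!: restrict_ext)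

lemma curry_ract:
  assumes "f \<in> carrier (C (Suc k))" "a \<in> carrier A" "b \<in> carrier A"
  shows "curry_at k (ract (C (Suc k)) f a) b = curry_at k f (a \<otimes>\<^bsub>A\<^esub> b) \<ominus>\<^bsub>C k\<^esub> ract (C k) (curry_at k f a) b"
proof -
  interpret N: weak_bimodule R A "C k" by (rule weak_bimodule_C)
  show ?thesis using assms by (intro curry_ract_if_closed) (simp_all add: curry_closed)
qed

lemma curry_minus:
  assumes "f \<in> carrier (C (Suc k))" "g \<in> carrier (C (Suc k))" "b \<in> carrier A"
  shows "curry_at k (f \<ominus>\<^bsub>C (Suc k)\<^esub> g) b = curry_at k f b \<ominus>\<^bsub>C k\<^esub> curry_at k g b"
proof -
  interpret N: module R "C k" by (rule module_C)
  interpret N': module R "C (Suc k)" by (rule module_C)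
  have "curry_at k ((f \<ominus>\<^bsub>C (Suc k)\<^esub> g) \<oplus>\<^bsub>C (Suc k)\<^esub> g) b = curry_at k f b"
    using assms by (simp add: N'.M.minus_add_cancel)
  then have "curry_at k (f \<ominus>\<^bsub>C (Suc k)\<^esub> g) b \<oplus>\<^bsub>C k\<^esub> curry_at k g b = curry_at k f b"
    using assms by (simp add: curry_simps)
  then show ?thesis using assms by (intro N.M.add_eq_imp_eq_minus curry_closed N'.M.minus_closed)
qed

lemma cochain_curry_eqI:
  assumes "f \<in> carrier (C (Suc k))" "g \<in> carrier (C (Suc k))" "\<And>a. a \<in> carrier A \<Longrightarrow> curry_at k f a = curry_at k g a"
  shows "f = g"
  by (rule curry_eqI[of _ k]) (simp_all add: assms cochain_extensional)

lemma cocycle_iff: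
  "f \<in> hochschild_cocycles R A M k \<longleftrightarrow>
    f \<in> carrier (C k) \<and> (\<forall>a\<in>carrier A. lact (C k) a f = ract (C k) f a)"
proof (cases "f \<in> carrier (C k)")
  case True
  interpret N: weak_bimodule R A "C k" by (rule weak_bimodule_C)
  have "hochschild_diff A M k f = \<zero>\<^bsub>C (Suc k)\<^esub> \<longleftrightarrow>
      (\<forall>a\<in>carrier A. curry_at k (hochschild_diff A M k f) a = curry_at k \<zero>\<^bsub>C (Suc k)\<^esub> a)"
    using cochain_curry_eqI[OF diff_closed[OF True] C_zero_closed] by metis
  also have "\<dots> \<longleftrightarrow> (\<forall>a\<in>carrier A. lact (C k) a f = ract (C k) f a)"
    using True by (simp add: curry_zero curry_diff N.N.M.minus_eq_zero_iff)
  finally show ?thesis using True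
    by (simp add: hochschild_cocycles_def hochschild_cochain_group_def C_simps(1,2))
qed (simp add: hochschild_cocycles_def C_simps(1))

text \<open>A cochain of degree \<open>k + 2\<close> as a bilinear map with values in \<open>C\<^sup>k\<close>.\<close>

definition slice2 :: "nat \<Rightarrow> ('a list \<Rightarrow> 'm) \<Rightarrow> 'a \<Rightarrow> 'a \<Rightarrow> 'a list \<Rightarrow> 'm" where
  "slice2 k f b c = curry_at k (curry_at (Suc k) f b) c"

lemma slice2_linear_right: "f \<in> carrier (C (Suc (Suc k))) \<Longrightarrow> b \<in> carrier A \<Longrightarrow> slice2 k f b \<in> linear_maps R A (C k)"
  unfolding slice2_def by (intro curry_linear curry_closed)

lemma slice2_linear_left:
  assumes "f \<in> carrier (C (Suc (Suc k)))" "c \<in> carrier A"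
  shows "(\<lambda>b. slice2 k f b c) \<in> linear_maps R A (C k)"
  by (rule linear_mapsI) (use assms in \<open>simp_all add: slice2_def curry_closed curry_simps
      linear_maps_add[OF curry_linear] linear_maps_smult[OF curry_linear]\<close>)

text \<open>The equation \<open>a f = f \<cdot> a\<close> for a cocycle, with its first two remaining arguments made explicit.\<close>

lemma slice2_cocycle:
  assumes f: "f \<in> hochschild_cocycles R A M (Suc (Suc k))"
    and b: "b \<in> carrier A" and c: "c \<in> carrier A" and d: "d \<in> carrier A"
  shows "lact (C k) b (slice2 k f c d) \<oplus>\<^bsub>C k\<^esub> slice2 k f b (c \<otimes>\<^bsub>A\<^esub> d)
    = slice2 k f (b \<otimes>\<^bsub>A\<^esub> c) d \<oplus>\<^bsub>C k\<^esub> ract (C k) (slice2 k f b c) d"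
proof -
  interpret N: weak_bimodule R A "C k" by (rule weak_bimodule_C)
  interpret N': weak_bimodule R A "C (Suc k)" by (rule weak_bimodule_C)
  interpret N'': weak_bimodule R A "C (Suc (Suc k))" by (rule weak_bimodule_C)
  have fC: "f \<in> carrier (C (Suc (Suc k)))" and eq: "lact (C (Suc (Suc k))) b f = ract (C (Suc (Suc k))) f b"
    using f b by (auto simp: cocycle_iff)
  have closed [simp]: "slice2 k f v w \<in> carrier (C k)" if "v \<in> carrier A" "w \<in> carrier A" for v w
    using that fC by (simp add: slice2_def curry_closed)
  have "curry_at k (curry_at (Suc k) (lact (C (Suc (Suc k))) b f) c) d
      = curry_at k (curry_at (Suc k) (ract (C (Suc (Suc k))) f b) c) d"
    by (simp add: eq)
  then have "lact (C k) b (slice2 k f c d)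
      = slice2 k f (b \<otimes>\<^bsub>A\<^esub> c) d \<ominus>\<^bsub>C k\<^esub> (slice2 k f b (c \<otimes>\<^bsub>A\<^esub> d) \<ominus>\<^bsub>C k\<^esub> ract (C k) (slice2 k f b c) d)"
    using fC b c d by (simp add: curry_simps curry_ract curry_minus curry_closed slice2_def)
  then have "lact (C k) b (slice2 k f c d) \<oplus>\<^bsub>C k\<^esub> slice2 k f b (c \<otimes>\<^bsub>A\<^esub> d)
      = (slice2 k f (b \<otimes>\<^bsub>A\<^esub> c) d \<oplus>\<^bsub>C k\<^esub> ract (C k) (slice2 k f b c) d)
        \<oplus>\<^bsub>C k\<^esub> (\<ominus>\<^bsub>C k\<^esub> slice2 k f b (c \<otimes>\<^bsub>A\<^esub> d) \<oplus>\<^bsub>C k\<^esub> slice2 k f b (c \<otimes>\<^bsub>A\<^esub> d))"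
    using b c d by (simp add: a_minus_def N.N.M.minus_add N.N.M.a_ac)
  then show ?thesis using b c d by (simp add: N.N.M.l_neg)
qed

text \<open>The sign of \<open>g\<close> follows \<open>two_cocycle_splits\<close>: the cochain with coboundary \<open>f\<close> is \<open>- g\<close>, uncurried.\<close>

lemma coboundaryI:
  assumes f: "f \<in> carrier (C (Suc (Suc k)))" and g: "g \<in> linear_maps R A (C k)"
    and eq: "\<And>b c. b \<in> carrier A \<Longrightarrow> c \<in> carrier A \<Longrightarrow>
      g (b \<otimes>\<^bsub>A\<^esub> c) = lact (C k) b (g c) \<oplus>\<^bsub>C k\<^esub> ract (C k) (g b) c \<oplus>\<^bsub>C k\<^esub> slice2 k f b c"
  shows "f \<in> hochschild_coboundaries R A M (Suc (Suc k))"
proof -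
  interpret N: weak_bimodule R A "C k" by (rule weak_bimodule_C)
  interpret N': weak_bimodule R A "C (Suc k)" by (rule weak_bimodule_C)
  have closed [simp]: "slice2 k f v w \<in> carrier (C k)" if "v \<in> carrier A" "w \<in> carrier A" for v w
    using that f by (simp add: slice2_def curry_closed)
  note g_closed [simp] = linear_maps_closed[OF g]
  have neg: "(\<lambda>b. \<zero>\<^bsub>C k\<^esub> \<ominus>\<^bsub>C k\<^esub> g b) \<in> linear_maps R A (C k)"
    by (rule linear_mapsI) (simp_all add: a_minus_def linear_maps_add[OF g] linear_maps_smult[OF g]
        N.N.M.minus_add N.N.smult_r_minus)
  obtain G where G: "G \<in> carrier (C (Suc k))" and G_eq: "\<And>b. b \<in> carrier A \<Longrightarrow> curry_at k G b = \<zero>\<^bsub>C k\<^esub> \<ominus>\<^bsub>C k\<^esub> g b"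
    by (rule uncurry[OF neg]) (rule that; assumption)
  have "hochschild_diff A M (Suc k) G = f"
  proof (rule cochain_curry_eqI[OF diff_closed[OF G] f], rule cochain_curry_eqI)
    fix b c assume b: "b \<in> carrier A" and c: "c \<in> carrier A"
    have "curry_at k (curry_at (Suc k) (hochschild_diff A M (Suc k) G) b) c
        = lact (C k) b (\<zero>\<^bsub>C k\<^esub> \<ominus>\<^bsub>C k\<^esub> g c) \<ominus>\<^bsub>C k\<^esub> ((\<zero>\<^bsub>C k\<^esub> \<ominus>\<^bsub>C k\<^esub> g (b \<otimes>\<^bsub>A\<^esub> c)) \<ominus>\<^bsub>C k\<^esub> ract (C k) (\<zero>\<^bsub>C k\<^esub> \<ominus>\<^bsub>C k\<^esub> g b) c)"
      using b c G by (simp add: curry_diff curry_minus curry_simps curry_ract G_eq)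
    also have "\<dots> = g (b \<otimes>\<^bsub>A\<^esub> c) \<ominus>\<^bsub>C k\<^esub> (lact (C k) b (g c) \<oplus>\<^bsub>C k\<^esub> ract (C k) (g b) c)"
      using b c by (simp add: N.lact_minus N.ract_minus) (simp add: a_minus_def N.N.M.minus_add N.N.M.a_ac)
    also have "\<dots> = slice2 k f b c"
      using b c by (intro N.N.M.add_eq_imp_eq_minus[symmetric]) (simp_all add: eq N.N.M.a_ac)
    finally show "curry_at k (curry_at (Suc k) (hochschild_diff A M (Suc k) G) b) c = curry_at k (curry_at (Suc k) f b) c"
      by (simp add: slice2_def)
  qed (use f in \<open>simp_all add: curry_closed diff_closed G\<close>)
  then show ?thesis using G by (auto simp: C_simps(1))
qed

text \<open>This is \<open>d\<^sup>2 = 0\<close>. After currying twice it amounts to the two actions commuting and to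
  associativity of the right action.\<close>

lemma coboundaries_subset: "hochschild_coboundaries R A M (Suc k) \<subseteq> hochschild_cocycles R A M (Suc k)"
proof
  fix f assume "f \<in> hochschild_coboundaries R A M (Suc k)"
  then obtain g where g: "g \<in> carrier (C k)" and f: "f = hochschild_diff A M k g" by (auto simp: C_simps(1))
  interpret N: weak_bimodule R A "C k" by (rule weak_bimodule_C)
  interpret N': weak_bimodule R A "C (Suc k)" by (rule weak_bimodule_C)
  have fC: "f \<in> carrier (C (Suc k))" using g f diff_closed by simp
  have "lact (C (Suc k)) a f = ract (C (Suc k)) f a" if a: "a \<in> carrier A" for a
  proof (rule cochain_curry_eqI)
    fix b assume b: "b \<in> carrier A"
    have "curry_at k (lact (C (Suc k)) a f) b = lact (C k) a (lact (C k) b g) \<ominus>\<^bsub>C k\<^esub> lact (C k) a (ract (C k) g b)"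
      using a b g fC by (simp add: curry_simps f curry_diff N.lact_minus)
    moreover have "curry_at k (ract (C (Suc k)) f a) b = (lact (C k) a (lact (C k) b g) \<ominus>\<^bsub>C k\<^esub> ract (C k) (ract (C k) g a) b)
        \<ominus>\<^bsub>C k\<^esub> (lact (C k) a (ract (C k) g b) \<ominus>\<^bsub>C k\<^esub> ract (C k) (ract (C k) g a) b)"
      using a b g fC by (simp add: curry_ract) (simp add: f curry_diff N.lact_mult N.ract_mult N.ract_minus N.lact_ract)
    ultimately show "curry_at k (lact (C (Suc k)) a f) b = curry_at k (ract (C (Suc k)) f a) b"
      using a b g by (simp add: N.N.M.minus_minus_cancel)
  qed (use fC a in simp_all)
  then show "f \<in> hochschild_cocycles R A M (Suc k)" using fC by (simp add: cocycle_iff)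
qed

lemma cocycle_group: "group ((hochschild_cochain_group R A M k)\<lparr>carrier := hochschild_cocycles R A M k\<rparr>)"
proof -
  interpret N: weak_bimodule R A "C k" by (rule weak_bimodule_C)
  have simps: "one (hochschild_cochain_group R A M k) = \<zero>\<^bsub>C k\<^esub>"
    "monoid.mult (hochschild_cochain_group R A M k) f g = f \<oplus>\<^bsub>C k\<^esub> g" for f g
    by (simp_all add: hochschild_cochain_group_def C_simps)
  show ?thesis
  proof (rule groupI)
    fix f assume "f \<in> carrier ((hochschild_cochain_group R A M k)\<lparr>carrier := hochschild_cocycles R A M k\<rparr>)"
    then have f: "f \<in> carrier (C k)" "\<And>a. a \<in> carrier A \<Longrightarrow> lact (C k) a f = ract (C k) f a"
      by (auto simp: cocycle_iff)
    then have "\<zero>\<^bsub>C k\<^esub> \<ominus>\<^bsub>C k\<^esub> f \<in> hochschild_cocycles R A M k"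
      by (simp add: cocycle_iff N.lact_minus N.ract_minus)
    with f(1) show "\<exists>g\<in>carrier ((hochschild_cochain_group R A M k)\<lparr>carrier := hochschild_cocycles R A M k\<rparr>).
        g \<otimes>\<^bsub>(hochschild_cochain_group R A M k)\<lparr>carrier := hochschild_cocycles R A M k\<rparr>\<^esub> f
          = \<one>\<^bsub>(hochschild_cochain_group R A M k)\<lparr>carrier := hochschild_cocycles R A M k\<rparr>\<^esub>"
      by (auto simp: simps N.N.M.minus_add_cancel intro!: bexI[of _ "\<zero>\<^bsub>C k\<^esub> \<ominus>\<^bsub>C k\<^esub> f"])
  qed (auto simp: simps cocycle_iff N.lact_add_right N.ract_add_left N.N.M.a_assoc)
qed

lemma HH_trivial_if:
  assumes "hochschild_cocycles R A M (Suc k) \<subseteq> hochschild_coboundaries R A M (Suc k)"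
  shows "trivial_group (HH R A M (Suc k))"
proof -
  let ?G = "(hochschild_cochain_group R A M (Suc k))\<lparr>carrier := hochschild_cocycles R A M (Suc k)\<rparr>"
  interpret G: group ?G by (rule cocycle_group)
  have eq: "hochschild_coboundaries R A M (Suc k) = carrier ?G" using assms coboundaries_subset by auto
  have sub: "subgroup (carrier ?G) ?G" by (rule G.subgroup_self)
  have "\<forall>f\<in>carrier ?G. \<forall>g\<in>carrier ?G. f \<otimes>\<^bsub>?G\<^esub> g \<otimes>\<^bsub>?G\<^esub> inv\<^bsub>?G\<^esub> f \<in> carrier ?G"
    by (blast intro: G.m_closed G.inv_closed)
  with sub have "carrier ?G \<lhd> ?G" unfolding G.normal_inv_iff by blast
  then interpret N: normal "carrier ?G" ?G .
  show ?thesis unfolding HH_def eq trivial_group_def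
    using N.factorgroup_is_group G.coset_join2[OF _ sub] G.one_closed
    by (auto simp only: carrier_FactGroup one_FactGroup image_iff)
qed

lemma HH_nontrivial_if:
  assumes f: "f \<in> hochschild_cocycles R A M (Suc k)" "f \<notin> hochschild_coboundaries R A M (Suc k)"
  shows "\<not> trivial_group (HH R A M (Suc k))"
proof
  interpret N: weak_bimodule R A "C k" by (rule weak_bimodule_C)
  interpret N': weak_bimodule R A "C (Suc k)" by (rule weak_bimodule_C)
  let ?G = "(hochschild_cochain_group R A M (Suc k))\<lparr>carrier := hochschild_cocycles R A M (Suc k)\<rparr>"
  let ?B = "hochschild_coboundaries R A M (Suc k)"
  assume "trivial_group (HH R A M (Suc k))"
  then have "carrier (?G Mod ?B) = {?B}" by (simp add: trivial_group_def HH_def)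
  moreover have "?B #>\<^bsub>?G\<^esub> f \<in> carrier (?G Mod ?B)" using f(1) by (simp add: carrier_FactGroup)
  ultimately have coset: "?B #>\<^bsub>?G\<^esub> f = ?B" by simp
  have "hochschild_diff A M k \<zero>\<^bsub>C k\<^esub> = \<zero>\<^bsub>C (Suc k)\<^esub>"
    by (rule cochain_curry_eqI[of _ k]) (simp_all add: diff_closed C_zero_closed curry_diff curry_zero N.N.M.minus_eq_zero_iff)
  then have "\<zero>\<^bsub>C (Suc k)\<^esub> \<in> ?B" using C_zero_closed[of k]
    by (auto simp: C_simps(1) intro!: image_eqI[of _ _ "\<zero>\<^bsub>C k\<^esub>"])
  moreover have "monoid.mult ?G \<zero>\<^bsub>C (Suc k)\<^esub> f = f"
    using f(1) N'.N.M.l_zero[of f] by (simp add: hochschild_cochain_group_def cocycle_iff C_simps(3))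
  ultimately have "f \<in> ?B #>\<^bsub>?G\<^esub> f" unfolding r_coset_def by force
  with coset f(2) show False by simp
qed

end

section \<open>Vanishing in high degrees\<close>

context family
begin

text \<open>For \<open>a = 0\<close> the zero lifts satisfy the relation \<open>x = 0\<close>.\<close>

lemma HH_vanishes_for_zero:
  assumes B: "bimodule complex_ring A M" and a: "a = 0"
  shows "trivial_group (HH complex_ring A M (Suc (Suc k)))"
proof -
  interpret B: bimodule complex_ring A M by (rule B)
  interpret N: weak_bimodule complex_ring A "B.C k" by (rule B.weak_bimodule_C)
  have "f \<in> hochschild_coboundaries complex_ring A M (Suc (Suc k))"
    if f: "f \<in> hochschild_cocycles complex_ring A M (Suc (Suc k))" for f
  proof -
    have fC: "f \<in> carrier (B.C (Suc (Suc k)))" using f by (simp add: B.cocycle_iff)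
    have closed: "B.slice2 k f b c \<in> carrier (B.C k)" if "b \<in> carrier A" "c \<in> carrier A" for b c
      using linear_maps_closed[OF B.slice2_linear_right[OF fC that(1)] that(2)] .
    have null: "a \<odot>\<^bsub>B.C k\<^esub> m = \<zero>\<^bsub>B.C k\<^esub>" if "m \<in> carrier (B.C k)" for m
      using N.N.smult_l_null[OF that] a by simp
    have "a \<odot>\<^bsub>B.C k\<^esub> (lact (B.C k) x \<zero>\<^bsub>B.C k\<^esub> \<oplus>\<^bsub>B.C k\<^esub> ract (B.C k) \<zero>\<^bsub>B.C k\<^esub> y \<oplus>\<^bsub>B.C k\<^esub> B.slice2 k f x y)
      = a \<odot>\<^bsub>B.C k\<^esub> (lact (B.C k) y \<zero>\<^bsub>B.C k\<^esub> \<oplus>\<^bsub>B.C k\<^esub> ract (B.C k) \<zero>\<^bsub>B.C k\<^esub> x \<oplus>\<^bsub>B.C k\<^esub> B.slice2 k f y x)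
        \<oplus>\<^bsub>B.C k\<^esub> \<zero>\<^bsub>B.C k\<^esub>"
      by (simp add: closed null)
    then obtain g where "g \<in> linear_maps complex_ring A (B.C k)"
      "\<And>b c. b \<in> carrier A \<Longrightarrow> c \<in> carrier A \<Longrightarrow>
        g (b \<otimes>\<^bsub>A\<^esub> c) = lact (B.C k) b (g c) \<oplus>\<^bsub>B.C k\<^esub> ract (B.C k) (g b) c \<oplus>\<^bsub>B.C k\<^esub> B.slice2 k f b c"
      using two_cocycle_splits[OF B.weak_bimodule_C, of "B.slice2 k f" k, OF B.slice2_linear_left[OF fC] B.slice2_linear_right[OF fC]
        B.slice2_cocycle[OF f] N.N.zero_closed N.N.zero_closed] by blast
    with fC show ?thesis by (intro B.coboundaryI)
  qed
  then show ?thesis by (intro B.HH_trivial_if) blast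
qed

text \<open>A cocycle of degree \<open>k + 3\<close> is a 2-cocycle \<open>F\<close> with values in \<open>C\<^sup>k\<^sup>+\<^sup>1\<close>, and the lifts of \<open>x\<close> and \<open>y\<close> are
  sought as functions of one more argument \<open>c\<close>. At \<open>c = 1\<close> there is an obstruction, since the right
  unit law is missing. It is removed by the lifts \<open>n v = (c \<mapsto> p(v) \<cdot> c)\<close> with \<open>p(v) = F(v, 1)(1)\<close>, which
  the right action annihilates. What remains is an equation \<open>x m + K = m \<cdot> x\<close> with \<open>K(1) \<cdot> 1 = 0\<close>, solved
  by the recursion along left multiplication by \<open>x\<close>; the solution corrects the lift of \<open>y\<close>.\<close>

lemma HH_vanishes_for_nonzero:
  assumes B: "bimodule complex_ring A M" and a: "a \<noteq> 0"
  shows "trivial_group (HH complex_ring A M (Suc (Suc (Suc k))))"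
proof -
  interpret B: bimodule complex_ring A M by (rule B)
  interpret N: weak_bimodule complex_ring A "B.C k" by (rule B.weak_bimodule_C)
  interpret N': weak_bimodule complex_ring A "B.C (Suc k)" by (rule B.weak_bimodule_C)
  note N_simps = N.lact_one N.lact_mult N.lact_add_left N.lact_add_right
    N.lact_smult_left N.lact_smult_right N.ract_mult N.ract_add_left N.ract_add_right
    N.ract_smult_left N.ract_smult_right N.lact_ract N.lact_minus N.ract_minus
  have "f \<in> hochschild_coboundaries complex_ring A M (Suc (Suc (Suc k)))"
    if f: "f \<in> hochschild_cocycles complex_ring A M (Suc (Suc (Suc k)))" for f
  proof -
    have fC: "f \<in> carrier (B.C (Suc (Suc (Suc k))))" using f by (simp add: B.cocycle_iff)
    define F where "F = B.slice2 (Suc k) f"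
    note F_left = B.slice2_linear_left[OF fC, folded F_def]
    note F_right = B.slice2_linear_right[OF fC, folded F_def]
    note F_cocycle = B.slice2_cocycle[OF f, folded F_def]
    have F_closed [simp]: "F b c \<in> carrier (B.C (Suc k))" if "b \<in> carrier A" "c \<in> carrier A" for b c
      using linear_maps_closed[OF F_right[OF that(1)] that(2)] .
    note cur_closed [simp] = B.curry_closed[of _ k]
    define p where "p v = B.curry_at k (F v \<one>\<^bsub>A\<^esub>) \<one>\<^bsub>A\<^esub>" for v
    have p: "p \<in> linear_maps complex_ring A (B.C k)"
      by (rule linear_mapsI) (simp_all add: p_def linear_maps_add[OF F_left] linear_maps_smult[OF F_left] B.curry_simps)
    note p_closed [simp] = linear_maps_closed[OF p]
    have p_relation: "p (v \<otimes>\<^bsub>A\<^esub> w) = lact (B.C k) v (p w) \<oplus>\<^bsub>B.C k\<^esub> ract (B.C k) (B.curry_at k (F v w) \<one>\<^bsub>A\<^esub>) \<one>\<^bsub>A\<^esub>"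
      if vw: "v \<in> carrier A" "w \<in> carrier A" for v w
    proof -
      let ?e = "B.curry_at k (F v w) \<one>\<^bsub>A\<^esub>"
      have e: "?e \<in> carrier (B.C k)" using vw by simp
      have "lact (B.C k) v (p w) \<oplus>\<^bsub>B.C k\<^esub> ?e = p (v \<otimes>\<^bsub>A\<^esub> w) \<oplus>\<^bsub>B.C k\<^esub> (?e \<ominus>\<^bsub>B.C k\<^esub> ract (B.C k) ?e \<one>\<^bsub>A\<^esub>)"
        using arg_cong[OF F_cocycle[OF vw one_closed], of "\<lambda>g. B.curry_at k g \<one>\<^bsub>A\<^esub>"] vw
        by (simp add: B.curry_simps B.curry_ract p_def)
      then have "?e \<oplus>\<^bsub>B.C k\<^esub> lact (B.C k) v (p w) = ?e \<oplus>\<^bsub>B.C k\<^esub> (p (v \<otimes>\<^bsub>A\<^esub> w) \<ominus>\<^bsub>B.C k\<^esub> ract (B.C k) ?e \<one>\<^bsub>A\<^esub>)"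
        using vw e by (simp add: a_minus_def N.N.M.a_ac)
      then have "lact (B.C k) v (p w) = p (v \<otimes>\<^bsub>A\<^esub> w) \<ominus>\<^bsub>B.C k\<^esub> ract (B.C k) ?e \<one>\<^bsub>A\<^esub>"
        using vw e by simp
      then show ?thesis using vw e by (simp add: N.N.M.minus_add_cancel)
    qed
    have "(\<lambda>c. ract (B.C k) (p v) c) \<in> linear_maps complex_ring A (B.C k)" if "v \<in> carrier A" for v
      by (rule linear_mapsI) (use that in \<open>simp_all add: N_simps\<close>)
    from B.uncurry[OF this]
    have "\<exists>n. n \<in> carrier (B.C (Suc k)) \<and> (\<forall>c\<in>carrier A. B.curry_at k n c = ract (B.C k) (p v) c)"
      if "v \<in> carrier A" for v using that by metis
    then obtain n where n_closed [simp]: "\<And>v. v \<in> carrier A \<Longrightarrow> n v \<in> carrier (B.C (Suc k))"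
      and n: "\<And>v c. v \<in> carrier A \<Longrightarrow> c \<in> carrier A \<Longrightarrow> B.curry_at k (n v) c = ract (B.C k) (p v) c"
      by metis
    have n_ract: "ract (B.C (Suc k)) (n v) w = \<zero>\<^bsub>B.C (Suc k)\<^esub>" if "v \<in> carrier A" "w \<in> carrier A" for v w
      by (rule B.cochain_curry_eqI[of _ k]) (use that in \<open>simp_all add: B.curry_ract B.curry_zero n N.ract_mult N.N.M.minus_eq_zero_iff\<close>)
    define L where "L v w = lact (B.C (Suc k)) v (n w) \<oplus>\<^bsub>B.C (Suc k)\<^esub> F v w" for v w
    have L_closed [simp]: "L v w \<in> carrier (B.C (Suc k))" if "v \<in> carrier A" "w \<in> carrier A" for v w
      using that by (simp add: L_def)
    have idem: "ract (B.C k) (ract (B.C k) m \<one>\<^bsub>A\<^esub>) \<one>\<^bsub>A\<^esub> = ract (B.C k) m \<one>\<^bsub>A\<^esub>" if "m \<in> carrier (B.C k)" for m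
      using N.ract_mult[of "\<one>\<^bsub>A\<^esub>" "\<one>\<^bsub>A\<^esub>" m] that by simp
    \<comment> \<open>The contribution of \<open>F\<close> at \<open>1\<close> and that of the lifts combine to a quantity that depends on the
      product \<open>v w\<close> only, so the relation of \<open>A\<close> applies to it.\<close>
    have L_at_one: "ract (B.C k) (B.curry_at k (L v w) \<one>\<^bsub>A\<^esub>) \<one>\<^bsub>A\<^esub> = ract (B.C k) (p (v \<otimes>\<^bsub>A\<^esub> w)) \<one>\<^bsub>A\<^esub>"
      if "v \<in> carrier A" "w \<in> carrier A" for v w
      using that by (simp add: L_def B.curry_simps n p_relation N.lact_ract[symmetric] N.ract_add_left idem)
    define K where "K = L x y \<ominus>\<^bsub>B.C (Suc k)\<^esub> (L y x \<oplus>\<^bsub>B.C (Suc k)\<^esub> (1 / a) \<odot>\<^bsub>B.C (Suc k)\<^esub> n x)"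
    have K_closed [simp]: "K \<in> carrier (B.C (Suc k))" by (simp add: K_def)
    have scale: "a \<odot>\<^bsub>B.C j\<^esub> ((1 / a) \<odot>\<^bsub>B.C j\<^esub> m) = m" "(1 / a) \<odot>\<^bsub>B.C j\<^esub> (a \<odot>\<^bsub>B.C j\<^esub> m) = m" if "m \<in> carrier (B.C j)" for j m
    proof -
      interpret Cj: module complex_ring "B.C j" by (rule B.module_C)
      show "a \<odot>\<^bsub>B.C j\<^esub> ((1 / a) \<odot>\<^bsub>B.C j\<^esub> m) = m" "(1 / a) \<odot>\<^bsub>B.C j\<^esub> (a \<odot>\<^bsub>B.C j\<^esub> m) = m"
        using Cj.smult_assoc1[of a "1 / a" m] Cj.smult_assoc1[of "1 / a" a m] Cj.smult_one[OF that] that a by simp_all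
    qed
    have p_xy: "p (x \<otimes>\<^bsub>A\<^esub> y) = p (y \<otimes>\<^bsub>A\<^esub> x) \<oplus>\<^bsub>B.C k\<^esub> (1 / a) \<odot>\<^bsub>B.C k\<^esub> p x"
    proof -
      have "a \<odot>\<^bsub>B.C k\<^esub> p (x \<otimes>\<^bsub>A\<^esub> y) = a \<odot>\<^bsub>B.C k\<^esub> p (y \<otimes>\<^bsub>A\<^esub> x) \<oplus>\<^bsub>B.C k\<^esub> p x"
        using arg_cong[OF relation, of p] by (simp add: linear_maps_add[OF p] linear_maps_smult[OF p])
      from arg_cong[OF this, of "\<lambda>m. (1 / a) \<odot>\<^bsub>B.C k\<^esub> m"] show ?thesis
        by (simp add: N.N.smult_r_distr scale)
    qed
    have K_at_one: "ract (B.C k) (B.curry_at k K \<one>\<^bsub>A\<^esub>) \<one>\<^bsub>A\<^esub> = \<zero>\<^bsub>B.C k\<^esub>"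
      by (simp add: K_def B.curry_minus B.curry_simps n N.ract_minus N.ract_add_left N.ract_smult_left
          L_at_one idem p_xy N.N.M.minus_eq_zero_iff)
    obtain q where q: "q \<in> linear_maps complex_ring A (B.C k)" "q \<one>\<^bsub>A\<^esub> = \<zero>\<^bsub>B.C k\<^esub>"
      "\<And>c. c \<in> carrier A \<Longrightarrow> q (x \<otimes>\<^bsub>A\<^esub> c) = lact (B.C k) x (q c) \<oplus>\<^bsub>B.C k\<^esub> B.curry_at k K c"
      by (rule left_x_recursion[OF a B.weak_bimodule_C B.curry_linear[OF K_closed]]) (rule that; assumption)
    obtain m where m [simp]: "m \<in> carrier (B.C (Suc k))" and m_eq: "\<And>c. c \<in> carrier A \<Longrightarrow> B.curry_at k m c = q c"
      by (rule B.uncurry[OF q(1)]) (rule that; assumption)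
    \<comment> \<open>The recursion at \<open>c = 1\<close> gives \<open>q x = K(1)\<close>, so this is the place where the obstruction must vanish.\<close>
    have q_x: "ract (B.C k) (q x) c = \<zero>\<^bsub>B.C k\<^esub>" if "c \<in> carrier A" for c
    proof -
      have "q x = B.curry_at k K \<one>\<^bsub>A\<^esub>" using q(3)[of "\<one>\<^bsub>A\<^esub>"] by (simp add: q(2))
      then have "ract (B.C k) (q x) c = ract (B.C k) (ract (B.C k) (B.curry_at k K \<one>\<^bsub>A\<^esub>) \<one>\<^bsub>A\<^esub>) c"
        using N.ract_mult[of "\<one>\<^bsub>A\<^esub>" c "B.curry_at k K \<one>\<^bsub>A\<^esub>"] that by simp
      then show ?thesis using that by (simp add: K_at_one)
    qed
    have m_K: "lact (B.C (Suc k)) x m \<oplus>\<^bsub>B.C (Suc k)\<^esub> K = ract (B.C (Suc k)) m x"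
      by (rule B.cochain_curry_eqI[of _ k])
        (simp_all add: B.curry_simps B.curry_ract m_eq q q_x linear_maps_closed[OF q(1)] a_minus_def N.N.M.minus_equality)
    have L_K: "L x y = K \<oplus>\<^bsub>B.C (Suc k)\<^esub> (L y x \<oplus>\<^bsub>B.C (Suc k)\<^esub> (1 / a) \<odot>\<^bsub>B.C (Suc k)\<^esub> n x)"
      unfolding K_def by (rule N'.N.M.minus_add_cancel[symmetric]) simp_all
    have "a \<odot>\<^bsub>B.C (Suc k)\<^esub> (lact (B.C (Suc k)) x (n y \<oplus>\<^bsub>B.C (Suc k)\<^esub> m) \<oplus>\<^bsub>B.C (Suc k)\<^esub> ract (B.C (Suc k)) (n x) y \<oplus>\<^bsub>B.C (Suc k)\<^esub> F x y)
      = a \<odot>\<^bsub>B.C (Suc k)\<^esub> (lact (B.C (Suc k)) x m \<oplus>\<^bsub>B.C (Suc k)\<^esub> L x y)"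
      by (simp add: n_ract N'.lact_add_right L_def N'.N.M.a_ac)
    also have "lact (B.C (Suc k)) x m \<oplus>\<^bsub>B.C (Suc k)\<^esub> L x y
        = ract (B.C (Suc k)) m x \<oplus>\<^bsub>B.C (Suc k)\<^esub> (L y x \<oplus>\<^bsub>B.C (Suc k)\<^esub> (1 / a) \<odot>\<^bsub>B.C (Suc k)\<^esub> n x)"
      unfolding L_K m_K[symmetric] by (simp add: N'.N.M.a_assoc)
    also have "a \<odot>\<^bsub>B.C (Suc k)\<^esub> \<dots> = a \<odot>\<^bsub>B.C (Suc k)\<^esub> (ract (B.C (Suc k)) m x \<oplus>\<^bsub>B.C (Suc k)\<^esub> L y x) \<oplus>\<^bsub>B.C (Suc k)\<^esub> n x"
      by (simp add: N'.N.smult_r_distr scale N'.N.M.a_assoc)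
    also have "ract (B.C (Suc k)) m x \<oplus>\<^bsub>B.C (Suc k)\<^esub> L y x = lact (B.C (Suc k)) y (n x)
        \<oplus>\<^bsub>B.C (Suc k)\<^esub> ract (B.C (Suc k)) (n y \<oplus>\<^bsub>B.C (Suc k)\<^esub> m) x \<oplus>\<^bsub>B.C (Suc k)\<^esub> F y x"
      by (simp add: n_ract N'.ract_add_left L_def N'.N.M.a_ac)
    finally obtain g where "g \<in> linear_maps complex_ring A (B.C (Suc k))"
      "\<And>b c. b \<in> carrier A \<Longrightarrow> c \<in> carrier A \<Longrightarrow>
        g (b \<otimes>\<^bsub>A\<^esub> c) = lact (B.C (Suc k)) b (g c) \<oplus>\<^bsub>B.C (Suc k)\<^esub> ract (B.C (Suc k)) (g b) c \<oplus>\<^bsub>B.C (Suc k)\<^esub> F b c"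
      using two_cocycle_splits[OF B.weak_bimodule_C F_left F_right F_cocycle, of "n x" "n y \<oplus>\<^bsub>B.C (Suc k)\<^esub> m"]
        n_closed[OF gens_closed(1)] N'.N.M.a_closed[OF n_closed[OF gens_closed(2)] m] by blast
    with fC show ?thesis unfolding F_def by (intro B.coboundaryI)
  qed
  then show ?thesis by (intro B.HH_trivial_if) blast
qed

end

section \<open>Non-trivial classes in one-dimensional bimodules\<close>

definition scalar_module :: "(complex, complex) module" where
  "scalar_module = \<lparr>carrier = UNIV, monoid.mult = (*), one = 1, ring.zero = 0, add = (+), module.smult = (*)\<rparr>"

lemma scalar_module_simps [simp]:
  "carrier scalar_module = UNIV" "\<zero>\<^bsub>scalar_module\<^esub> = 0"
  "c \<oplus>\<^bsub>scalar_module\<^esub> d = c + d" "c \<odot>\<^bsub>scalar_module\<^esub> d = c * d"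
  by (simp_all add: scalar_module_def)

lemma module_scalar_module: "module complex_ring scalar_module"
proof (rule moduleI[OF cring_from_type_algebra])
  show "abelian_group scalar_module"
    by (rule abelian_groupI) (auto simp: add_ac intro: exI[of _ "- _"] add.left_inverse)
qed (simp_all add: algebra_simps)

text \<open>The complex numbers with left and right action through the characters \<open>\<chi>\<close> and \<open>\<psi>\<close>, transported along
  an injection into the given universe of carriers.\<close>

definition character_bimodule :: "(complex \<Rightarrow> 'm) \<Rightarrow> ('a \<Rightarrow> complex) \<Rightarrow> ('a \<Rightarrow> complex) \<Rightarrow> (complex, 'a, 'm) bimodule" where
  "character_bimodule \<kappa> \<chi> \<psi> = \<lparr>carrier = range \<kappa>, monoid.mult = undefined, one = undefined,
     ring.zero = \<kappa> 0, add = \<lambda>m m'. \<kappa> (inv_into UNIV \<kappa> m + inv_into UNIV \<kappa> m'), module.smult = \<lambda>c m. \<kappa> (c * inv_into UNIV \<kappa> m),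
     lact = \<lambda>b m. \<kappa> (\<chi> b * inv_into UNIV \<kappa> m), ract = \<lambda>m b. \<kappa> (\<psi> b * inv_into UNIV \<kappa> m)\<rparr>"

lemma character_bimodule_simps:
  assumes "inj \<kappa>"
  shows "carrier (character_bimodule \<kappa> \<chi> \<psi>) = range \<kappa>" "\<zero>\<^bsub>character_bimodule \<kappa> \<chi> \<psi>\<^esub> = \<kappa> 0"
    "\<kappa> u \<oplus>\<^bsub>character_bimodule \<kappa> \<chi> \<psi>\<^esub> \<kappa> v = \<kappa> (u + v)" "c \<odot>\<^bsub>character_bimodule \<kappa> \<chi> \<psi>\<^esub> \<kappa> u = \<kappa> (c * u)"
    "lact (character_bimodule \<kappa> \<chi> \<psi>) b (\<kappa> u) = \<kappa> (\<chi> b * u)"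
    "ract (character_bimodule \<kappa> \<chi> \<psi>) (\<kappa> u) b = \<kappa> (\<psi> b * u)"
  using assms by (simp_all add: character_bimodule_def inv_f_f)

lemma bimodule_character_bimodule:
  assumes \<kappa>: "inj \<kappa>" and A: "assoc_algebra complex_ring A"
    and char: "\<And>\<phi>. \<phi> \<in> {\<chi>, \<psi>} \<Longrightarrow> \<phi> \<in> linear_maps complex_ring A scalar_module \<and> \<phi> \<one>\<^bsub>A\<^esub> = 1 \<and>
      (\<forall>b\<in>carrier A. \<forall>c\<in>carrier A. \<phi> (b \<otimes>\<^bsub>A\<^esub> c) = \<phi> b * \<phi> c)"
  shows "bimodule complex_ring A (character_bimodule \<kappa> \<chi> \<psi>)"
proof -
  let ?M = "character_bimodule \<kappa> \<chi> \<psi>"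
  note simps = character_bimodule_simps[OF \<kappa>, of \<chi> \<psi>]
  have inverse: "\<exists>v. \<kappa> (u + v) = \<kappa> 0" for u by (rule exI[of _ "- u"]) simp
  have "abelian_group ?M"
    by (rule abelian_groupI) (auto simp: simps add_ac inverse)
  then have "module complex_ring ?M"
    by (rule moduleI[OF cring_from_type_algebra]) (auto simp: simps algebra_simps)
  with A show ?thesis
    by (rule bimodule.intro, intro bimodule_axioms.intro)
      (use char[of \<chi>] char[of \<psi>] in \<open>auto simp: simps linear_maps_def algebra_simps\<close>)
qed

lemma character_bimodule_minus:
  assumes "inj \<kappa>" "abelian_group (character_bimodule \<kappa> \<chi> \<psi>)"
  shows "\<kappa> u \<ominus>\<^bsub>character_bimodule \<kappa> \<chi> \<psi>\<^esub> \<kappa> v = \<kappa> (u - v)"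
proof -
  interpret abelian_group "character_bimodule \<kappa> \<chi> \<psi>" by (rule assms(2))
  have "\<ominus>\<^bsub>character_bimodule \<kappa> \<chi> \<psi>\<^esub> \<kappa> v = \<kappa> (- v)"
    by (rule minus_equality) (simp_all add: character_bimodule_simps[OF assms(1)])
  then show ?thesis by (simp add: a_minus_def character_bimodule_simps[OF assms(1)])
qed

context family
begin

lemma character_exists:
  obtains \<chi> where "\<chi> \<in> linear_maps complex_ring A scalar_module" "\<chi> \<one>\<^bsub>A\<^esub> = 1"
    "\<And>b c. b \<in> carrier A \<Longrightarrow> c \<in> carrier A \<Longrightarrow> \<chi> (b \<otimes>\<^bsub>A\<^esub> c) = \<chi> b * \<chi> c" "\<chi> x = 0" "\<chi> y = l"
proof -
  obtain \<chi> where \<chi>: "\<chi> \<in> linear_maps complex_ring A scalar_module" "\<chi> \<one>\<^bsub>A\<^esub> = 1"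
    and gen: "\<And>c. c \<in> carrier A \<Longrightarrow> \<chi> (x \<otimes>\<^bsub>A\<^esub> c) = 0" "\<And>c. c \<in> carrier A \<Longrightarrow> \<chi> (y \<otimes>\<^bsub>A\<^esub> c) = l * \<chi> c"
    by (rule universal_property[OF module_scalar_module, of "\<lambda>_. 0" "\<lambda>v. l * v" 1])
      (auto simp: linear_maps_def algebra_simps)
  have vals: "\<chi> x = 0" "\<chi> y = l" using gen[of "\<one>\<^bsub>A\<^esub>"] \<chi>(2) by simp_all
  have "\<chi> (b \<otimes>\<^bsub>A\<^esub> c) = \<chi> b * \<chi> c" if "b \<in> carrier A" and c: "c \<in> carrier A" for b c
    using that(1)
    by (induction rule: generator_induct)
      (simp_all add: c \<chi>(2) l_distr smult_mult_left m_assoc gen linear_maps_add[OF \<chi>(1)] linear_maps_smult[OF \<chi>(1)] algebra_simps)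
  with \<chi> vals show ?thesis by (intro that[of \<chi>]) auto
qed

text \<open>A \<open>(\<chi>, \<epsilon>)\<close>-derivation is the upper right entry of a triangular representation of \<open>A\<close> with
  diagonal \<open>\<chi>, \<epsilon>\<close>. The matrices for \<open>x\<close> and \<open>y\<close> satisfy the relation exactly when
  \<open>s (1 + a l) = 0\<close>.\<close>

lemma skew_derivation_exists:
  assumes \<epsilon>: "\<epsilon> \<in> linear_maps complex_ring A scalar_module" "\<epsilon> \<one>\<^bsub>A\<^esub> = 1"
    "\<And>b c. b \<in> carrier A \<Longrightarrow> c \<in> carrier A \<Longrightarrow> \<epsilon> (b \<otimes>\<^bsub>A\<^esub> c) = \<epsilon> b * \<epsilon> c" "\<epsilon> x = 0" "\<epsilon> y = 0"
    and \<chi>: "\<chi> \<in> linear_maps complex_ring A scalar_module" "\<chi> \<one>\<^bsub>A\<^esub> = 1"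
    "\<And>b c. b \<in> carrier A \<Longrightarrow> c \<in> carrier A \<Longrightarrow> \<chi> (b \<otimes>\<^bsub>A\<^esub> c) = \<chi> b * \<chi> c" "\<chi> x = 0" "\<chi> y = l"
    and s: "s * (1 + a * l) = 0"
  obtains D where "D \<in> linear_maps complex_ring A scalar_module" "D x = s" "D y = t"
    "\<And>b c. b \<in> carrier A \<Longrightarrow> c \<in> carrier A \<Longrightarrow> D (b \<otimes>\<^bsub>A\<^esub> c) = \<chi> b * D c + D b * \<epsilon> c"
proof -
  let ?V = "prod_module scalar_module scalar_module"
  define \<xi> where "\<xi> u = (s * snd u, 0 :: complex)" for u :: "complex \<times> complex"
  define \<eta> where "\<eta> u = (l * fst u + t * snd u, 0 :: complex)" for u :: "complex \<times> complex"
  have V: "module complex_ring ?V" by (intro module_prod_module module_scalar_module)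
  have lin: "\<xi> \<in> linear_maps complex_ring ?V ?V" "\<eta> \<in> linear_maps complex_ring ?V ?V"
    by (auto simp: linear_maps_def \<xi>_def \<eta>_def algebra_simps)
  have rel: "a \<odot>\<^bsub>?V\<^esub> \<xi> (\<eta> u) = a \<odot>\<^bsub>?V\<^esub> \<eta> (\<xi> u) \<oplus>\<^bsub>?V\<^esub> \<xi> u" for u
  proof -
    have "s * snd u * (1 + a * l) = 0" using s by auto
    then show ?thesis by (simp add: \<xi>_def \<eta>_def algebra_simps)
  qed
  obtain T where T: "T \<in> linear_maps complex_ring A ?V" "T \<one>\<^bsub>A\<^esub> = (0, 1)"
    and gen: "\<And>c. c \<in> carrier A \<Longrightarrow> T (x \<otimes>\<^bsub>A\<^esub> c) = \<xi> (T c)" "\<And>c. c \<in> carrier A \<Longrightarrow> T (y \<otimes>\<^bsub>A\<^esub> c) = \<eta> (T c)"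
    by (rule universal_property[OF V lin rel, of "(0, 1)"]) auto
  have snd_T: "snd (T c) = \<epsilon> c" if "c \<in> carrier A" for c
    using that by (induction rule: generator_induct)
      (simp_all add: T gen \<xi>_def \<eta>_def \<epsilon> linear_maps_add[OF T(1)] linear_maps_smult[OF T(1)]
        linear_maps_add[OF \<epsilon>(1)] linear_maps_smult[OF \<epsilon>(1)])
  define D where "D c = fst (T c)" for c
  have D: "D \<in> linear_maps complex_ring A scalar_module"
    by (rule linear_mapsI) (simp_all add: D_def linear_maps_add[OF T(1)] linear_maps_smult[OF T(1)])
  have D_one: "D \<one>\<^bsub>A\<^esub> = 0" by (simp add: D_def T)
  have D_gen: "D (x \<otimes>\<^bsub>A\<^esub> c) = s * \<epsilon> c" "D (y \<otimes>\<^bsub>A\<^esub> c) = l * D c + t * \<epsilon> c" if "c \<in> carrier A" for c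
    using that by (simp_all add: D_def gen \<xi>_def \<eta>_def snd_T)
  have vals: "D x = s" "D y = t" using D_gen[of "\<one>\<^bsub>A\<^esub>"] by (simp_all add: D_one \<epsilon>)
  have "D (b \<otimes>\<^bsub>A\<^esub> c) = \<chi> b * D c + D b * \<epsilon> c" if "b \<in> carrier A" and c: "c \<in> carrier A" for b c
    using that(1)
    by (induction rule: generator_induct)
      (simp_all add: c D_one \<epsilon> \<chi> l_distr smult_mult_left m_assoc D_gen linear_maps_add[OF D] linear_maps_smult[OF D]
        linear_maps_add[OF \<chi>(1)] linear_maps_smult[OF \<chi>(1)] algebra_simps)
  with D vals show ?thesis by (intro that[of D]) auto
qed

text \<open>On the trivial bimodule \<open>b m = \<epsilon>(b) m = m b\<close>, so all 1-coboundaries vanish, but \<open>\<beta>(y) = 1\<close>.\<close>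

lemma HH_one_nontrivial:
  fixes \<kappa> :: "complex \<Rightarrow> 'm"
  assumes \<kappa>: "inj \<kappa>"
  shows "HH_nonzero_degree TYPE('m) complex_ring A 1"
proof -
  obtain \<epsilon> where \<epsilon>: "\<epsilon> \<in> linear_maps complex_ring A scalar_module" "\<epsilon> \<one>\<^bsub>A\<^esub> = 1"
    "\<And>b c. b \<in> carrier A \<Longrightarrow> c \<in> carrier A \<Longrightarrow> \<epsilon> (b \<otimes>\<^bsub>A\<^esub> c) = \<epsilon> b * \<epsilon> c" "\<epsilon> x = 0" "\<epsilon> y = 0"
    by (rule character_exists[of 0]) (rule that; assumption)
  obtain \<beta> where \<beta>: "\<beta> \<in> linear_maps complex_ring A scalar_module" "\<beta> x = 0" "\<beta> y = 1"
    "\<And>b c. b \<in> carrier A \<Longrightarrow> c \<in> carrier A \<Longrightarrow> \<beta> (b \<otimes>\<^bsub>A\<^esub> c) = \<epsilon> b * \<beta> c + \<beta> b * \<epsilon> c"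
    by (rule skew_derivation_exists[OF \<epsilon> \<epsilon>, of 0 1]; (assumption | (rule that; assumption) | simp))
  let ?M = "character_bimodule \<kappa> \<epsilon> \<epsilon>"
  have B: "bimodule complex_ring A ?M"
    by (rule bimodule_character_bimodule[OF \<kappa> assoc_algebra_axioms]) (use \<epsilon> in auto)
  interpret B: bimodule complex_ring A ?M by (rule B)
  note simps = character_bimodule_simps[OF \<kappa>, of \<epsilon> \<epsilon>] character_bimodule_minus[OF \<kappa> B.M.M.abelian_group_axioms]
  define f where "f = (\<lambda>as\<in>tuples A 1. \<kappa> (\<beta> (hd as)))"
  have tup: "bs = []" if "bs \<in> tuples A 0" for bs :: "(generator free_monoid \<Rightarrow>\<^sub>0 complex) set list"
    using that by simp
  have fC: "f \<in> carrier (B.C (Suc 0))" unfolding f_def One_nat_def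
    by (rule B.restrict_cochainI)
      (auto elim!: tuples_SucE simp: simps linear_maps_add[OF \<beta>(1)] linear_maps_smult[OF \<beta>(1)])
  have "lact (B.C (Suc 0)) b f = ract (B.C (Suc 0)) f b" if b: "b \<in> carrier A" for b
    unfolding B.C_simps cochain_ract.simps
    by (rule restrict_ext) (use b in \<open>auto elim!: tuples_SucE simp: f_def simps \<beta> algebra_simps\<close>)
  then have "f \<in> hochschild_cocycles complex_ring A ?M (Suc 0)" using fC by (simp add: B.cocycle_iff)
  moreover have "f \<notin> hochschild_coboundaries complex_ring A ?M (Suc 0)"
  proof
    assume "f \<in> hochschild_coboundaries complex_ring A ?M (Suc 0)"
    then obtain g where g: "g \<in> carrier (B.C 0)" "f = hochschild_diff A ?M 0 g" by (auto simp: B.C_simps(1))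
    interpret N: weak_bimodule complex_ring A "B.C 0" by (rule B.weak_bimodule_C)
    obtain u where u: "g [] = \<kappa> u" using B.cochain_closed[OF g(1), of "[]"] by (auto simp: simps)
    have "f [y] = B.curry_at 0 f y []" by (simp add: B.curry_at_def)
    also have "\<dots> = lact (B.C 0) y g [] \<ominus>\<^bsub>?M\<^esub> ract (B.C 0) g y []"
      using g by (simp add: B.curry_diff B.C_minus_apply)
    also have "\<dots> = \<kappa> 0" by (simp add: B.C_simps u simps \<epsilon>)
    finally show False using injD[OF \<kappa>, of 1 0] by (simp add: f_def \<beta>)
  qed
  ultimately show ?thesis using B B.HH_nontrivial_if[of f 0] unfolding HH_nonzero_degree_def by auto
qed

text \<open>The cocycle is the product of \<open>\<alpha>\<close> and \<open>\<beta>\<close>. On a coboundary \<open>d g\<close> the values at \<open>(x, y)\<close> and \<open>(y, x)\<close> are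
  \<open>- g(x y)\<close> and \<open>- g(x) / a - g(y x)\<close>, which agree by the relation; the product takes the values \<open>1\<close> and \<open>0\<close>.\<close>

lemma HH_two_nontrivial:
  fixes \<kappa> :: "complex \<Rightarrow> 'm"
  assumes \<kappa>: "inj \<kappa>" and a: "a \<noteq> 0"
  shows "HH_nonzero_degree TYPE('m) complex_ring A 2"
proof -
  obtain \<epsilon> where \<epsilon>: "\<epsilon> \<in> linear_maps complex_ring A scalar_module" "\<epsilon> \<one>\<^bsub>A\<^esub> = 1"
    "\<And>b c. b \<in> carrier A \<Longrightarrow> c \<in> carrier A \<Longrightarrow> \<epsilon> (b \<otimes>\<^bsub>A\<^esub> c) = \<epsilon> b * \<epsilon> c" "\<epsilon> x = 0" "\<epsilon> y = 0"
    by (rule character_exists[of 0]) (rule that; assumption)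
  obtain \<chi> where \<chi>: "\<chi> \<in> linear_maps complex_ring A scalar_module" "\<chi> \<one>\<^bsub>A\<^esub> = 1"
    "\<And>b c. b \<in> carrier A \<Longrightarrow> c \<in> carrier A \<Longrightarrow> \<chi> (b \<otimes>\<^bsub>A\<^esub> c) = \<chi> b * \<chi> c" "\<chi> x = 0" "\<chi> y = - 1 / a"
    by (rule character_exists[of "- 1 / a"]) (rule that; assumption)
  obtain \<alpha> where \<alpha>: "\<alpha> \<in> linear_maps complex_ring A scalar_module" "\<alpha> x = 1" "\<alpha> y = 0"
    "\<And>b c. b \<in> carrier A \<Longrightarrow> c \<in> carrier A \<Longrightarrow> \<alpha> (b \<otimes>\<^bsub>A\<^esub> c) = \<chi> b * \<alpha> c + \<alpha> b * \<epsilon> c"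
    by (rule skew_derivation_exists[OF \<epsilon> \<chi>, of 1 0]; (assumption | (rule that; assumption) | simp add: a))
  obtain \<beta> where \<beta>: "\<beta> \<in> linear_maps complex_ring A scalar_module" "\<beta> x = 0" "\<beta> y = 1"
    "\<And>b c. b \<in> carrier A \<Longrightarrow> c \<in> carrier A \<Longrightarrow> \<beta> (b \<otimes>\<^bsub>A\<^esub> c) = \<epsilon> b * \<beta> c + \<beta> b * \<epsilon> c"
    by (rule skew_derivation_exists[OF \<epsilon> \<epsilon>, of 0 1]; (assumption | (rule that; assumption) | simp))
  let ?M = "character_bimodule \<kappa> \<chi> \<epsilon>"
  have B: "bimodule complex_ring A ?M"
    by (rule bimodule_character_bimodule[OF \<kappa> assoc_algebra_axioms]) (use \<epsilon> \<chi> in auto)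
  interpret B: bimodule complex_ring A ?M by (rule B)
  note simps = character_bimodule_simps[OF \<kappa>, of \<chi> \<epsilon>] character_bimodule_minus[OF \<kappa> B.M.M.abelian_group_axioms]
  define f where "f = (\<lambda>as\<in>tuples A (Suc (Suc 0)). \<kappa> (\<alpha> (as ! 0) * \<beta> (as ! 1)))"
  have fC: "f \<in> carrier (B.C (Suc (Suc 0)))" unfolding f_def
    by (rule B.restrict_cochainI)
      (auto elim!: tuples_SucE simp: simps linear_maps_add[OF \<alpha>(1)] linear_maps_smult[OF \<alpha>(1)]
        linear_maps_add[OF \<beta>(1)] linear_maps_smult[OF \<beta>(1)] less_Suc_eq algebra_simps)
  have "lact (B.C (Suc (Suc 0))) b f = ract (B.C (Suc (Suc 0))) f b" if b: "b \<in> carrier A" for b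
    unfolding B.C_simps cochain_ract.simps
    by (rule restrict_ext) (use b in \<open>auto elim!: tuples_SucE simp: f_def simps \<alpha> \<beta> algebra_simps\<close>)
  then have "f \<in> hochschild_cocycles complex_ring A ?M (Suc (Suc 0))" using fC by (simp add: B.cocycle_iff)
  moreover have "f \<notin> hochschild_coboundaries complex_ring A ?M (Suc (Suc 0))"
  proof
    assume "f \<in> hochschild_coboundaries complex_ring A ?M (Suc (Suc 0))"
    then obtain g where g: "g \<in> carrier (B.C (Suc 0))" "f = hochschild_diff A ?M (Suc 0) g" by (auto simp: B.C_simps(1))
    interpret N: weak_bimodule complex_ring A "B.C (Suc 0)" by (rule B.weak_bimodule_C)
    define G where "G b = inv_into UNIV \<kappa> (g [b])" for b
    have g_eq: "g [b] = \<kappa> (G b)" if "b \<in> carrier A" for b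
      using B.cochain_closed[OF g(1), of "[b]"] that by (auto simp: G_def simps inv_f_f[OF \<kappa>])
    have G_add: "G (b \<oplus>\<^bsub>A\<^esub> c) = G b + G c" if "b \<in> carrier A" "c \<in> carrier A" for b c
      using B.cochain_Cons_add[OF g(1), of b c "[]"] that injD[OF \<kappa>] by (simp add: g_eq simps)
    have G_smult: "G (r \<odot>\<^bsub>A\<^esub> b) = r * G b" if "b \<in> carrier A" for b r
      using B.cochain_Cons_smult[OF g(1), of b r "[]"] that injD[OF \<kappa>] by (simp add: g_eq simps)
    have f_eq: "\<alpha> b * \<beta> c = \<chi> b * G c - G (b \<otimes>\<^bsub>A\<^esub> c) + G b * \<epsilon> c" if bc: "b \<in> carrier A" "c \<in> carrier A" for b c
    proof -
      have "f [b, c] = B.curry_at (Suc 0) f b [c]" using bc by (simp add: B.curry_at_def)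
      also have "\<dots> = lact (B.C (Suc 0)) b g [c] \<ominus>\<^bsub>?M\<^esub> ract (B.C (Suc 0)) g b [c]"
        using g bc by (simp add: B.curry_diff B.C_minus_apply)
      also have "\<dots> = \<kappa> (\<chi> b * G c - G (b \<otimes>\<^bsub>A\<^esub> c) + G b * \<epsilon> c)"
        using bc by (simp add: B.C_simps g_eq simps algebra_simps)
      finally show ?thesis using bc injD[OF \<kappa>] by (simp add: f_def)
    qed
    have "- G (x \<otimes>\<^bsub>A\<^esub> y) = 1" "a * G (y \<otimes>\<^bsub>A\<^esub> x) = - G x"
      using f_eq[of x y] f_eq[of y x] a by (simp_all add: \<alpha> \<beta> \<epsilon> \<chi> field_simps)
    moreover have "a * G (x \<otimes>\<^bsub>A\<^esub> y) = a * G (y \<otimes>\<^bsub>A\<^esub> x) + G x"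
      using arg_cong[OF relation, of G] by (simp add: G_add G_smult)
    ultimately show False using a by auto
  qed
  ultimately show ?thesis using B B.HH_nontrivial_if[of f "Suc 0"] unfolding HH_nonzero_degree_def by (auto simp: numeral_2_eq_2)
qed

end

section \<open>The Hochschild dimension of the family\<close>

lemma HCDim_eqI:
  assumes "HH_nonzero_degree U R A n" "\<And>m. m > n \<Longrightarrow> \<not> HH_nonzero_degree U R A m"
  shows "HCDim U R A = enat n"
proof -
  have le: "m \<le> n" if "HH_nonzero_degree U R A m" for m using assms(2)[of m] that by force
  then have "(GREATEST m. HH_nonzero_degree U R A m) = n" using assms(1) by (intro Greatest_equality)
  then show ?thesis using assms(1) le unfolding HCDim_def by auto
qed

theorem theorem1p2:
  assumes "(UNIV :: complex set) \<lesssim> (UNIV :: 'm set)"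
  shows "(\<forall>a. assoc_algebra complex_ring (A_family a)) \<and>
         (\<forall>a. a \<noteq> 0 \<longrightarrow> HCDim TYPE('m) complex_ring (A_family a) = 2) \<and>
         HCDim TYPE('m) complex_ring (A_family 0) = 1"
proof (intro conjI allI impI)
  obtain \<kappa> :: "complex \<Rightarrow> 'm" where \<kappa>: "inj \<kappa>" using assms by (auto simp: lepoll_def)
  show "assoc_algebra complex_ring (A_family a)" for a
  proof -
    interpret family a .
    show ?thesis by (rule assoc_algebra_axioms)
  qed
  show "HCDim TYPE('m) complex_ring (A_family a) = 2" if a: "a \<noteq> 0" for a
  proof -
    have "\<not> HH_nonzero_degree TYPE('m) complex_ring (A_family a) m" if "m > 2" for m
      using that family.HH_vanishes_for_nonzero[OF _ a, of _ "m - 3"]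
      by (auto simp: HH_nonzero_degree_def numeral_3_eq_3 Suc_diff_Suc)
    then show ?thesis
      using HCDim_eqI[OF family.HH_two_nontrivial[OF \<kappa> a]] by (simp add: numeral_eq_enat)
  qed
  have "\<not> HH_nonzero_degree TYPE('m) complex_ring (A_family 0) m" if "m > 1" for m
    using that family.HH_vanishes_for_zero[of 0 _ "m - 2"]
    by (auto simp: HH_nonzero_degree_def numeral_2_eq_2 Suc_diff_Suc)
  then show "HCDim TYPE('m) complex_ring (A_family 0) = 1"
    using HCDim_eqI[OF family.HH_one_nontrivial[OF \<kappa>, of 0]] by (simp add: one_enat_def)
qed

end
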